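(* Let $v\in S_n$ and let $I=[e,z]$ be any hypercube decomposition of the lower interval $[e,v]$. Then the hypercube cluster at every $x\in I$ satisfies property (E), and the hypercube cluster at $e$ relative to $I$ (i) is strong, and (ii) satisfies the numerical criterion.
   Context: $S_n$: symmetric group, $e$ identity, simple reflections $s_i=(i\;i+1)$, length $\ell$, reflections = transpositions. Bruhat graph $\Gamma$: vertices $S_n$, edge $x\to y$ labelled $yx^{-1}$ if $yx^{-1}$ is a reflection and $\ell(x)<\ell(y)$; Bruhat order $x\le y$ iff a directed path exists. $\Gamma(u,v)$: induced subgraph on $[u,v]$; $\ell(u,v)=\ell(v)-\ell(u)$. An $m$-hypercube in $\Gamma(u,v)$: subgraph isomorphic to the upward directed Hasse diagram of a rank-$m$ Boolean lattice, spanned by the endpoints of the edges leaving its bottom vertex; a diamond is a $2$-hypercube. $I$ is diamond-closed if it contains the fourth vertex of any diamond of $\Gamma(u,v)$ of which it contains three. For $x\in I$: $\mathcal{Y}_x=\{y\in[u,v]\setminus I: x\to y\}$, $\mathcal{A}_x$ = antichains (including $\varnothing$) of $(\mathcal{Y}_x,\le)$, and $\Lambda(Y)$ the order ideal of $(\mathcal{Y}_x,\le)$ generated by $Y$. Hypercube cluster at $x$: for each $Y\in\mathcal{A}_x$ a unique hypercube in $\Gamma(u,v)$ with bottom $x$ spanned by $Y$; $\theta_x(Y)$ is its top. A hypercube decomposition of $[u,v]$: $I=[u,z]$ for some $z\in[u,v]$, diamond-closed, with a hypercube cluster at each $x\in I$. Strong: for all $Y_1,Y_2\in\mathcal{A}_x$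 with $|Y_1|=|Y_2|=|Y_1\cap Y_2|+1$, if there is $w$ with edges $\theta_x(Y_1\cap Y_2)\to\theta_x(Y_i)\to w$ ($i=1,2$) in $\Gamma(u,v)$, then $Y_1\cup Y_2$ is an antichain and $\theta_x(Y_1\cup Y_2)=w$. Numerical criterion: $\frac{\ell(x,\theta_x(Y))+|Y|}{2}=|\Lambda(Y)|$ for all $Y\in\mathcal{A}_x$. A reflection order is a total order $\prec$ on transpositions such that for all $a<b<c$, either $(a\,b)\prec(a\,c)\prec(b\,c)$ or $(b\,c)\prec(a\,c)\prec(a\,b)$. Property (E) at $x$: there is a reflection order $\prec$ such that whenever $x_1\xrightarrow{t_1}x_2$ and $x_3\xrightarrow{t_2}y$ are edges with $x_1,x_2,x_3\in I\cap[x,v]$ and $y\in[x,v]\setminus I$, then $t_1\prec t_2$. *)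

theory Defs
  imports "HOL-Combinatorics.Permutations" "Graph_Theory.Graph_Theory"
begin

type_synonym perm = "nat \<Rightarrow> nat"

definition Sym :: "nat \<Rightarrow> perm set" where
  "Sym n = {p. p permutes {1..n}}"

definition simple_reflections :: "nat \<Rightarrow> perm set" where
  "simple_reflections n = {Transposition.transpose i (i + 1) | i. 1 \<le> i \<and> i < n}"

definition reflections :: "nat \<Rightarrow> perm set" where
  "reflections n = {Transposition.transpose a b | a b. 1 \<le> a \<and> a < b \<and> b \<le> n}"

definition len :: "nat \<Rightarrow> perm \<Rightarrow> nat" where
  "len n w = (LEAST k. \<exists>ss. length ss = k \<and> set ss \<subseteq> simple_reflections n \<and> w = foldr (\<circ>) ss id)"

definition len2 :: "nat \<Rightarrow> perm \<Rightarrow> perm \<Rightarrow> int" where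
  "len2 n x y = int (len n y) - int (len n x)"

text \<open>Products in the symmetric group are compositions of functions, right factor first.\<close>

definition label :: "perm \<Rightarrow> perm \<Rightarrow> perm" where
  "label x y = y \<circ> inv x"

text \<open>An edge is determined by its end points, so labels are not stored in the graph.\<close>

definition bruhat_graph :: "nat \<Rightarrow> perm pair_pre_digraph" where
  "bruhat_graph n =
     \<lparr> pverts = Sym n,
       parcs = {(x, y). x \<in> Sym n \<and> y \<in> Sym n \<and> label x y \<in> reflections n \<and> len n x < len n y} \<rparr>"

definition bruhat_le :: "nat \<Rightarrow> perm \<Rightarrow> perm \<Rightarrow> bool" where
  "bruhat_le n x y \<longleftrightarrow> x \<rightarrow>\<^sup>*\<^bsub>with_proj (bruhat_graph n)\<^esub> y"

definition interval :: "nat \<Rightarrow> perm \<Rightarrow> perm \<Rightarrow> perm set" where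
  "interval n u v = {x. bruhat_le n u x \<and> bruhat_le n x v}"

definition bruhat_interval_graph :: "nat \<Rightarrow> perm \<Rightarrow> perm \<Rightarrow> (perm, perm \<times> perm) pre_digraph" where
  "bruhat_interval_graph n u v = with_proj (bruhat_graph n) \<restriction> interval n u v"

definition boolean_hasse :: "nat \<Rightarrow> nat set pair_pre_digraph" where
  "boolean_hasse m =
     \<lparr> pverts = Pow {..<m},
       parcs = {(A, insert i A) | A i. A \<subseteq> {..<m} \<and> i \<in> {..<m} - A} \<rparr>"

text \<open>Subgraphs need not be induced: a hypercube is recorded with both its vertices and its edges.
  The case \<open>m = 0\<close> is a single vertex, which is the hypercube spanned by the empty antichain.\<close>

definition hypercube :: "nat \<Rightarrow> perm \<Rightarrow> perm \<Rightarrow> nat \<Rightarrow> perm pair_pre_digraph \<Rightarrow> bool" where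
  "hypercube n u v m H \<longleftrightarrow>
     subgraph (with_proj H) (bruhat_interval_graph n u v) \<and>
     digraph_iso (with_proj (boolean_hasse m)) (with_proj H)"

text \<open>The descriptions below are proper only for a hypercube, which has exactly one source and exactly
  one sink.\<close>

definition bottom :: "perm pair_pre_digraph \<Rightarrow> perm" where
  "bottom H = (THE x. x \<in> pverts H \<and> (\<forall>y. (y, x) \<notin> parcs H))"

definition top_vertex :: "perm pair_pre_digraph \<Rightarrow> perm" where
  "top_vertex H = (THE x. x \<in> pverts H \<and> (\<forall>y. (x, y) \<notin> parcs H))"

definition spanning_set :: "perm pair_pre_digraph \<Rightarrow> perm set" where
  "spanning_set H = {y. (bottom H, y) \<in> parcs H}"

definition diamond_closed :: "nat \<Rightarrow> perm \<Rightarrow> perm \<Rightarrow> perm set \<Rightarrow> bool" where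
  "diamond_closed n u v I \<longleftrightarrow>
     (\<forall>H p. hypercube n u v 2 H \<and> p \<in> pverts H \<and> pverts H - {p} \<subseteq> I \<longrightarrow> p \<in> I)"

text \<open>The sets $\mathcal{Y}_x$ (\<open>upper_nbrs\<close>), $\mathcal{A}_x$ (\<open>antichains\<close>) and $\Lambda(Y)$
  (\<open>order_ideal\<close>); the order on $\mathcal{Y}_x$ is the restriction of Bruhat order.\<close>

definition upper_nbrs :: "nat \<Rightarrow> perm \<Rightarrow> perm \<Rightarrow> perm set \<Rightarrow> perm \<Rightarrow> perm set" where
  "upper_nbrs n u v I x = {y \<in> interval n u v - I. (x, y) \<in> parcs (bruhat_graph n)}"

definition antichains :: "nat \<Rightarrow> perm \<Rightarrow> perm \<Rightarrow> perm set \<Rightarrow> perm \<Rightarrow> perm set set" where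
  "antichains n u v I x =
     {Y. Y \<subseteq> upper_nbrs n u v I x \<and> pairwise (\<lambda>y y'. \<not> bruhat_le n y y') Y}"

definition order_ideal ::
  "nat \<Rightarrow> perm \<Rightarrow> perm \<Rightarrow> perm set \<Rightarrow> perm \<Rightarrow> perm set \<Rightarrow> perm set" where
  "order_ideal n u v I x Y = {y \<in> upper_nbrs n u v I x. \<exists>y'\<in>Y. bruhat_le n y y'}"

definition hypercube_at ::
  "nat \<Rightarrow> perm \<Rightarrow> perm \<Rightarrow> perm \<Rightarrow> perm set \<Rightarrow> perm pair_pre_digraph \<Rightarrow> bool" where
  "hypercube_at n u v x Y H \<longleftrightarrow>
     (\<exists>m. hypercube n u v m H) \<and> bottom H = x \<and> spanning_set H = Y"

definition hypercube_cluster :: "nat \<Rightarrow> perm \<Rightarrow> perm \<Rightarrow> perm set \<Rightarrow> perm \<Rightarrow> bool" where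
  "hypercube_cluster n u v I x \<longleftrightarrow> (\<forall>Y \<in> antichains n u v I x. \<exists>!H. hypercube_at n u v x Y H)"

text \<open>Meaningful only if the hypercube is unique, in particular for the antichains at a vertex that
  carries a hypercube cluster.\<close>

definition theta :: "nat \<Rightarrow> perm \<Rightarrow> perm \<Rightarrow> perm \<Rightarrow> perm set \<Rightarrow> perm" where
  "theta n u v x Y = top_vertex (THE H. hypercube_at n u v x Y H)"

definition hypercube_decomposition :: "nat \<Rightarrow> perm \<Rightarrow> perm \<Rightarrow> perm set \<Rightarrow> bool" where
  "hypercube_decomposition n u v I \<longleftrightarrow>
     (\<exists>z \<in> interval n u v. I = interval n u z) \<and>
     diamond_closed n u v I \<and>
     (\<forall>x \<in> I. hypercube_cluster n u v I x)"

definition strong_cluster :: "nat \<Rightarrow> perm \<Rightarrow> perm \<Rightarrow> perm set \<Rightarrow> perm \<Rightarrow> bool" where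
  "strong_cluster n u v I x \<longleftrightarrow>
     (\<forall>Y1 \<in> antichains n u v I x. \<forall>Y2 \<in> antichains n u v I x.
        card Y1 = card Y2 \<and> card Y2 = card (Y1 \<inter> Y2) + 1 \<longrightarrow>
        (\<forall>w. (\<forall>Y \<in> {Y1, Y2}.
                (theta n u v x (Y1 \<inter> Y2), theta n u v x Y) \<in> arcs (bruhat_interval_graph n u v) \<and>
                (theta n u v x Y, w) \<in> arcs (bruhat_interval_graph n u v)) \<longrightarrow>
             Y1 \<union> Y2 \<in> antichains n u v I x \<and> theta n u v x (Y1 \<union> Y2) = w))"

definition numerical_criterion :: "nat \<Rightarrow> perm \<Rightarrow> perm \<Rightarrow> perm set \<Rightarrow> perm \<Rightarrow> bool" where
  "numerical_criterion n u v I x \<longleftrightarrow>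
     (\<forall>Y \<in> antichains n u v I x.
        (rat_of_int (len2 n x (theta n u v x Y)) + rat_of_nat (card Y)) / 2
          = rat_of_nat (card (order_ideal n u v I x Y)))"

definition reflection_order :: "nat \<Rightarrow> perm rel \<Rightarrow> bool" where
  "reflection_order n r \<longleftrightarrow>
     r \<subseteq> reflections n \<times> reflections n \<and>
     strict_linear_order_on (reflections n) r \<and>
     (\<forall>a b c. 1 \<le> a \<and> a < b \<and> b < c \<and> c \<le> n \<longrightarrow>
        (let ab = Transposition.transpose a b;
             ac = Transposition.transpose a c;
             bc = Transposition.transpose b c
         in ((ab, ac) \<in> r \<and> (ac, bc) \<in> r) \<or> ((bc, ac) \<in> r \<and> (ac, ab) \<in> r)))"

text \<open>The property does not depend on the lower end of the ambient interval.\<close>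

definition property_E :: "nat \<Rightarrow> perm \<Rightarrow> perm set \<Rightarrow> perm \<Rightarrow> bool" where
  "property_E n v I x \<longleftrightarrow>
     (\<exists>r. reflection_order n r \<and>
        (\<forall>x1 \<in> I \<inter> interval n x v. \<forall>x2 \<in> I \<inter> interval n x v. \<forall>x3 \<in> I \<inter> interval n x v.
         \<forall>y \<in> interval n x v - I.
           (x1, x2) \<in> parcs (bruhat_graph n) \<and> (x3, y) \<in> parcs (bruhat_graph n) \<longrightarrow>
           (label x1 x2, label x3 y) \<in> r))"

end

theory Submission
  imports Defs "HOL-Library.Product_Lexorder"
begin

text \<open>Every permutation with at least two inversions is the top of a diamond, so diamond-closedness makes
  \<open>I\<close> the intersection of \<open>[e, v]\<close> with a parabolic subgroup \<open>W_J\<close>. Labels of edges inside \<open>I\<close> then lie in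
  \<open>W_J\<close> and labels of edges leaving \<open>I\<close> do not, and a reflection order that starts with the reflections of
  \<open>W_J\<close> gives property (E).

  A reflection \<open>(a c)\<close> is identified with the interval \<open>[a, c]\<close>; it lies below \<open>v\<close> iff \<open>v\<close> maps some
  \<open>k \<le> a\<close> to a value \<open>\<ge> c\<close> (\<open>v\<close> rises across \<open>[a, c]\<close>) and some \<open>k \<ge> c\<close> to a value \<open>\<le> a\<close> (\<open>v\<close> falls). The
  clusters at \<open>e\<close> and at a few explicit elements of \<open>I\<close> show that for \<open>(a c) \<le> v\<close> outside \<open>I\<close> exactly one
  simple reflection in \<open>[a, c]\<close> is missing from \<open>J\<close>, and that it sits at an end of \<open>[a, c]\<close>. Hence two
  crossing members \<open>[a, c], [b, d]\<close> of an antichain satisfy \<open>c = b + 1\<close> and share their missing reflection.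

  Along a cube, the label in a given direction is a transposition whose two points stay in the orbits of
  the two points of the corresponding atom. Removing the rightmost member of an antichain therefore
  changes the top by one explicit transposition, and the numerical criterion follows by induction. For
  strength, the label calculus leaves two candidates for the top of a diamond; a wrong candidate yields a
  rising and a falling strand, hence a reflection below \<open>v\<close> with two missing simple reflections.\<close>

section \<open>Length and inversions\<close>

text \<open>The recurring contradiction has one form. Ranks grow along Bruhat order, so a rising
  strand of one element below \<open>v\<close> and a falling strand of another, across the same
  interval, both survive in \<open>v\<close> and put that reflection below \<open>v\<close>;
  \<open>cut_once\<close> then forbids it to be cut on both sides of an inner point. Strands thus
  replace the comparison of whole permutations: it suffices to follow one or two values through a
  cube.

  The obstacle is that the atoms do not determine the labels of a cube, since opposite sides of a
  diamond may be conjugate instead of equal. The orbits that confine the labels are never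
  constructed. They are handled through sets \<open>S\<close> containing both or neither of the ends
  of each atom involved, and the work lies in finding small such sets: a singleton, a half line, one
  of these with one extra point, or all points of a pattern. The crossing analysis of antichains
  provides them.

  Clusters at elements of \<open>I\<close> other than \<open>id\<close> enter only through
  \<open>triple_top\<close>: the face of two atoms is nearly determined, and the third atom then has
  no room left.\<close>

definition invs :: "perm \<Rightarrow> (nat \<times> nat) set" where
  "invs w = {(i, j). i < j \<and> w j < w i}"

lemma Sym_id [simp]: "id \<in> Sym n"
  by (simp add: Sym_def permutes_id)

lemma Sym_comp: "x \<in> Sym n \<Longrightarrow> y \<in> Sym n \<Longrightarrow> x \<circ> y \<in> Sym n"
  by (simp add: Sym_def permutes_compose)

lemma Sym_inv: "x \<in> Sym n \<Longrightarrow> inv x \<in> Sym n"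
  by (simp add: Sym_def permutes_inv)

lemma Sym_bij: "x \<in> Sym n \<Longrightarrow> bij x"
  by (simp add: Sym_def permutes_bij)

lemma Sym_eq_iff: "x \<in> Sym n \<Longrightarrow> x i = x j \<longleftrightarrow> i = j"
  using Sym_bij bij_is_inj inj_eq by metis

lemma Sym_inv_f [simp]: "x \<in> Sym n \<Longrightarrow> inv x (x i) = i"
  using Sym_bij bij_is_inj inv_f_f by metis

lemma Sym_f_inv [simp]: "x \<in> Sym n \<Longrightarrow> x (inv x i) = i"
  using Sym_bij bij_is_surj surj_f_inv_f by metis

lemma Sym_transpose:
  "1 \<le> a \<Longrightarrow> a \<le> n \<Longrightarrow> 1 \<le> b \<Longrightarrow> b \<le> n \<Longrightarrow> Transposition.transpose a b \<in> Sym n"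
  by (simp add: Sym_def permutes_swap_id)

lemma Sym_in_iff: "x \<in> Sym n \<Longrightarrow> x i \<in> {1..n} \<longleftrightarrow> i \<in> {1..n}"
  unfolding Sym_def by (metis mem_Collect_eq permutes_in_image)

lemma Sym_fix: "x \<in> Sym n \<Longrightarrow> i \<notin> {1..n} \<Longrightarrow> x i = i"
  by (simp add: Sym_def permutes_not_in)

lemma invs_range: "w \<in> Sym n \<Longrightarrow> invs w \<subseteq> {1..n} \<times> {1..n}"
proof -
  assume w: "w \<in> Sym n"
  have "i \<in> {1..n} \<and> j \<in> {1..n}" if "i < j" "w j < w i" for i j
    using that Sym_fix[OF w, of i] Sym_fix[OF w, of j] Sym_in_iff[OF w, of i] Sym_in_iff[OF w, of j]
    by (cases "i \<in> {1..n}"; cases "j \<in> {1..n}") auto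
  then show ?thesis by (auto simp: invs_def)
qed

lemma finite_invs: "w \<in> Sym n \<Longrightarrow> finite (invs w)"
  using invs_range finite_subset by blast

text \<open>An increasing self-map of the naturals lies above the identity; applied to
  \<open>w\<close> and to its inverse this leaves only the identity.\<close>

lemma invs_empty_imp_id:
  assumes "w \<in> Sym n" "invs w = {}"
  shows "w = id"
proof -
  have "strict_mono w"
  proof (rule strict_monoI)
    fix i j :: nat assume "i < j"
    moreover from this have "w i \<noteq> w j" using Sym_eq_iff[OF assms(1)] by simp
    moreover have "\<not> w j < w i" using \<open>i < j\<close> assms(2) by (auto simp: invs_def)
    ultimately show "w i < w j" by simp
  qed
  then have "\<And>k. k \<le> w k"
    by (rule strict_mono_imp_increasing)
  moreover have "\<And>k. k \<le> inv w k"
  proof -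
    have "strict_mono (inv w)"
      using \<open>strict_mono w\<close> by (intro strict_monoI) (metis Sym_f_inv assms(1) strict_mono_less)
    then show "k \<le> inv w k" for k by (rule strict_mono_imp_increasing)
  qed
  ultimately show ?thesis
    by (intro ext) (metis Sym_inv_f assms(1) id_apply le_antisym)
qed

text \<open>\<open>?s\<close> preserves the order of every pair of positions except
  \<open>i, Suc i\<close>, so it carries the inversions of \<open>w\<close> to all inversions of the
  product but that one.\<close>

lemma card_invs_adjacent:
  assumes w: "w \<in> Sym n" and "1 \<le> i" "i < n" and asc: "w i < w (Suc i)"
  shows "card (invs (w \<circ> Transposition.transpose i (Suc i))) = Suc (card (invs w))"
proof -
  let ?s = "Transposition.transpose i (Suc i)"
  have "invs (w \<circ> ?s) = insert (i, Suc i) (map_prod ?s ?s ` invs w)"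
  proof (intro set_eqI iffI)
    fix p assume p: "p \<in> invs (w \<circ> ?s)"
    obtain k l where [simp]: "p = (k, l)" by force
    have kl: "k < l" "w (?s l) < w (?s k)" using p by (auto simp: invs_def)
    show "p \<in> insert (i, Suc i) (map_prod ?s ?s ` invs w)"
    proof (cases "k = i \<and> l = Suc i")
      case False
      then have "?s k < ?s l" using kl(1) by (auto simp: transpose_def)
      then have "(?s k, ?s l) \<in> invs w" using kl(2) by (auto simp: invs_def)
      then show ?thesis by (force simp: image_iff)
    qed simp
  next
    fix p assume "p \<in> insert (i, Suc i) (map_prod ?s ?s ` invs w)"
    then consider "p = (i, Suc i)" | k l where "(k, l) \<in> invs w" "p = (?s k, ?s l)" by auto
    then show "p \<in> invs (w \<circ> ?s)"
    proof cases
      case 1 then show ?thesis using asc by (auto simp: invs_def)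
    next
      case 2
      then have "k < l" "w l < w k" by (auto simp: invs_def)
      moreover from this asc have "\<not> (k = i \<and> l = Suc i)" by auto
      ultimately have "?s k < ?s l" by (auto simp: transpose_def)
      then show ?thesis using 2 by (auto simp: invs_def)
    qed
  qed
  moreover have "(i, Suc i) \<notin> map_prod ?s ?s ` invs w"
  proof
    assume "(i, Suc i) \<in> map_prod ?s ?s ` invs w"
    then obtain k l where "(k, l) \<in> invs w" "?s k = i" "?s l = Suc i" by auto
    then have "k = Suc i" "l = i" "k < l"
      by (auto simp: invs_def transpose_eq_iff)
    then show False by simp
  qed
  moreover have "inj_on (map_prod ?s ?s) (invs w)"
    by (intro inj_on_subset[OF prod.inj_map]) auto
  ultimately show ?thesis
    using finite_invs[OF w] by (simp add: card_image)
qed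

lemma card_invs_adjacent':
  assumes w: "w \<in> Sym n" and "1 \<le> i" "i < n" and desc: "w (Suc i) < w i"
  shows "card (invs w) = Suc (card (invs (w \<circ> Transposition.transpose i (Suc i))))"
proof -
  let ?s = "Transposition.transpose i (Suc i)"
  have "w \<circ> ?s \<in> Sym n" using assms by (intro Sym_comp Sym_transpose) auto
  from card_invs_adjacent[OF this assms(2,3)] desc show ?thesis
    by (simp add: comp_assoc)
qed

lemma foldr_comp_Sym: "set ss \<subseteq> simple_reflections n \<Longrightarrow> foldr (\<circ>) ss id \<in> Sym n"
proof (induction ss)
  case (Cons s ss)
  then obtain i where "1 \<le> i" "i < n" "s = Transposition.transpose i (i + 1)"
    by (auto simp: simple_reflections_def)
  then have "s \<in> Sym n" by (simp add: Sym_transpose)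
  moreover have "foldr (\<circ>) ss id \<in> Sym n" using Cons.IH Cons.prems by (simp only: list.set insert_subset)
  moreover have "foldr (\<circ>) (s # ss) id = s \<circ> foldr (\<circ>) ss id" by simp
  ultimately show ?case by (metis Sym_comp)
qed simp

lemma foldr_comp_append: "foldr (\<circ>) (xs @ ys) id = foldr (\<circ>) xs id \<circ> foldr (\<circ>) ys id"
  by (induction xs) (auto simp: comp_assoc)

lemma card_invs_word: "set ss \<subseteq> simple_reflections n \<Longrightarrow> card (invs (foldr (\<circ>) ss id)) \<le> length ss"
proof (induction ss rule: rev_induct)
  case Nil
  have "invs id = {}" by (auto simp: invs_def)
  moreover have "foldr (\<circ>) [] id = (id :: perm)" by simp
  ultimately show ?case by (metis card.empty le0)
next
  case (snoc s ss)
  let ?w = "foldr (\<circ>) ss id"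
  obtain i where i: "1 \<le> i" "i < n" "s = Transposition.transpose i (i + 1)"
    using snoc.prems by (auto simp: simple_reflections_def)
  have w: "?w \<in> Sym n" using snoc.prems foldr_comp_Sym by simp
  have "?w i \<noteq> ?w (Suc i)" using w by (simp add: Sym_eq_iff)
  then have "card (invs (?w \<circ> s)) \<le> Suc (card (invs ?w))"
    using card_invs_adjacent[OF w i(1,2)] card_invs_adjacent'[OF w i(1,2)] i(3)
    by (cases "?w i < ?w (Suc i)") auto
  moreover have "foldr (\<circ>) (ss @ [s]) id = ?w \<circ> s"
    by (subst foldr_comp_append) simp
  moreover have "card (invs ?w) \<le> length ss" using snoc.prems by (intro snoc.IH) simp
  ultimately show ?case by (metis Suc_le_mono le_trans length_append_singleton)
qed

lemma has_descent:
  assumes "w \<in> Sym n" "invs w \<noteq> {}"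
  obtains i where "1 \<le> i" "i < n" "w (Suc i) < w i"
proof -
  have "\<exists>i. w (Suc i) < w i"
  proof (rule ccontr)
    assume "\<nexists>i. w (Suc i) < w i"
    then have "mono w" by (intro iffD2[OF mono_iff_le_Suc]) (auto simp: not_less)
    then show False using assms(2) by (auto simp: invs_def mono_def not_le[symmetric] dest: less_imp_le)
  qed
  then obtain i where i: "w (Suc i) < w i" by blast
  then have "(i, Suc i) \<in> invs w" by (simp add: invs_def)
  then show ?thesis using invs_range[OF assms(1)] i that[of i] by auto
qed

lemma reduced_word:
  "w \<in> Sym n \<Longrightarrow> \<exists>ss. length ss = card (invs w) \<and> set ss \<subseteq> simple_reflections n \<and> w = foldr (\<circ>) ss id"
proof (induction "card (invs w)" arbitrary: w)
  case 0
  then have "w = id" using invs_empty_imp_id finite_invs by (metis card_0_eq)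
  with 0 show ?case by (auto intro: exI[of _ "[]"])
next
  case (Suc k)
  then have "invs w \<noteq> {}" by auto
  then obtain i where i: "1 \<le> i" "i < n" "w (Suc i) < w i"
    using has_descent Suc.prems by blast
  let ?s = "Transposition.transpose i (Suc i)"
  have ws: "w \<circ> ?s \<in> Sym n" using i Suc.prems by (intro Sym_comp Sym_transpose) auto
  have c: "card (invs w) = Suc (card (invs (w \<circ> ?s)))"
    using card_invs_adjacent'[OF Suc.prems i] .
  then obtain ss where ss: "length ss = k" "set ss \<subseteq> simple_reflections n" "w \<circ> ?s = foldr (\<circ>) ss id"
    using Suc.hyps(1)[OF _ ws] Suc.hyps(2) by auto
  have "w = (w \<circ> ?s) \<circ> ?s" by (simp add: comp_assoc)
  also have "\<dots> = foldr (\<circ>) (ss @ [?s]) id" by (subst foldr_comp_append) (simp add: ss)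
  finally show ?case
    using ss i Suc.hyps(2) by (intro exI[of _ "ss @ [?s]"]) (auto simp: simple_reflections_def)
qed

lemma len_eq_card_invs:
  assumes "w \<in> Sym n"
  shows "len n w = card (invs w)"
  unfolding len_def using reduced_word[OF assms] card_invs_word
  by (intro Least_equality) auto

lemma len_inv:
  assumes "w \<in> Sym n"
  shows "len n (inv w) = len n w"
proof -
  have "invs (inv w) = (\<lambda>(i, j). (w j, w i)) ` invs w"
    using assms by (auto simp: invs_def image_iff) (metis Sym_f_inv)
  moreover have "inj_on (\<lambda>(i, j). (w j, w i)) (invs w)"
    using assms by (auto simp: inj_on_def Sym_eq_iff)
  ultimately show ?thesis
    using assms by (simp add: len_eq_card_invs Sym_inv card_image)
qed

lemma len_adjacent:
  assumes w: "w \<in> Sym n" and i: "1 \<le> i" "i < n"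
  shows "int (len n (w \<circ> Transposition.transpose i (Suc i))) =
    int (len n w) + (if w i < w (Suc i) then 1 else - 1)"
proof -
  let ?s = "Transposition.transpose i (Suc i)"
  have ws: "w \<circ> ?s \<in> Sym n" using i w by (intro Sym_comp Sym_transpose) auto
  have "w i \<noteq> w (Suc i)" using w by (simp add: Sym_eq_iff)
  then show ?thesis
    using card_invs_adjacent[OF w i] card_invs_adjacent'[OF w i] w ws
    by (cases "w i < w (Suc i)") (auto simp: len_eq_card_invs)
qed

text \<open>Conjugating \<open>(a c)\<close> by the adjacent transposition of \<open>c\<close> and
  \<open>Suc c\<close> moves its right end one step. The two outer factors change the length by 1
  each; they cancel unless \<open>w c\<close> lies strictly between \<open>w a\<close> and
  \<open>w (Suc c)\<close>, when both add 1, and \<open>c\<close> is then the newly counted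
  position.\<close>

lemma len_transpose_right:
  assumes "w \<in> Sym n" and "1 \<le> a" "a < c" "c \<le> n" and "w a < w c"
  shows "len n (w \<circ> Transposition.transpose a c) =
    len n w + 1 + 2 * card {k. a < k \<and> k < c \<and> w a < w k \<and> w k < w c}"
  using assms
proof (induction c arbitrary: w)
  case (Suc c)
  let ?s = "Transposition.transpose c (Suc c)" and ?t = "Transposition.transpose a c"
  let ?K = "\<lambda>w c. {k. a < k \<and> k < c \<and> w a < w k \<and> w k < w c}"
  show ?case
  proof (cases "a = c")
    case True
    then have "?K w (Suc c) = {}" by auto
    moreover have "int (len n (w \<circ> Transposition.transpose a (Suc a))) = int (len n w) + 1"
      using True Suc.prems len_adjacent[OF Suc.prems(1), of a] by simp
    ultimately show ?thesis using True by (simp only: card.empty mult_0_right add_0_right)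
  next
    case False
    then have ac: "a < c" using Suc.prems by simp
    have t: "Transposition.transpose a (Suc c) = ?s \<circ> ?t \<circ> ?s"
      using ac by (auto simp: fun_eq_iff transpose_def)
    define w1 where "w1 = w \<circ> ?s"
    define w2 where "w2 = w1 \<circ> ?t"
    have w1: "w1 \<in> Sym n" and w2: "w2 \<in> Sym n" unfolding w1_def w2_def
      using Suc.prems ac by (auto intro!: Sym_comp Sym_transpose)
    have v1: "w1 a = w a" "w1 c = w (Suc c)" using ac by (auto simp: w1_def transpose_def)
    have v2: "w2 c = w a" "w2 (Suc c) = w c" using ac by (auto simp: w1_def w2_def transpose_def)
    have K: "?K w1 c = ?K w (Suc c) - {c}"
      using ac by (auto simp: w1_def transpose_def less_Suc_eq)
    define C where "C = card (?K w (Suc c) - {c})"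
    have "len n w2 = len n w1 + 1 + 2 * C"
      unfolding w2_def C_def using Suc.IH[OF w1] v1 Suc.prems ac K by (auto simp del: o_apply)
    moreover have "int (len n w1) = int (len n w) + (if w c < w (Suc c) then 1 else - 1)"
      unfolding w1_def using len_adjacent[OF Suc.prems(1), of c] Suc.prems ac by auto
    moreover have "int (len n (w2 \<circ> ?s)) = int (len n w2) + (if w a < w c then 1 else - 1)"
      using len_adjacent[OF w2, of c] v2 Suc.prems ac by auto
    moreover have C: "card (?K w (Suc c)) = C + (if w a < w c \<and> w c < w (Suc c) then 1 else 0)"
    proof (cases "w a < w c \<and> w c < w (Suc c)")
      case True
      then have "c \<in> ?K w (Suc c)" using ac by simp
      with True show ?thesis unfolding C_def by (subst card.remove[of _ c]) auto
    qed (auto simp: C_def)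
    moreover have "w a < w c \<or> w c < w a" "w c < w (Suc c) \<or> w (Suc c) < w c"
      using ac Sym_eq_iff[OF Suc.prems(1), of a c] Sym_eq_iff[OF Suc.prems(1), of c "Suc c"] by auto
    ultimately have "len n (w2 \<circ> ?s) = len n w + 1 + 2 * card (?K w (Suc c))"
      using \<open>w a < w (Suc c)\<close> by (auto simp del: o_apply split: if_splits)
    moreover have "w \<circ> Transposition.transpose a (Suc c) = w2 \<circ> ?s"
      by (simp add: t w2_def w1_def comp_assoc)
    ultimately show ?thesis by (simp only:)
  qed
qed simp

lemma len_transpose_less_iff:
  assumes w: "w \<in> Sym n" and ac: "1 \<le> a" "a < c" "c \<le> n"
  shows "len n w < len n (w \<circ> Transposition.transpose a c) \<longleftrightarrow> w a < w c"
proof (cases "w a < w c")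
  case False
  then have "w c < w a" using w ac by (metis Sym_eq_iff linorder_neqE_nat nat_less_le)
  moreover have "w \<circ> Transposition.transpose a c \<in> Sym n" (is "?u \<in> _")
    using assms by (intro Sym_comp Sym_transpose) auto
  ultimately have "len n (?u \<circ> Transposition.transpose a c) > len n ?u"
    using len_transpose_right[of ?u n a c] ac by simp
  then show ?thesis using False by (simp add: comp_assoc)
qed (use len_transpose_right[OF assms] in simp)

section \<open>Bruhat order\<close>

abbreviation edge :: "nat \<Rightarrow> perm \<Rightarrow> perm \<Rightarrow> bool" where
  "edge n x y \<equiv> (x, y) \<in> parcs (bruhat_graph n)"

lemma transpose_comp_left:
  assumes "x \<in> Sym n"
  shows "Transposition.transpose p q \<circ> x = x \<circ> Transposition.transpose (inv x p) (inv x q)"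
  using assms by (auto simp: fun_eq_iff transpose_def)

lemma transpose_comp_right:
  assumes "x \<in> Sym n"
  shows "x \<circ> Transposition.transpose i j = Transposition.transpose (x i) (x j) \<circ> x"
  using assms by (auto simp: fun_eq_iff transpose_def Sym_eq_iff)

lemma edgeD:
  assumes "edge n x y"
  shows "x \<in> Sym n" "y \<in> Sym n" "len n x < len n y"
  using assms by (auto simp: bruhat_graph_def)

lemma edge_right_iff:
  assumes x: "x \<in> Sym n" and ij: "1 \<le> i" "i < j" "j \<le> n"
  shows "edge n x (x \<circ> Transposition.transpose i j) \<longleftrightarrow> x i < x j"
proof -
  let ?y = "x \<circ> Transposition.transpose i j"
  have y: "?y \<in> Sym n" using assms by (intro Sym_comp Sym_transpose) auto
  have "label x ?y = Transposition.transpose (x i) (x j)"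
    using x unfolding label_def transpose_comp_right[OF x] by (auto simp: fun_eq_iff)
  moreover have "Transposition.transpose (x i) (x j) \<in> reflections n"
  proof -
    have "x i \<in> {1..n}" "x j \<in> {1..n}" "x i \<noteq> x j"
      using Sym_in_iff[OF x, of i] Sym_in_iff[OF x, of j] Sym_eq_iff[OF x, of i j] ij by auto
    then show ?thesis unfolding reflections_def
      by (cases "x i < x j") (force simp: transpose_commute)+
  qed
  ultimately show ?thesis
    using x y len_transpose_less_iff[OF x ij] by (simp add: bruhat_graph_def)
qed

lemma edge_leftD:
  assumes "edge n x y"
  obtains p q where "1 \<le> p" "p < q" "q \<le> n" "inv x p < inv x q" "y = Transposition.transpose p q \<circ> x"
proof -
  have x: "x \<in> Sym n" using assms edgeD by blast
  have "label x y \<in> reflections n" using assms by (simp add: bruhat_graph_def)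
  then obtain p q where pq: "1 \<le> p" "p < q" "q \<le> n" "y \<circ> inv x = Transposition.transpose p q"
    by (auto simp: reflections_def label_def)
  have y: "y = Transposition.transpose p q \<circ> x"
    using x unfolding pq(4)[symmetric] by (auto simp: fun_eq_iff)
  have "inv x p \<in> {1..n}" "inv x q \<in> {1..n}" "inv x p \<noteq> inv x q"
    using pq Sym_in_iff[OF Sym_inv[OF x], of p] Sym_in_iff[OF Sym_inv[OF x], of q] Sym_eq_iff[OF Sym_inv[OF x], of p q] by auto
  moreover have "\<not> inv x q < inv x p"
  proof
    assume "inv x q < inv x p"
    moreover have "y = x \<circ> Transposition.transpose (inv x q) (inv x p)"
      using y transpose_comp_left[OF x] by (simp only: transpose_commute)
    ultimately show False
      using edge_right_iff[OF x, of "inv x q" "inv x p"] assms \<open>inv x p \<in> {1..n}\<close> \<open>inv x q \<in> {1..n}\<close> x pq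
      by (simp del: o_apply)
  qed
  ultimately show ?thesis using that pq y by simp
qed

lemma edge_rightD:
  assumes "edge n x y"
  obtains i j where "1 \<le> i" "i < j" "j \<le> n" "x i < x j" "y = x \<circ> Transposition.transpose i j"
proof -
  have x: "x \<in> Sym n" using assms edgeD by blast
  obtain p q where pq: "1 \<le> p" "p < q" "q \<le> n" "inv x p < inv x q" "y = Transposition.transpose p q \<circ> x"
    using edge_leftD[OF assms] .
  have "inv x p \<in> {1..n}" "inv x q \<in> {1..n}"
    using pq Sym_in_iff[OF Sym_inv[OF x], of p] Sym_in_iff[OF Sym_inv[OF x], of q] by auto
  then show ?thesis using that[of "inv x p" "inv x q"] pq transpose_comp_left[OF x] x by auto
qed

text \<open>Inversion turns left factors into right factors and keeps the length. This later carries
  monotonicity from rising to falling strands.\<close>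

lemma edge_inv:
  assumes "edge n x y"
  shows "edge n (inv x) (inv y)"
proof -
  have x: "x \<in> Sym n" using assms edgeD by blast
  obtain p q where pq: "1 \<le> p" "p < q" "q \<le> n" "inv x p < inv x q" "y = Transposition.transpose p q \<circ> x"
    using edge_leftD[OF assms] .
  have "inv y = inv x \<circ> Transposition.transpose p q"
    unfolding pq(5) using Sym_bij[OF x] by (subst o_inv_distrib) auto
  then show ?thesis using edge_right_iff[OF Sym_inv[OF x] pq(1-3)] pq(4) by simp
qed

lemma bruhat_le_refl: "x \<in> Sym n \<Longrightarrow> bruhat_le n x x"
  by (simp add: bruhat_le_def reachable_def bruhat_graph_def)

lemma edge_imp_bruhat_le: "edge n x y \<Longrightarrow> bruhat_le n x y"
  unfolding bruhat_le_def reachable_def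
  by (rule rtrancl_on_into_rtrancl_on[of x x]) (auto simp: bruhat_graph_def)

lemma bruhat_le_trans: "bruhat_le n x y \<Longrightarrow> bruhat_le n y z \<Longrightarrow> bruhat_le n x z"
  unfolding bruhat_le_def reachable_def by (rule rtrancl_on_trans)

lemma bruhat_le_Sym: "bruhat_le n x y \<Longrightarrow> x \<in> Sym n \<and> y \<in> Sym n"
  unfolding bruhat_le_def by (auto elim: reachable_in_vertsE simp: bruhat_graph_def)

lemma bruhat_le_induct [consumes 1, case_names refl step]:
  assumes "bruhat_le n x y" and "x \<in> Sym n \<Longrightarrow> P x"
    and "\<And>y z. bruhat_le n x y \<Longrightarrow> edge n y z \<Longrightarrow> P y \<Longrightarrow> P z"
  shows "P y"
  using assms(1) unfolding bruhat_le_def reachable_def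
proof (induction rule: rtrancl_on_induct)
  case base
  then show ?case using assms(2) by (simp add: bruhat_graph_def)
next
  case (step y z)
  then show ?case using assms(3)[of y z] by (simp add: bruhat_le_def reachable_def)
qed

lemma bruhat_le_inv: "bruhat_le n x y \<Longrightarrow> bruhat_le n (inv x) (inv y)"
  by (induction rule: bruhat_le_induct)
    (auto intro: bruhat_le_refl Sym_inv bruhat_le_trans edge_imp_bruhat_le edge_inv)

subsection \<open>The rank matrix\<close>

text \<open>The rank matrix of the tableau criterion, with positions counted from 0. Elements of
  \<open>Sym n\<close> fix 0, and the matrix of the identity is \<open>p + 1 - q\<close> in
  truncated subtraction.\<close>

definition rk :: "perm \<Rightarrow> nat \<Rightarrow> nat \<Rightarrow> nat" where
  "rk w p q = card {l. l \<le> p \<and> q \<le> w l}"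

lemma rk_transpose_outside:
  assumes "i < j" "p < i \<or> j \<le> p"
  shows "rk (x \<circ> Transposition.transpose i j) p q = rk x p q"
proof -
  let ?t = "Transposition.transpose i j"
  have "{l. l \<le> p \<and> q \<le> (x \<circ> ?t) l} = ?t ` {l. l \<le> p \<and> q \<le> x l}"
  proof (intro set_eqI iffI)
    fix l assume "l \<in> {l. l \<le> p \<and> q \<le> (x \<circ> ?t) l}"
    then have "?t l \<in> {l. l \<le> p \<and> q \<le> x l}" using assms by (auto simp: transpose_def)
    then show "l \<in> ?t ` {l. l \<le> p \<and> q \<le> x l}" by (force simp: image_iff)
  qed (use assms in \<open>auto simp: transpose_def\<close>)
  then show ?thesis by (simp add: rk_def card_image)
qed

lemma rk_edge:
  assumes "edge n x y"
  shows "rk x p q \<le> rk y p q"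
proof -
  obtain i j where ij: "i < j" "x i < x j" "y = x \<circ> Transposition.transpose i j"
    using edge_rightD[OF assms] .
  show ?thesis
  proof (cases "p < i \<or> j \<le> p")
    case False
    then have "{l. l \<le> p \<and> q \<le> x l} \<subseteq> {l. l \<le> p \<and> q \<le> y l}"
      using ij by (auto simp: transpose_def)
    then show ?thesis unfolding rk_def by (intro card_mono) auto
  qed (use rk_transpose_outside ij in auto)
qed

lemma bruhat_le_rk: "bruhat_le n x y \<Longrightarrow> rk x p q \<le> rk y p q"
  by (induction rule: bruhat_le_induct) (auto dest: rk_edge[of _ _ _ p q])

lemma len_le_square: "w \<in> Sym n \<Longrightarrow> len n w \<le> n * n"
  using card_mono[OF _ invs_range[of w n]] by (simp add: len_eq_card_invs)

lemma rk_split: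
  assumes "q \<le> r"
  shows "rk w p q = rk w p r + card {l. l \<le> p \<and> q \<le> w l \<and> w l < r}"
proof -
  have "{l. l \<le> p \<and> q \<le> w l} = {l. l \<le> p \<and> r \<le> w l} \<union> {l. l \<le> p \<and> q \<le> w l \<and> w l < r}"
    using assms by auto
  then show ?thesis unfolding rk_def by (simp add: card_Un_disjoint disjoint_iff)
qed

text \<open>The hard half of the rank criterion, by climbing from \<open>x\<close> towards
  \<open>y\<close>. At the first position \<open>i\<close> of disagreement \<open>x i < y i\<close>;
  exchanging it with the nearest later position whose value is above \<open>x i\<close> and at most
  \<open>y i\<close> keeps all ranks below those of \<open>y\<close>. Lengths are at most
  \<open>n * n\<close>, so the climb ends.\<close>

lemma rk_le_imp_bruhat_le:
  assumes "x \<in> Sym n" "y \<in> Sym n" "\<And>p q. rk x p q \<le> rk y p q"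
  shows "bruhat_le n x y"
  using assms
proof (induction "n * n - len n x" arbitrary: x rule: less_induct)
  case less
  show ?case
  proof (cases "x = y")
    case True
    then show ?thesis using less.prems by (simp add: bruhat_le_refl)
  next
    case False
    then obtain i where i: "x i \<noteq> y i" "\<And>l. l < i \<Longrightarrow> x l = y l"
      using exists_least_iff[of "\<lambda>i. x i \<noteq> y i"] by auto
    have i1: "i \<in> {1..n}"
      using i(1) Sym_fix[OF less.prems(1), of i] Sym_fix[OF less.prems(2), of i] by force
    have xy: "x i < y i"
    proof (rule ccontr)
      assume "\<not> x i < y i"
      then have yx: "y i < x i" using i by simp
      have "{l. l \<le> i \<and> x i \<le> y l} \<subseteq> {l. l \<le> i \<and> x i \<le> x l} - {i}"
        using i yx by (auto simp: order_le_less)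
      then have "rk y i (x i) \<le> card ({l. l \<le> i \<and> x i \<le> x l} - {i})"
        unfolding rk_def by (intro card_mono) auto
      also have "\<dots> < rk x i (x i)" unfolding rk_def by (intro card_Diff1_less) auto
      finally show False using less.prems(3)[of i "x i"] by simp
    qed
    have "\<exists>m. i < m \<and> x i < x m \<and> x m \<le> y i"
    proof -
      let ?m = "inv x (y i)"
      have m: "x ?m = y i" using less.prems by simp
      then have "\<not> ?m < i" using i(2)[of ?m] Sym_eq_iff[OF less.prems(2), of ?m i] by auto
      moreover have "?m \<noteq> i" using i m by auto
      ultimately show ?thesis using m xy by (intro exI[of _ ?m]) auto
    qed
    then obtain j where j: "i < j" "x i < x j" "x j \<le> y i"
      and jmin: "\<And>l. i < l \<Longrightarrow> l < j \<Longrightarrow> \<not> (x i < x l \<and> x l \<le> y i)"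
      using exists_least_iff[of "\<lambda>m. i < m \<and> x i < x m \<and> x m \<le> y i"] by auto
    have "j \<le> n"
    proof (rule ccontr)
      assume "\<not> j \<le> n"
      then have "x j = j" using Sym_fix less.prems(1) by simp
      moreover have "y i \<le> n" using Sym_in_iff[OF less.prems(2), of i] i1 by simp
      ultimately show False using j \<open>\<not> j \<le> n\<close> by simp
    qed
    define x' where "x' = x \<circ> Transposition.transpose i j"
    have e: "edge n x x'"
      unfolding x'_def using edge_right_iff[OF less.prems(1), of i j] j \<open>j \<le> n\<close> i1 by simp
    have "rk x' p q \<le> rk y p q" for p q
    proof (cases "i \<le> p \<and> p < j")
      case False
      then show ?thesis unfolding x'_def using rk_transpose_outside[OF j(1), of p x q] less.prems(3)[of p q] by auto
    next
      case p: True
      show ?thesis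
      proof (cases "x i < q \<and> q \<le> x j")
        case False
        then have "{l. l \<le> p \<and> q \<le> x' l} = {l. l \<le> p \<and> q \<le> x l}"
          using p j unfolding x'_def by (auto simp: transpose_def)
        then show ?thesis using less.prems(3)[of p q] by (simp add: rk_def)
      next
        case q: True
        \<comment> \<open>Only here can the exchange raise the rank, by one. From level
          \<open>?r\<close> on the old comparison applies. In the band from \<open>q\<close> to
          \<open>y i\<close>, minimality of \<open>j\<close> leaves \<open>x\<close> only positions
          before \<open>i\<close>, where it agrees with \<open>y\<close>, while \<open>y\<close>
          also has position \<open>i\<close>: this pays for the extra one.\<close>
        let ?r = "Suc (y i)"
        let ?L = "{l. l < i \<and> q \<le> y l \<and> y l < ?r}"
        have "{l. l \<le> p \<and> q \<le> x' l} \<subseteq> insert i {l. l \<le> p \<and> q \<le> x l}"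
          using p j unfolding x'_def by (auto simp: transpose_def)
        then have "rk x' p q \<le> card (insert i {l. l \<le> p \<and> q \<le> x l})"
          unfolding rk_def by (intro card_mono) auto
        also have "\<dots> \<le> Suc (rk x p q)" unfolding rk_def by (simp add: card_insert_if)
        finally have 1: "rk x' p q \<le> Suc (rk x p q)" .
        have "{l. l \<le> p \<and> q \<le> x l \<and> x l < ?r} \<subseteq> ?L"
        proof
          fix l assume l: "l \<in> {l. l \<le> p \<and> q \<le> x l \<and> x l < ?r}"
          then have "\<not> i < l" using jmin[of l] p q by auto
          moreover have "l \<noteq> i" using l q by auto
          ultimately show "l \<in> ?L" using l i(2)[of l] by auto
        qed
        then have "card {l. l \<le> p \<and> q \<le> x l \<and> x l < ?r} \<le> card ?L"
          by (intro card_mono) auto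
        moreover have "Suc (card ?L) = card (insert i ?L)" by simp
        moreover have "card (insert i ?L) \<le> card {l. l \<le> p \<and> q \<le> y l \<and> y l < ?r}"
          using p q j by (intro card_mono) auto
        moreover have "rk x p ?r \<le> rk y p ?r" using less.prems(3) .
        moreover have "q \<le> ?r" using q j by simp
        ultimately show ?thesis using 1 rk_split[of q ?r x p] rk_split[of q ?r y p] by linarith
      qed
    qed
    moreover have "n * n - len n x' < n * n - len n x"
      using edgeD[OF e] len_le_square[of x' n] by linarith
    ultimately have "bruhat_le n x' y" using less.hyps[of x'] edgeD[OF e] less.prems by blast
    then show ?thesis using edge_imp_bruhat_le[OF e] bruhat_le_trans by blast
  qed
qed

subsection \<open>Strands across a reflection\<close>

definition rises :: "perm \<Rightarrow> nat \<Rightarrow> nat \<Rightarrow> bool" where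
  "rises w a c \<longleftrightarrow> (\<exists>k\<le>a. c \<le> w k)"

definition falls :: "perm \<Rightarrow> nat \<Rightarrow> nat \<Rightarrow> bool" where
  "falls w a c \<longleftrightarrow> (\<exists>k\<ge>c. w k \<le> a)"

lemma rises_iff_rk: "rises w a c \<longleftrightarrow> 0 < rk w a c"
  unfolding rises_def rk_def by (subst card_gt_0_iff) auto

lemma rises_mono: "bruhat_le n x y \<Longrightarrow> rises x a c \<Longrightarrow> rises y a c"
  using bruhat_le_rk[of n x y a c] by (simp add: rises_iff_rk)

lemma falls_iff_rises_inv: "w \<in> Sym n \<Longrightarrow> falls w a c \<longleftrightarrow> rises (inv w) a c"
  unfolding rises_def falls_def by (metis Sym_f_inv Sym_inv_f)

lemma falls_mono: "bruhat_le n x y \<Longrightarrow> falls x a c \<Longrightarrow> falls y a c"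
  using bruhat_le_inv rises_mono bruhat_le_Sym falls_iff_rises_inv by metis

lemma rises_subinterval: "rises w a c \<Longrightarrow> a \<le> b \<Longrightarrow> d \<le> c \<Longrightarrow> rises w b d"
  unfolding rises_def by (meson le_trans)

lemma falls_subinterval: "falls w a c \<Longrightarrow> a \<le> b \<Longrightarrow> d \<le> c \<Longrightarrow> falls w b d"
  unfolding falls_def by (meson le_trans)

text \<open>Positions up to \<open>p\<close> compete with those in \<open>F\<close> for the
  \<open>q\<close> values below \<open>q\<close>, so each late position with a small value pushes
  one more large value to the front.\<close>

lemma rk_ge:
  assumes "w \<in> Sym n" "F \<subseteq> {l. p < l \<and> w l < q}" "finite F"
  shows "p + 1 + card F \<le> rk w p q + q"
proof -
  have "card (({l. l \<le> p \<and> w l < q}) \<union> F) \<le> card {..<q}"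
    using assms Sym_bij[OF assms(1)]
    by (intro card_inj_on_le[where f = w]) (auto intro: inj_on_subset[OF bij_is_inj])
  moreover have "card (({l. l \<le> p \<and> w l < q}) \<union> F) = card {l. l \<le> p \<and> w l < q} + card F"
    using assms by (intro card_Un_disjoint) auto
  moreover have "card ({l. l \<le> p \<and> w l < q} \<union> {l. l \<le> p \<and> q \<le> w l}) = card {l. l \<le> p \<and> w l < q} + rk w p q"
    unfolding rk_def by (intro card_Un_disjoint) auto
  moreover have "{l. l \<le> p \<and> w l < q} \<union> {l. l \<le> p \<and> q \<le> w l} = {..p}" by auto
  ultimately show ?thesis by simp
qed

lemma rk_id: "rk id p q = p + 1 - q"
proof -
  have "{l. l \<le> p \<and> q \<le> id l} = {q..p}" by auto
  then show ?thesis by (simp add: rk_def)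
qed

text \<open>The rank matrix of \<open>(a c)\<close> exceeds that of the identity only on the square
  \<open>a <= p < c\<close>, \<open>a < q <= c\<close>, by one. For \<open>p < q\<close> the
  identity contributes 0 and the rising strand supplies the one; for \<open>q <= p\<close> the
  falling strand does, as a late position in \<open>rk_ge\<close>.\<close>

lemma transpose_bruhat_leI:
  assumes y: "y \<in> Sym n" and ac: "1 \<le> a" "a < c" "c \<le> n" and "rises y a c" "falls y a c"
  shows "bruhat_le n (Transposition.transpose a c) y"
proof (rule rk_le_imp_bruhat_le)
  let ?t = "Transposition.transpose a c"
  show "?t \<in> Sym n" using ac by (intro Sym_transpose) auto
  fix p q
  have base: "p + 1 - q \<le> rk y p q" using rk_ge[OF y, of "{}" p q] by simp
  show "rk ?t p q \<le> rk y p q"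
  proof (cases "a \<le> p \<and> p < c")
    case False
    then have "rk ?t p q = rk id p q" using rk_transpose_outside[OF ac(2), of p id q] by (auto simp: id_comp)
    then show ?thesis using base rk_id by simp
  next
    case p: True
    show ?thesis
    proof (cases "a < q \<and> q \<le> c")
      case False
      then have "{l. l \<le> p \<and> q \<le> ?t l} \<subseteq> {l. l \<le> p \<and> q \<le> id l}"
        using p by (auto simp: transpose_def split: if_splits)
      then have "rk ?t p q \<le> rk id p q" unfolding rk_def by (intro card_mono) auto
      then show ?thesis using base rk_id by simp
    next
      case q: True
      have "{l. l \<le> p \<and> q \<le> ?t l} \<subseteq> insert a {l. l \<le> p \<and> q \<le> id l}"
        using p by (auto simp: transpose_def split: if_splits)
      then have "rk ?t p q \<le> card (insert a {l. l \<le> p \<and> q \<le> id l})"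
        unfolding rk_def by (intro card_mono) auto
      also have "\<dots> \<le> Suc (rk id p q)" unfolding rk_def by (simp add: card_insert_if)
      finally have t: "rk ?t p q \<le> Suc (p + 1 - q)" by (simp add: rk_id)
      have "0 < rk y p q" using rises_subinterval[OF assms(5)] p q by (simp add: rises_iff_rk)
      moreover obtain k where k: "c \<le> k" "y k \<le> a" using assms(6) by (auto simp: falls_def)
      then have "p + 1 + card {k} \<le> rk y p q + q" using p q by (intro rk_ge[OF y]) auto
      ultimately show ?thesis using t by (cases "q \<le> p") auto
    qed
  qed
qed fact

lemma transpose_bruhat_le_iff:
  assumes "y \<in> Sym n" "1 \<le> a" "a < c" "c \<le> n"
  shows "bruhat_le n (Transposition.transpose a c) y \<longleftrightarrow> rises y a c \<and> falls y a c"
proof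
  have "rises (Transposition.transpose a c) a c" "falls (Transposition.transpose a c) a c"
    by (auto simp: rises_def falls_def intro: exI[of _ a] exI[of _ c])
  then show "rises y a c \<and> falls y a c" if "bruhat_le n (Transposition.transpose a c) y"
    using that rises_mono falls_mono by blast
qed (use transpose_bruhat_leI assms in blast)

lemma rises_transpose:
  assumes "a < c" "p < q"
  shows "rises (Transposition.transpose a c) p q \<longleftrightarrow> a \<le> p \<and> q \<le> c"
  using assms by (auto simp: rises_def transpose_def split: if_splits intro: exI[of _ a])

lemma falls_transpose:
  assumes "a < c" "p < q"
  shows "falls (Transposition.transpose a c) p q \<longleftrightarrow> a \<le> p \<and> q \<le> c"
  using assms by (auto simp: falls_def transpose_def split: if_splits intro: exI[of _ c])

lemma transpose_bruhat_le_transpose_iff: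
  assumes "1 \<le> a" "a < c" "c \<le> n" "1 \<le> p" "p < q" "q \<le> n"
  shows "bruhat_le n (Transposition.transpose p q) (Transposition.transpose a c) \<longleftrightarrow> a \<le> p \<and> q \<le> c"
  using transpose_bruhat_le_iff[of "Transposition.transpose a c" n p q] assms
    rises_transpose[of a c p q] falls_transpose[of a c p q] Sym_transpose[of a n c] by auto

lemma id_bruhat_le: "y \<in> Sym n \<Longrightarrow> bruhat_le n id y"
  using rk_ge[of y n "{}"] by (intro rk_le_imp_bruhat_le) (auto simp: rk_id le_diff_conv)

section \<open>Hypercubes as maps on a power set\<close>

definition cube_graph :: "('a set \<Rightarrow> perm) \<Rightarrow> 'a set \<Rightarrow> perm pair_pre_digraph" where
  "cube_graph f K =
     \<lparr> pverts = f ` Pow K, parcs = {(f B, f (insert s B)) | B s. B \<subseteq> K \<and> s \<in> K - B} \<rparr>"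

text \<open>The index set is arbitrary, so that a cube can be indexed by the antichain spanning it,
  with \<open>f {y} = y\<close>. Passing to a face at the bottom is then restriction to a
  subset.\<close>

definition cube_map :: "nat \<Rightarrow> perm \<Rightarrow> perm \<Rightarrow> ('a set \<Rightarrow> perm) \<Rightarrow> 'a set \<Rightarrow> bool" where
  "cube_map n u v f K \<longleftrightarrow> finite K \<and> inj_on f (Pow K) \<and> (\<forall>B \<subseteq> K. f B \<in> interval n u v) \<and>
     (\<forall>B s. B \<subseteq> K \<and> s \<in> K - B \<longrightarrow> edge n (f B) (f (insert s B)))"

lemma cube_map_finite: "cube_map n u v f K \<Longrightarrow> finite K"
  and cube_map_interval: "cube_map n u v f K \<Longrightarrow> B \<subseteq> K \<Longrightarrow> f B \<in> interval n u v"
  and cube_map_edge: "cube_map n u v f K \<Longrightarrow> B \<subseteq> K \<Longrightarrow> s \<in> K \<Longrightarrow> s \<notin> B \<Longrightarrow> edge n (f B) (f (insert s B))"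
  and cube_map_eq_iff: "cube_map n u v f K \<Longrightarrow> B \<subseteq> K \<Longrightarrow> C \<subseteq> K \<Longrightarrow> f B = f C \<longleftrightarrow> B = C"
  by (auto simp: cube_map_def inj_on_def)

lemma cube_map_subset: "cube_map n u v f K \<Longrightarrow> A \<subseteq> K \<Longrightarrow> cube_map n u v f A"
  using cube_map_edge[of n u v f K]
  by (auto simp: cube_map_def subset_iff intro: finite_subset inj_on_subset[OF _ Pow_mono])

lemma cube_map_cong: "cube_map n u v f K \<Longrightarrow> (\<And>B. B \<subseteq> K \<Longrightarrow> g B = f B) \<Longrightarrow> cube_map n u v g K"
  unfolding cube_map_def by (auto simp: inj_on_def)

lemma cube_map_reindex:
  assumes "cube_map n u v f K" and e: "bij_betw e K' K"
  shows "cube_map n u v (\<lambda>A. f (e ` A)) K'"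
  unfolding cube_map_def
proof (intro conjI allI impI)
  have im: "e ` A \<subseteq> K" if "A \<subseteq> K'" for A using that e by (auto simp: bij_betw_def)
  have inj: "inj_on e K'" using e by (simp add: bij_betw_def)
  show "finite K'" using assms cube_map_finite bij_betw_finite by metis
  show "inj_on (\<lambda>A. f (e ` A)) (Pow K')"
    using im by (intro inj_onI) (auto simp: cube_map_eq_iff[OF assms(1)] inj_on_image_eq_iff[OF inj])
  fix A
  show "f (e ` A) \<in> interval n u v" if "A \<subseteq> K'" using cube_map_interval[OF assms(1)] im that by blast
  fix s assume "A \<subseteq> K' \<and> s \<in> K' - A"
  then show "edge n (f (e ` A)) (f (e ` insert s A))"
    using im[of A] im[of "{s}"] inj by (auto intro!: cube_map_edge[OF assms(1)] simp: inj_on_eq_iff subset_iff)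
qed

lemma cube_graph_reindex:
  assumes e: "bij_betw e K' K"
  shows "cube_graph (\<lambda>A. f (e ` A)) K' = cube_graph f K"
proof -
  have im: "e ` K' = K" and inj: "inj_on e K'" using e by (auto simp: bij_betw_def)
  have "(\<lambda>A. f (e ` A)) ` Pow K' = f ` Pow K"
    using image_Pow_surj[OF im] by (auto simp: image_image[symmetric, of f "image e"])
  moreover have "{(f (e ` A), f (e ` insert s A)) | A s. A \<subseteq> K' \<and> s \<in> K' - A} =
    {(f B, f (insert s B)) | B s. B \<subseteq> K \<and> s \<in> K - B}" (is "?L = ?R")
  proof (intro equalityI subsetI)
    fix p assume "p \<in> ?L"
    then obtain A s where "A \<subseteq> K'" "s \<in> K' - A" "p = (f (e ` A), f (e ` insert s A))" by auto
    then show "p \<in> ?R" using im inj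
      by (intro CollectI exI[of _ "e ` A"] exI[of _ "e s"]) (auto simp: inj_on_eq_iff subset_iff)
  next
    fix p assume "p \<in> ?R"
    then obtain B s where B: "B \<subseteq> K" "s \<in> K - B" "p = (f B, f (insert s B))" by auto
    then obtain A t where "A \<subseteq> K'" "B = e ` A" "t \<in> K'" "s = e t"
      using im by (metis DiffD1 imageE subset_imageE)
    then show "p \<in> ?L" using B by (intro CollectI exI[of _ A] exI[of _ t]) auto
  qed
  ultimately show ?thesis by (simp add: cube_graph_def)
qed

lemma wf_bruhat_interval_graph: "wf_digraph (bruhat_interval_graph n u v)"
  by unfold_locales (auto simp: bruhat_interval_graph_def)

lemma arcs_bruhat_interval_graph:
  "(x, y) \<in> arcs (bruhat_interval_graph n u v) \<longleftrightarrow>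
     edge n x y \<and> x \<in> interval n u v \<and> y \<in> interval n u v"
  by (simp add: bruhat_interval_graph_def)

text \<open>Tail and head in \<open>with_proj\<close> are the projections, so the arc map of an
  isomorphism is determined by its vertex map.\<close>

lemma hypercube_iff:
  "hypercube n u v m H \<longleftrightarrow> (\<exists>g. cube_map n u v g {..<m} \<and> H = cube_graph g {..<m})"
proof
  assume "hypercube n u v m H"
  then have sub: "subgraph (with_proj H) (bruhat_interval_graph n u v)"
    and "digraph_iso (with_proj (boolean_hasse m)) (with_proj H)"
    by (auto simp: hypercube_def)
  then obtain h where iso: "pre_digraph.digraph_isomorphism (with_proj (boolean_hasse m)) h"
    and H: "with_proj H = app_iso h (with_proj (boolean_hasse m))"
    by (auto simp: digraph_iso_def)
  define g where "g = iso_verts h"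
  have verts: "pverts H = g ` Pow {..<m}"
    using arg_cong[OF H, of verts] by (simp add: g_def boolean_hasse_def)
  have "iso_tail h = fst" "iso_head h = snd"
    using arg_cong[OF H, of tail] arg_cong[OF H, of head] by simp_all
  then have "iso_arcs h a = (g (fst a), g (snd a))" if "a \<in> parcs (boolean_hasse m)" for a
    using iso that by (auto simp: pre_digraph.digraph_isomorphism_def g_def prod_eq_iff)
  then have arcs: "parcs H = (\<lambda>a. (g (fst a), g (snd a))) ` parcs (boolean_hasse m)"
    using arg_cong[OF H, of arcs] by simp
  have "parcs H = {(g B, g (insert s B)) | B s. B \<subseteq> {..<m} \<and> s \<in> {..<m} - B}"
  proof (intro equalityI subsetI)
    fix a assume "a \<in> {(g B, g (insert s B)) | B s. B \<subseteq> {..<m} \<and> s \<in> {..<m} - B}"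
    then obtain B s where "B \<subseteq> {..<m}" "s \<in> {..<m} - B" "a = (g B, g (insert s B))" by blast
    moreover from this have "(B, insert s B) \<in> parcs (boolean_hasse m)"
      by (auto simp: boolean_hasse_def)
    ultimately show "a \<in> parcs H" unfolding arcs by (intro image_eqI[of _ _ "(B, insert s B)"]) simp_all
  next
    fix a assume "a \<in> parcs H"
    then obtain b where "b \<in> parcs (boolean_hasse m)" "a = (g (fst b), g (snd b))" unfolding arcs by blast
    moreover from this obtain B s where "B \<subseteq> {..<m}" "s \<in> {..<m} - B" "b = (B, insert s B)"
      unfolding boolean_hasse_def by auto
    ultimately show "a \<in> {(g B, g (insert s B)) | B s. B \<subseteq> {..<m} \<and> s \<in> {..<m} - B}" by auto
  qed
  then have "H = cube_graph g {..<m}" using verts by (simp add: cube_graph_def)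
  moreover have "inj_on g (Pow {..<m})"
    using iso by (simp add: pre_digraph.digraph_isomorphism_def g_def boolean_hasse_def)
  moreover have "pverts H \<subseteq> interval n u v" "parcs H \<subseteq> parcs (bruhat_graph n)"
    using sub by (auto simp: subgraph_def bruhat_interval_graph_def)
  ultimately show "\<exists>g. cube_map n u v g {..<m} \<and> H = cube_graph g {..<m}"
    by (intro exI[of _ g]) (auto simp: cube_map_def cube_graph_def)
next
  assume "\<exists>g. cube_map n u v g {..<m} \<and> H = cube_graph g {..<m}"
  then obtain g where g: "cube_map n u v g {..<m}" and H: "H = cube_graph g {..<m}" by blast
  let ?h = "\<lparr> iso_verts = g, iso_arcs = (\<lambda>a. (g (fst a), g (snd a))), iso_head = snd, iso_tail = fst \<rparr>"
  have wf: "wf_digraph (with_proj (boolean_hasse m))"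
    by unfold_locales (auto simp: boolean_hasse_def)
  have inj: "inj_on g (Pow {..<m})" using g by (simp add: cube_map_def)
  have "pre_digraph.digraph_isomorphism (with_proj (boolean_hasse m)) ?h"
    unfolding pre_digraph.digraph_isomorphism_def
  proof (intro conjI wf)
    show "inj_on (iso_verts ?h) (verts (with_proj (boolean_hasse m)))"
      using inj by (simp add: boolean_hasse_def)
    show "inj_on (iso_arcs ?h) (arcs (with_proj (boolean_hasse m)))"
      by (rule inj_onI) (auto simp: boolean_hasse_def inj_on_eq_iff[OF inj])
  qed simp
  moreover have "with_proj H = app_iso ?h (with_proj (boolean_hasse m))"
    unfolding H cube_graph_def boolean_hasse_def app_iso_def with_proj_def by force
  ultimately have "digraph_iso (with_proj (boolean_hasse m)) (with_proj H)"
    unfolding digraph_iso_def by blast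
  moreover have "wf_digraph (with_proj H)"
    by unfold_locales (auto simp: H cube_graph_def)
  then have "subgraph (with_proj H) (bruhat_interval_graph n u v)"
    using g wf_bruhat_interval_graph
    by (auto simp: subgraph_def compatible_def bruhat_interval_graph_def H cube_graph_def cube_map_def
      intro: cube_map_interval[OF g])
  ultimately show "hypercube n u v m H" by (simp add: hypercube_def)
qed

lemma hypercube_cube_graph:
  assumes "cube_map n u v f K"
  shows "hypercube n u v (card K) (cube_graph f K)"
proof -
  obtain e where e: "bij_betw e {..<card K} K"
    using cube_map_finite[OF assms] ex_bij_betw_nat_finite by (metis atLeast0LessThan)
  show ?thesis unfolding hypercube_iff
    using cube_map_reindex[OF assms e] cube_graph_reindex[OF e, of f] by metis
qed

lemma parcs_cube_graph_into:
  assumes "cube_map n u v f K" "B \<subseteq> K"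
  shows "(y, f B) \<in> parcs (cube_graph f K) \<longleftrightarrow> (\<exists>s \<in> B. y = f (B - {s}))"
proof
  assume "(y, f B) \<in> parcs (cube_graph f K)"
  then obtain C s where C: "C \<subseteq> K" "s \<in> K - C" "y = f C" "f B = f (insert s C)"
    by (auto simp: cube_graph_def)
  then have "B = insert s C" using cube_map_eq_iff[OF assms(1)] assms(2) by auto
  then show "\<exists>s \<in> B. y = f (B - {s})" using C by (intro bexI[of _ s]) auto
next
  assume "\<exists>s \<in> B. y = f (B - {s})"
  then obtain s where "s \<in> B" "y = f (B - {s})" by blast
  then show "(y, f B) \<in> parcs (cube_graph f K)"
    using assms(2) by (auto simp: cube_graph_def insert_absorb intro!: exI[of _ "B - {s}"] exI[of _ s])
qed

lemma parcs_cube_graph_from: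
  assumes "cube_map n u v f K" "B \<subseteq> K"
  shows "(f B, y) \<in> parcs (cube_graph f K) \<longleftrightarrow> (\<exists>s \<in> K - B. y = f (insert s B))"
  using assms(2) cube_map_eq_iff[OF assms(1)] by (auto simp: cube_graph_def)

lemma bottom_cube_graph:
  assumes "cube_map n u v f K"
  shows "bottom (cube_graph f K) = f {}"
  unfolding bottom_def
proof (rule the_equality)
  show "f {} \<in> pverts (cube_graph f K) \<and> (\<forall>y. (y, f {}) \<notin> parcs (cube_graph f K))"
    using parcs_cube_graph_into[OF assms, of "{}"] by (auto simp: cube_graph_def)
  fix x assume x: "x \<in> pverts (cube_graph f K) \<and> (\<forall>y. (y, x) \<notin> parcs (cube_graph f K))"
  then obtain B where "B \<subseteq> K" "x = f B" by (auto simp: cube_graph_def)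
  moreover have "B = {}"
  proof (rule ccontr)
    assume "B \<noteq> {}"
    then obtain s where "s \<in> B" by blast
    then show False using x parcs_cube_graph_into[OF assms \<open>B \<subseteq> K\<close>, of "f (B - {s})"] \<open>x = f B\<close> by blast
  qed
  ultimately show "x = f {}" by simp
qed

lemma top_vertex_cube_graph:
  assumes "cube_map n u v f K"
  shows "top_vertex (cube_graph f K) = f K"
  unfolding top_vertex_def
proof (rule the_equality)
  show "f K \<in> pverts (cube_graph f K) \<and> (\<forall>y. (f K, y) \<notin> parcs (cube_graph f K))"
    using parcs_cube_graph_from[OF assms, of K] by (auto simp: cube_graph_def)
  fix x assume x: "x \<in> pverts (cube_graph f K) \<and> (\<forall>y. (x, y) \<notin> parcs (cube_graph f K))"
  then obtain B where "B \<subseteq> K" "x = f B" by (auto simp: cube_graph_def)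
  moreover have "B = K"
  proof (rule ccontr)
    assume "B \<noteq> K"
    then obtain s where "s \<in> K - B" using \<open>B \<subseteq> K\<close> by blast
    then show False using x parcs_cube_graph_from[OF assms \<open>B \<subseteq> K\<close>, of "f (insert s B)"] \<open>x = f B\<close> by blast
  qed
  ultimately show "x = f K" by simp
qed

lemma spanning_set_cube_graph:
  assumes "cube_map n u v f K"
  shows "spanning_set (cube_graph f K) = (\<lambda>s. f {s}) ` K"
  using parcs_cube_graph_from[OF assms, of "{}"] bottom_cube_graph[OF assms]
  by (auto simp: spanning_set_def)

lemma hypercube_at_cube_graph:
  assumes "cube_map n u v f K" "\<And>y. y \<in> K \<Longrightarrow> f {y} = y"
  shows "hypercube_at n u v (f {}) K (cube_graph f K)"
  using hypercube_cube_graph bottom_cube_graph spanning_set_cube_graph assms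
  by (fastforce simp: hypercube_at_def)

text \<open>Sending an index to its atom is injective; reindexing along the inverse names every
  direction by the atom that it leads to.\<close>

lemma hypercube_atE:
  assumes "hypercube_at n u v x Y H"
  obtains f where "cube_map n u v f Y" "H = cube_graph f Y" "f {} = x" "\<And>y. y \<in> Y \<Longrightarrow> f {y} = y"
proof -
  obtain m where "hypercube n u v m H"
    using assms unfolding hypercube_at_def by (elim conjE exE)
  then obtain g where g: "cube_map n u v g {..<m}" and H: "H = cube_graph g {..<m}"
    unfolding hypercube_iff by (elim conjE exE)
  have x: "g {} = x" and Y: "(\<lambda>i. g {i}) ` {..<m} = Y"
    using assms bottom_cube_graph[OF g] spanning_set_cube_graph[OF g] by (auto simp: hypercube_at_def H)
  have "inj_on (\<lambda>i. g {i}) {..<m}"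
    using cube_map_eq_iff[OF g] by (auto simp: inj_on_def)
  then have e: "bij_betw (the_inv_into {..<m} (\<lambda>i. g {i})) Y {..<m}" (is "bij_betw ?e _ _")
    using Y by (intro bij_betw_the_inv_into) (auto simp: bij_betw_def)
  have "g (?e ` {y}) = y" if "y \<in> Y" for y
    using that Y \<open>inj_on _ _\<close> f_the_inv_into_f[of "\<lambda>i. g {i}" "{..<m}" y] by simp
  then show ?thesis
    using that[of "\<lambda>A. g (?e ` A)"] cube_map_reindex[OF g e] cube_graph_reindex[OF e, of g] H x by simp
qed

lemma theta_eq:
  assumes "\<exists>!H. hypercube_at n u v x Y H" and "cube_map n u v f Y" "f {} = x" "\<And>y. y \<in> Y \<Longrightarrow> f {y} = y"
  shows "theta n u v x Y = f Y"
proof -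
  have "hypercube_at n u v x Y (cube_graph f Y)"
    using hypercube_at_cube_graph[OF assms(2)] assms(3,4) by simp
  then have "(THE H. hypercube_at n u v x Y H) = cube_graph f Y"
    using assms(1) by (simp add: the1_equality)
  then show ?thesis by (simp add: theta_def top_vertex_cube_graph[OF assms(2)])
qed

lemma antichains_subset: "Y \<in> antichains n u v I x \<Longrightarrow> A \<subseteq> Y \<Longrightarrow> A \<in> antichains n u v I x"
  unfolding antichains_def by (auto intro: pairwise_subset)

text \<open>A subset of an antichain is an antichain, and it spans a face of the cube. By uniqueness
  the top of that face is \<open>theta\<close> of the subset, so the single function
  \<open>theta\<close> describes every vertex of the cube.\<close>

lemma theta_cube_map:
  assumes "hypercube_cluster n u v I x" and Y: "Y \<in> antichains n u v I x"
  shows "cube_map n u v (theta n u v x) Y" "theta n u v x {} = x" "\<And>y. y \<in> Y \<Longrightarrow> theta n u v x {y} = y"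
proof -
  have ex1: "\<exists>!H. hypercube_at n u v x A H" if "A \<subseteq> Y" for A
    using assms antichains_subset that unfolding hypercube_cluster_def by blast
  then obtain H where "hypercube_at n u v x Y H" by blast
  then obtain f where f: "cube_map n u v f Y" "f {} = x" "\<And>y. y \<in> Y \<Longrightarrow> f {y} = y"
    using hypercube_atE by metis
  have eq: "theta n u v x A = f A" if "A \<subseteq> Y" for A
    using theta_eq[OF ex1 cube_map_subset[OF f(1)]] f that by blast
  show "cube_map n u v (theta n u v x) Y" using cube_map_cong[OF f(1)] eq by blast
  show "theta n u v x {} = x" "\<And>y. y \<in> Y \<Longrightarrow> theta n u v x {y} = y" using eq f by auto
qed

lemma diamond_cube_map:
  assumes "edge n x y1" "edge n x y2" "edge n y1 w" "edge n y2 w" "y1 \<noteq> y2"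
    and "{x, y1, y2, w} \<subseteq> interval n u v"
  obtains f where "cube_map n u v f {y1, y2}" "f {} = x" "f {y1} = y1" "f {y2} = y2" "f {y1, y2} = w"
proof -
  define f where "f B = (if B = {} then x else if B = {y1} then y1 else if B = {y2} then y2 else w)" for B
  have d: "x \<noteq> y1" "x \<noteq> y2" "x \<noteq> w" "y1 \<noteq> w" "y2 \<noteq> w"
    using assms by (auto dest!: edgeD(3))
  have sub: "B \<subseteq> {y1, y2} \<longleftrightarrow> B = {} \<or> B = {y1} \<or> B = {y2} \<or> B = {y1, y2}" for B by blast
  have v: "f {} = x" "f {y1} = y1" "f {y2} = y2" "f {y1, y2} = w" "f {y2, y1} = w"
    using assms(5) by (auto simp: f_def)
  have "cube_map n u v f {y1, y2}"
    unfolding cube_map_def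
  proof (intro conjI allI impI)
    show "inj_on f (Pow {y1, y2})"
      using d assms(5) v by (intro inj_onI) (auto simp: Pow_def sub)
    show "f B \<in> interval n u v" if "B \<subseteq> {y1, y2}" for B
      using that assms(6) v unfolding sub by auto
    show "edge n (f B) (f (insert s B))" if "B \<subseteq> {y1, y2} \<and> s \<in> {y1, y2} - B" for B s
      using that assms v unfolding sub by auto
  qed simp
  then show ?thesis using that v by blast
qed

section \<open>Labels along a hypercube\<close>

lemma inj_comp_transpose:
  "inj f \<Longrightarrow> f \<circ> Transposition.transpose i j = Transposition.transpose (f i) (f j) \<circ> f"
  by (auto simp: fun_eq_iff transpose_def inj_eq)

text \<open>Equality of the label products along the two sides of a diamond. Everything happens on
  the points of the two atom labels: on three points, the transpositions other than
  \<open>?q\<close> are \<open>?r\<close> and its conjugate by \<open>?q\<close>; on four points,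
  only \<open>?r\<close> itself is possible.\<close>

lemma transpose_exchange:
  fixes i j k l i' j' k' l' :: nat
  assumes "i \<noteq> j" "k \<noteq> l" "i' \<noteq> j'" "k' \<noteq> l'"
    and eq: "Transposition.transpose i' j' \<circ> Transposition.transpose k l = Transposition.transpose k' l' \<circ> Transposition.transpose i j"
    and ne: "Transposition.transpose i j \<noteq> Transposition.transpose k l" "Transposition.transpose i' j' \<noteq> Transposition.transpose k l"
  shows "Transposition.transpose i' j' = Transposition.transpose i j \<or>
    Transposition.transpose i' j' = Transposition.transpose (Transposition.transpose k l i) (Transposition.transpose k l j)"
proof -
  let ?q = "Transposition.transpose k l" and ?r = "Transposition.transpose i j"
  let ?q' = "Transposition.transpose k' l'" and ?r' = "Transposition.transpose i' j'"
  have ev: "?r' (?q p) = ?q' (?r p)" for p using fun_cong[OF eq, of p] by simp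
  have moved: "Transposition.transpose a b = Transposition.transpose p p'"
    if "Transposition.transpose a b p = p'" "p' \<noteq> p" for a b p p' :: nat
    using that by (auto simp: transpose_def fun_eq_iff split: if_splits)
  \<comment> \<open>A point outside that is moved by \<open>?r'\<close> is moved in the same way by
    \<open>?q'\<close>, which forces \<open>?r' = ?q'\<close> and then
    \<open>?q = ?r\<close>.\<close>
  have fix_r': "p \<in> {i, j, k, l}" if "?r' p \<noteq> p" for p
  proof (rule ccontr)
    assume "p \<notin> {i, j, k, l}"
    then have "?q p = p" "?r p = p" by auto
    then have "?r' p = ?q' p" using ev[of p] by simp
    then have "?r' = ?q'" using moved that by metis
    then have "?q = ?r" using eq by (metis comp_assoc id_comp transpose_comp_involutory)
    then show False using ne by simp
  qed
  have r'i: "?r' i \<in> {i, j, k, l}" using fix_r'[of "?r' i"] by (cases "?r' i = i") auto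
  show ?thesis
  proof (cases "k \<in> {i, j} \<or> l \<in> {i, j}")
    case True
    have "i' \<in> {i, j, k, l}" "j' \<in> {i, j, k, l}" using fix_r'[of i'] fix_r'[of j'] assms(3) by auto
    moreover have "\<exists>a b c. a \<noteq> b \<and> a \<noteq> c \<and> b \<noteq> c \<and> {i, j, k, l} = {a, b, c} \<and> ?r = Transposition.transpose a b \<and>
        ?q = Transposition.transpose a c \<and> Transposition.transpose (?q i) (?q j) = Transposition.transpose c b"
    proof -
      have *: ?thesis if "{i, j} = {a, b}" "{k, l} = {a, c}" for a b c
      proof -
        have d: "a \<noteq> b" "a \<noteq> c" using that assms(1,2) by (auto simp: doubleton_eq_iff)
        have r: "?r = Transposition.transpose a b" and q: "?q = Transposition.transpose a c"
          using that by (auto simp: doubleton_eq_iff transpose_commute)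
        have "b \<noteq> c" using r q ne by auto
        moreover have "Transposition.transpose (?q i) (?q j) = Transposition.transpose c b"
        proof -
          have "?q a = c" "?q b = b" using d \<open>b \<noteq> c\<close> unfolding q by simp_all
          moreover have "(i = a \<and> j = b) \<or> (i = b \<and> j = a)" using that(1) by (simp add: doubleton_eq_iff)
          ultimately show ?thesis by (elim disjE conjE) (simp_all add: transpose_commute)
        qed
        moreover have "{i, j, k, l} = {i, j} \<union> {k, l}" by auto
        then have "{i, j, k, l} = {a, b, c}" unfolding that by auto
        ultimately show ?thesis using d r q by (intro exI[of _ a] exI[of _ b] exI[of _ c]) (simp only: simp_thms)
      qed
      from True consider "k = i" | "k = j" | "l = i" | "l = j" by auto
      then show ?thesis
      proof cases
        case 1 then show ?thesis by (intro *[of i j l]) simp_all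
      next
        case 2 then show ?thesis by (intro *[of j i l]) auto
      next
        case 3 then show ?thesis by (intro *[of i j k]) auto
      next
        case 4 then show ?thesis by (intro *[of j i k]) auto
      qed
    qed
    then obtain a b c where abc: "{i, j, k, l} = {a, b, c}" "?r = Transposition.transpose a b"
        "?q = Transposition.transpose a c" "Transposition.transpose (?q i) (?q j) = Transposition.transpose c b"
      by blast
    ultimately have "i' \<in> {a, b, c}" "j' \<in> {a, b, c}" by simp_all
    moreover have "?r' \<noteq> Transposition.transpose a c" using abc ne by metis
    ultimately show ?thesis using assms(3) unfolding abc(4) abc(2)
      by (auto simp: transpose_commute)
  next
    case False
    then have q: "?q i = i" "?q j = j" and r: "?r k = k" "?r l = l" by auto
    have "?r' i \<noteq> i"
    proof
      assume 1: "?r' i = i"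
      then have "?q' j = i" using ev[of i] q by simp
      then have "?q' = ?r" using moved[of k' l' j i] assms(1) by (simp add: transpose_commute)
      then have "?r' l = k" using ev[of k] r by simp
      then have "?r' = ?q" using moved[of i' j' l k] assms(2) by (simp add: transpose_commute)
      then show False using ne by simp
    qed
    moreover have "?r' i \<noteq> m" if m: "m \<in> {k, l}" for m
    proof
      assume 1: "?r' i = m"
      then have "?r' = Transposition.transpose i m" using moved[of i' j' i m] False m by auto
      then have "?r' j = j" using False m assms(1) by auto
      moreover have "?q' j = m" using ev[of i] q 1 by simp
      then have "?q' = Transposition.transpose j m" using moved[of k' l' j m] False m by auto
      then have "?q' i = i" using False m assms(1) by auto
      ultimately show False using ev[of j] q assms(1) by simp
    qed
    ultimately have "?r' i = j" using r'i by auto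
    then have "?r' = ?r" using moved[of i' j' i j] assms(1) by simp
    then show ?thesis by simp
  qed
qed

lemma edge_transpose:
  assumes "edge n x y"
  obtains p q where "p \<noteq> q" "y = Transposition.transpose p q \<circ> x"
  using edge_leftD[OF assms] by (metis nat_neq_iff)

text \<open>Passing to the opposite side of a diamond conjugates a label at most by the label of the
  adjacent side, so the label of any edge in direction \<open>s\<close> is obtained from that of the atom \<open>s\<close> by
  moving its two points inside their orbits under the labels of the atoms already present.\<close>

lemma cube_map_label:
  fixes p q :: "'a \<Rightarrow> nat"
  assumes f: "cube_map n u v f K"
    and pq: "\<And>s. s \<in> K \<Longrightarrow> p s \<noteq> q s \<and> f {s} = Transposition.transpose (p s) (q s) \<circ> f {}"
    and "B \<subseteq> K" "s \<in> K" "s \<notin> B"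
  shows "\<exists>i j. i \<noteq> j \<and> f (insert s B) = Transposition.transpose i j \<circ> f B \<and>
    (\<forall>S. (\<forall>t\<in>B. p t \<in> S \<longleftrightarrow> q t \<in> S) \<longrightarrow> (i \<in> S \<longleftrightarrow> p s \<in> S) \<and> (j \<in> S \<longleftrightarrow> q s \<in> S))"
proof -
  have "finite B" using cube_map_finite[OF f] assms finite_subset by blast
  then show ?thesis using assms(3-5)
  proof (induction B arbitrary: s rule: finite_induct)
    case empty
    then show ?case using pq by blast
  next
    case (insert t B)
    have B: "B \<subseteq> K" "s \<in> K" "s \<notin> B" "t \<in> K" "s \<noteq> t" using insert.prems by auto
    obtain i j where r: "i \<noteq> j" "f (insert s B) = Transposition.transpose i j \<circ> f B"
      and rS: "\<And>S. \<forall>t\<in>B. p t \<in> S \<longleftrightarrow> q t \<in> S \<Longrightarrow> (i \<in> S \<longleftrightarrow> p s \<in> S) \<and> (j \<in> S \<longleftrightarrow> q s \<in> S)"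
      using insert.IH[OF B(1-3)] by (elim exE conjE) (rule that, assumption+, blast)
    obtain k l where q: "k \<noteq> l" "f (insert t B) = Transposition.transpose k l \<circ> f B"
      and qS: "\<And>S. \<forall>t\<in>B. p t \<in> S \<longleftrightarrow> q t \<in> S \<Longrightarrow> (k \<in> S \<longleftrightarrow> p t \<in> S) \<and> (l \<in> S \<longleftrightarrow> q t \<in> S)"
      using insert.IH[OF B(1,4) insert.hyps(2)] by (elim exE conjE) (rule that, assumption+, blast)
    let ?q = "Transposition.transpose k l" and ?r = "Transposition.transpose i j"
    have e: "edge n (f (insert t B)) (f (insert s (insert t B)))" "edge n (f (insert s B)) (f (insert t (insert s B)))"
      using insert.prems insert.hyps by (auto intro!: cube_map_edge[OF f])
    obtain i' j' where r': "i' \<noteq> j'" "f (insert s (insert t B)) = Transposition.transpose i' j' \<circ> f (insert t B)"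
      using edge_transpose[OF e(1)] .
    obtain k' l' where q': "k' \<noteq> l'" "f (insert t (insert s B)) = Transposition.transpose k' l' \<circ> f (insert s B)"
      using edge_transpose[OF e(2)] .
    let ?q' = "Transposition.transpose k' l'" and ?r' = "Transposition.transpose i' j'"
    have "f B \<in> Sym n" using bruhat_le_Sym cube_map_interval[OF f, of B] insert.prems by (auto simp: interval_def)
    then have surj: "surj (f B)" using Sym_bij bij_is_surj by blast
    have "(?r' \<circ> ?q) \<circ> f B = (?q' \<circ> ?r) \<circ> f B"
      using r' q' r q by (simp add: insert_commute comp_assoc)
    then have eq: "?r' \<circ> ?q = ?q' \<circ> ?r" using surj by (metis surj_fun_eq)
    have "f (insert s B) \<noteq> f (insert t B)"
      using insert.prems insert.hyps by (subst cube_map_eq_iff[OF f]) auto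
    then have ne1: "?r \<noteq> ?q" using r q by metis
    have "f (insert s (insert t B)) \<noteq> f B"
      using insert.prems insert.hyps by (subst cube_map_eq_iff[OF f]) auto
    then have ne2: "?r' \<noteq> ?q" using r' q by (metis comp_assoc id_comp transpose_comp_involutory)
    consider "?r' = ?r" | "?r' = Transposition.transpose (?q i) (?q j)"
      using transpose_exchange[OF r(1) q(1) r'(1) q'(1) eq ne1 ne2] by blast
    then show ?case
    proof cases
      case 1
      then show ?thesis using r r' rS by (intro exI[of _ i] exI[of _ j]) simp
    next
      case 2
      have "?q i \<in> S \<longleftrightarrow> i \<in> S" "?q j \<in> S \<longleftrightarrow> j \<in> S"
        if "\<forall>t'\<in>insert t B. p t' \<in> S \<longleftrightarrow> q t' \<in> S" for S
      proof -
        have "k \<in> S \<longleftrightarrow> l \<in> S" using qS[of S] that by simp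
        then show "?q i \<in> S \<longleftrightarrow> i \<in> S" "?q j \<in> S \<longleftrightarrow> j \<in> S" by (auto simp: transpose_def)
      qed
      moreover have "?q i \<noteq> ?q j" using r(1) by (metis transpose_involutory)
      ultimately show ?thesis using 2 r' rS by (intro exI[of _ "?q i"] exI[of _ "?q j"]) simp
    qed
  qed
qed

text \<open>Along a path from the bottom each label has both its points in \<open>S\<close> or both
  outside, so no value crosses the boundary of \<open>S\<close>.\<close>

lemma cube_map_invariant:
  fixes p q :: "'a \<Rightarrow> nat"
  assumes f: "cube_map n u v f K"
    and pq: "\<And>s. s \<in> K \<Longrightarrow> p s \<noteq> q s \<and> f {s} = Transposition.transpose (p s) (q s) \<circ> f {}"
    and "B \<subseteq> K" and S: "\<And>t. t \<in> B \<Longrightarrow> p t \<in> S \<longleftrightarrow> q t \<in> S"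
  shows "f B k \<in> S \<longleftrightarrow> f {} k \<in> S"
proof -
  have "finite B" using cube_map_finite[OF f] assms finite_subset by blast
  then show ?thesis using assms(3,4)
  proof (induction B rule: finite_induct)
    case (insert t B)
    have B: "B \<subseteq> K" "t \<in> K" "\<forall>t\<in>B. p t \<in> S \<longleftrightarrow> q t \<in> S" "p t \<in> S \<longleftrightarrow> q t \<in> S"
      using insert.prems by auto
    obtain i j where "f (insert t B) = Transposition.transpose i j \<circ> f B" "i \<in> S \<longleftrightarrow> p t \<in> S" "j \<in> S \<longleftrightarrow> q t \<in> S"
      using cube_map_label[OF f pq B(1,2) insert.hyps(2)] B(3) by blast
    then show ?case using insert.IH B insert.prems by (auto simp: transpose_def)
  qed simp
qed

text \<open>Both alternatives of \<open>transpose_exchange\<close> make the top a product of the two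
  atom labels; only their order stays open.\<close>

lemma diamond_top:
  assumes "x \<in> Sym n" and ij: "i \<noteq> j" "k \<noteq> l"
    and e: "edge n x (Transposition.transpose i j \<circ> x)" "edge n x (Transposition.transpose k l \<circ> x)"
    and ne: "Transposition.transpose i j \<noteq> Transposition.transpose k l"
    and w: "edge n (Transposition.transpose i j \<circ> x) w" "edge n (Transposition.transpose k l \<circ> x) w"
  shows "w = Transposition.transpose i j \<circ> (Transposition.transpose k l \<circ> x) \<or>
    w = Transposition.transpose k l \<circ> (Transposition.transpose i j \<circ> x)"
proof -
  let ?r = "Transposition.transpose i j" and ?q = "Transposition.transpose k l"
  obtain k' l' where q': "k' \<noteq> l'" "w = Transposition.transpose k' l' \<circ> (?r \<circ> x)"
    using edge_transpose[OF w(1)] .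
  obtain i' j' where r': "i' \<noteq> j'" "w = Transposition.transpose i' j' \<circ> (?q \<circ> x)"
    using edge_transpose[OF w(2)] .
  let ?q' = "Transposition.transpose k' l'" and ?r' = "Transposition.transpose i' j'"
  have surj: "surj x" using Sym_bij assms(1) bij_is_surj by blast
  have "(?r' \<circ> ?q) \<circ> x = (?q' \<circ> ?r) \<circ> x" using q' r' by (metis comp_assoc)
  then have eq: "?r' \<circ> ?q = ?q' \<circ> ?r" using surj by (metis surj_fun_eq)
  have "w \<noteq> x" using e(1) w(1) by (auto dest!: edgeD(3))
  then have ne2: "?r' \<noteq> ?q" using r' by (metis comp_assoc id_comp transpose_comp_involutory)
  consider "?r' = ?r" | "?r' = Transposition.transpose (?q i) (?q j)"
    using transpose_exchange[OF ij r'(1) q'(1) eq ne ne2] by blast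
  then show ?thesis
  proof cases
    case 1
    then show ?thesis using r' by simp
  next
    case 2
    have "Transposition.transpose (?q i) (?q j) \<circ> ?q = ?q \<circ> ?r"
      by (rule inj_comp_transpose[symmetric]) simp
    then show ?thesis using 2 r' by (metis comp_assoc)
  qed
qed

section \<open>Lower hypercube decompositions\<close>

lemma edge_upd:
  assumes "x \<in> Sym n" "1 \<le> i" "i < j" "j \<le> n" "x i < x j" "y = x(i := x j, j := x i)"
  shows "edge n x y"
proof -
  have "y = x \<circ> Transposition.transpose i j" using assms by (auto simp: fun_eq_iff transpose_def)
  then show ?thesis using edge_right_iff[of x n i j] assms by simp
qed

lemma edge_upd_down:
  assumes "x \<in> Sym n" "1 \<le> i" "i < j" "j \<le> n" "x j < x i" "y = x(i := x j, j := x i)"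
  shows "edge n y x"
proof -
  have y: "y = x \<circ> Transposition.transpose i j" using assms by (auto simp: fun_eq_iff transpose_def)
  have "y \<in> Sym n" unfolding y using assms by (intro Sym_comp Sym_transpose) auto
  moreover have "y i < y j" using assms by simp
  moreover have "x = y(i := y j, j := y i)" unfolding assms(6) using assms(3) by (auto simp: fun_eq_iff)
  ultimately show ?thesis by (intro edge_upd[of y n i j] assms(2-4))
qed

lemma edge_values:
  assumes w: "w \<in> Sym n" and "edge n w (Transposition.transpose (w k) (w l) \<circ> w)" "k < l"
  shows "w k < w l"
proof -
  have e: "edge n w (w \<circ> Transposition.transpose k l)" using assms transpose_comp_right[OF w] by simp
  obtain i j where ij: "1 \<le> i" "i < j" "j \<le> n" "w i < w j"
    "w \<circ> Transposition.transpose k l = w \<circ> Transposition.transpose i j"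
    using edge_rightD[OF e] .
  have "Transposition.transpose k l = Transposition.transpose i j"
    using ij(5) w by (auto simp: fun_eq_iff Sym_eq_iff)
  then have "Transposition.transpose i j k = l" by (metis transpose_apply_first)
  then have "k = i \<and> l = j"
    using \<open>k < l\<close> ij(2) by (auto simp: transpose_def split: if_splits)
  then show ?thesis using ij by simp
qed

text \<open>If nothing falls across the step, the inverse maps \<open>{..k}\<close> injectively into
  itself, hence onto it, and nothing can rise either.\<close>

lemma rises_Suc_iff_falls:
  assumes "w \<in> Sym n"
  shows "rises w k (Suc k) \<longleftrightarrow> falls w k (Suc k)"
proof -
  have *: "falls w k (Suc k)" if w: "w \<in> Sym n" and r: "rises w k (Suc k)" for w
  proof (rule ccontr)
    assume "\<not> falls w k (Suc k)"
    then have "inv w l \<le> k" if "l \<le> k" for l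
      using that Sym_f_inv[OF w, of l] unfolding falls_def by (metis not_less_eq_eq)
    then have "inv w ` {..k} \<subseteq> {..k}" by auto
    moreover have "inj_on (inv w) {..k}"
      using Sym_bij[OF Sym_inv[OF w]] by (auto intro: inj_on_subset bij_is_inj)
    ultimately have "inv w ` {..k} = {..k}" by (simp add: endo_inj_surj)
    moreover obtain i where "i \<le> k" "Suc k \<le> w i" using r by (auto simp: rises_def)
    ultimately have "i \<in> inv w ` {..k}" by simp
    then show False using \<open>Suc k \<le> w i\<close> w by auto
  qed
  show ?thesis
    using *[OF assms] *[OF Sym_inv[OF assms]] falls_iff_rises_inv[OF assms]
      falls_iff_rises_inv[OF Sym_inv[OF assms]] Sym_bij[OF assms] by (auto simp: inv_inv_eq)
qed

lemma Sym_atMost_one_inversion: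
  assumes x: "x \<in> Sym n" and one: "\<And>s t. s \<in> invs x \<Longrightarrow> t \<in> invs x \<Longrightarrow> s = t"
  shows "x = id \<or> (\<exists>k. 1 \<le> k \<and> k < n \<and> x = Transposition.transpose k (Suc k))"
proof (cases "invs x = {}")
  case True
  then show ?thesis using invs_empty_imp_id[OF x] by simp
next
  case False
  then obtain k where k: "1 \<le> k" "k < n" "x (Suc k) < x k" using has_descent[OF x] by blast
  let ?s = "Transposition.transpose k (Suc k)"
  have xs: "x \<circ> ?s \<in> Sym n" using k x by (auto intro!: Sym_comp Sym_transpose)
  have "card (invs x) \<le> 1" using one by (intro card_le_Suc0_iff_eq[THEN iffD2, unfolded One_nat_def[symmetric]] finite_invs[OF x]) auto
  then have "card (invs (x \<circ> ?s)) = 0" using card_invs_adjacent'[OF x k] by linarith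
  then have "x \<circ> ?s = id" using finite_invs[OF xs] invs_empty_imp_id[OF xs] by simp
  then have "(x \<circ> ?s) \<circ> ?s = ?s" by simp
  then have "x = ?s" by (simp only: comp_assoc transpose_comp_involutory comp_id)
  then show ?thesis using k by blast
qed

text \<open>On the three positions the pattern is 321, 312 or 231. Each is the top of a diamond
  among the patterns on three letters, and the direction of an edge depends only on the order of the
  two exchanged values.\<close>

lemma diamond_below_shared:
  assumes x: "x \<in> Sym n" and p: "1 \<le> p" "p < q" "q < r" "r \<le> n"
    and inv: "x q < x p \<and> x r < x p \<or> x r < x p \<and> x r < x q"
  shows "\<exists>d y1 y2. edge n d y1 \<and> edge n d y2 \<and> edge n y1 x \<and> edge n y2 x \<and> y1 \<noteq> y2"
proof -
  have ne: "x p \<noteq> x q" "x q \<noteq> x r" "x p \<noteq> x r" using p Sym_eq_iff[OF x] by auto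
  have down: "\<exists>d y1 y2. edge n d y1 \<and> edge n d y2 \<and> edge n y1 x \<and> edge n y2 x \<and> y1 \<noteq> y2"
    if y: "y1 = x(i1 := x j1, j1 := x i1)" "y2 = x(i2 := x j2, j2 := x i2)" "i1 < j1" "i2 < j2" "x j1 < x i1" "x j2 < x i2"
      and d: "d = y1(i3 := y1 j3, j3 := y1 i3)" "d = y2(i4 := y2 j4, j4 := y2 i4)" "i3 < j3" "i4 < j4" "y1 j3 < y1 i3" "y2 j4 < y2 i4"
      and s: "{i1, j1, i2, j2, i3, j3, i4, j4} \<subseteq> {p, q, r}" and "y1 p \<noteq> y2 p"
    for d y1 y2 i1 j1 i2 j2 i3 j3 i4 j4
  proof -
    have b: "1 \<le> i \<and> i \<le> n" if "i \<in> {p, q, r}" for i using that p by auto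
    have r: "1 \<le> i1" "j1 \<le> n" "1 \<le> i2" "j2 \<le> n" "1 \<le> i3" "j3 \<le> n" "1 \<le> i4" "j4 \<le> n"
      using s b by auto
    have e: "edge n y1 x" "edge n y2 x"
      using edge_upd_down[OF x r(1) y(3) r(2) y(5,1)] edge_upd_down[OF x r(3) y(4) r(4) y(6,2)] by auto
    have "edge n d y1" "edge n d y2"
      using edge_upd_down[OF edgeD(1)[OF e(1)] r(5) d(3) r(6) d(5,1)]
        edge_upd_down[OF edgeD(1)[OF e(2)] r(7) d(4) r(8) d(6,2)] by auto
    moreover have "y1 \<noteq> y2" using \<open>y1 p \<noteq> y2 p\<close> by metis
    ultimately show ?thesis using e by blast
  qed
  consider "x r < x q \<and> x q < x p" | "x q < x r \<and> x r < x p" | "x r < x p \<and> x p < x q"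
    using inv ne by linarith
  then show ?thesis
  proof cases
    case 1
    show ?thesis
      by (rule down[of "x(p := x q, q := x p)" p q "x(q := x r, r := x q)" q r "x(p := x q, q := x r, r := x p)" q r p r])
        (use 1 p ne in \<open>auto simp: fun_eq_iff\<close>)
  next
    case 2
    show ?thesis
      by (rule down[of "x(p := x q, q := x p)" p q "x(p := x r, r := x p)" p r "x(p := x q, q := x r, r := x p)" q r p q])
        (use 2 p ne in \<open>auto simp: fun_eq_iff\<close>)
  next
    case 3
    show ?thesis
      by (rule down[of "x(p := x r, r := x p)" p r "x(q := x r, r := x q)" q r "x(p := x r, q := x p, r := x q)" q r p q])
        (use 3 p ne in \<open>auto simp: fun_eq_iff\<close>)
  qed
qed

lemma diamond_below:
  assumes x: "x \<in> Sym n" and "s \<in> invs x" "t \<in> invs x" "s \<noteq> t"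
  shows "\<exists>d y1 y2. edge n d y1 \<and> edge n d y2 \<and> edge n y1 x \<and> edge n y2 x \<and> y1 \<noteq> y2"
proof -
  obtain i j where s: "s = (i, j)" "i < j" "x j < x i" using assms by (auto simp: invs_def)
  obtain k l where t: "t = (k, l)" "k < l" "x l < x k" using assms by (auto simp: invs_def)
  have r: "1 \<le> i" "j \<le> n" "1 \<le> k" "l \<le> n" using invs_range[OF x] assms s t by auto
  consider "i = k" "j < l" | "i = k" "l < j" | "j = l" "i < k" | "j = l" "k < i" | "j = k" | "i = l"
    | "i \<noteq> k" "i \<noteq> l" "j \<noteq> k" "j \<noteq> l"
    using s(1) t(1) \<open>s \<noteq> t\<close> by (metis linorder_neqE_nat)
  then show ?thesis
  proof cases
    case 1 then show ?thesis using s t r by (intro diamond_below_shared[OF x, of i j l]) auto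
  next
    case 2 then show ?thesis using s t r by (intro diamond_below_shared[OF x, of i l j]) auto
  next
    case 3 then show ?thesis using s t r by (intro diamond_below_shared[OF x, of i k j]) auto
  next
    case 4 then show ?thesis using s t r by (intro diamond_below_shared[OF x, of k i j]) auto
  next
    case 5 then show ?thesis using s t r by (intro diamond_below_shared[OF x, of i j l]) auto
  next
    case 6 then show ?thesis using s t r by (intro diamond_below_shared[OF x, of k i j]) auto
  next
    case 7
    define y1 where "y1 = x(i := x j, j := x i)"
    define y2 where "y2 = x(k := x l, l := x k)"
    define d where "d = x(i := x j, j := x i, k := x l, l := x k)"
    have e: "edge n y1 x" "edge n y2 x"
      using edge_upd_down[OF x r(1) s(2) r(2) s(3) y1_def] edge_upd_down[OF x r(3) t(2) r(4) t(3) y2_def] by auto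
    have "edge n d y1" using s t r 7 edgeD(1)[OF e(1)]
      by (intro edge_upd_down[of y1 n k l]) (auto simp: y1_def d_def)
    moreover have "edge n d y2" using s t r 7 edgeD(1)[OF e(2)]
      by (intro edge_upd_down[of y2 n i j]) (auto simp: y2_def d_def fun_eq_iff)
    moreover have "y1 i \<noteq> y2 i" using s t 7 by (auto simp: y1_def y2_def)
    then have "y1 \<noteq> y2" by metis
    ultimately show ?thesis using e by blast
  qed
qed

section \<open>The set \<open>I\<close> as part of a parabolic subgroup\<close>

locale lower_decomposition =
  fixes n :: nat and v :: perm and I :: "perm set"
  assumes v: "v \<in> Sym n" and dec: "hypercube_decomposition n id v I"
begin

definition refl_below :: "nat \<Rightarrow> nat \<Rightarrow> bool" where
  "refl_below a c \<longleftrightarrow> 1 \<le> a \<and> a < c \<and> c \<le> n \<and> bruhat_le n (Transposition.transpose a c) v"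

text \<open>The steps sought are the borders between blocks of the parabolic subgroup, so
  \<open>cut a c\<close> says that \<open>(a c)\<close> lies outside that subgroup.\<close>

definition cut :: "nat \<Rightarrow> nat \<Rightarrow> bool" where
  "cut a c \<longleftrightarrow> (\<exists>k. a \<le> k \<and> k < c \<and> Transposition.transpose k (Suc k) \<notin> I)"

lemma cut_split: "a < b \<Longrightarrow> b < c \<Longrightarrow> cut a c \<longleftrightarrow> cut a b \<or> cut b c"
  unfolding cut_def by (meson le_less_trans less_le_trans less_imp_le not_le)

lemma cut_mono: "cut b c \<Longrightarrow> a \<le> b \<Longrightarrow> c \<le> d \<Longrightarrow> cut a d"
  unfolding cut_def by (meson le_trans less_le_trans)

lemma interval_id: "x \<in> interval n id v \<longleftrightarrow> bruhat_le n x v"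
  using id_bruhat_le bruhat_le_Sym by (auto simp: interval_def)

lemma refl_below_iff:
  "refl_below a c \<longleftrightarrow> 1 \<le> a \<and> a < c \<and> c \<le> n \<and> rises v a c \<and> falls v a c"
  using transpose_bruhat_le_iff[OF v] by (auto simp: refl_below_def)

text \<open>The strands may come from different elements, since both persist up to \<open>v\<close>.
  This turns two rival tops of a diamond into a reflection below \<open>v\<close>.\<close>

lemma refl_belowI:
  assumes "1 \<le> a" "a < c" "c \<le> n" "bruhat_le n y v" "rises y a c" "bruhat_le n y' v" "falls y' a c"
  shows "refl_below a c"
  using assms rises_mono falls_mono by (auto simp: refl_below_iff)

lemma refl_below_sub: "refl_below a c \<Longrightarrow> a \<le> p \<Longrightarrow> p < q \<Longrightarrow> q \<le> c \<Longrightarrow> refl_below p q"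
  by (auto simp: refl_below_iff intro: rises_subinterval falls_subinterval)

lemma I_eq_interval: obtains z where "bruhat_le n z v" "I = interval n id z"
  using dec interval_id by (auto simp: hypercube_decomposition_def)

lemma I_iff: obtains z where "bruhat_le n z v" "\<And>x. x \<in> I \<longleftrightarrow> bruhat_le n x z"
proof -
  obtain z where z: "bruhat_le n z v" "I = interval n id z" using I_eq_interval .
  have "x \<in> I \<longleftrightarrow> bruhat_le n x z" for x
    using id_bruhat_le[of x n] bruhat_le_Sym[of n x z] unfolding z(2) interval_def by blast
  then show ?thesis using that z(1) by blast
qed

lemma I_le: "x \<in> I \<Longrightarrow> bruhat_le n x v"
  using I_iff bruhat_le_trans by metis

lemma I_down: "x \<in> I \<Longrightarrow> bruhat_le n y x \<Longrightarrow> y \<in> I"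
  using I_iff bruhat_le_trans by metis

lemma id_in_I: "id \<in> I"
  using I_iff id_bruhat_le bruhat_le_Sym by metis

lemma cluster: "x \<in> I \<Longrightarrow> hypercube_cluster n id v I x"
  using dec by (simp add: hypercube_decomposition_def)

text \<open>\<open>I\<close> is a lower set, so the bottom \<open>d\<close> lies in it together with
  \<open>y1\<close>, and the top is the fourth vertex of a diamond with three vertices in
  \<open>I\<close>.\<close>

lemma diamond_top_in_I:
  assumes "edge n d y1" "edge n d y2" "edge n y1 x" "edge n y2 x" "y1 \<noteq> y2"
    and "y1 \<in> I" "y2 \<in> I" "bruhat_le n x v"
  shows "x \<in> I"
proof -
  have le: "bruhat_le n y1 v" "bruhat_le n y2 v" using assms I_le by auto
  have d: "d \<in> I" using I_down assms edge_imp_bruhat_le by blast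
  then have "{d, y1, y2, x} \<subseteq> interval n id v" using le assms I_le interval_id by auto
  then obtain f where f: "cube_map n id v f {y1, y2}" "f {} = d" "f {y1} = y1" "f {y2} = y2" "f {y1, y2} = x"
    using diamond_cube_map[OF assms(1-5)] by metis
  have "hypercube n id v 2 (cube_graph f {y1, y2})"
    using hypercube_cube_graph[OF f(1)] assms(5) by (simp add: numeral_2_eq_2)
  moreover have "pverts (cube_graph f {y1, y2}) = {d, y1, y2, x}"
    using f by (auto simp: cube_graph_def Pow_insert)
  then have "x \<in> pverts (cube_graph f {y1, y2})" "pverts (cube_graph f {y1, y2}) - {x} \<subseteq> I"
    using assms d by auto
  moreover have "diamond_closed n id v I" using dec by (simp add: hypercube_decomposition_def)
  ultimately show ?thesis unfolding diamond_closed_def by blast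
qed

text \<open>Every element with at least two inversions is the top of a diamond, so diamond-closedness
  forces \<open>I\<close> to contain everything below \<open>v\<close> in the parabolic subgroup of its simple reflections.\<close>

lemma mem_I_iff:
  "x \<in> I \<longleftrightarrow> bruhat_le n x v \<and>
    (\<forall>k. 1 \<le> k \<longrightarrow> k < n \<longrightarrow> rises x k (Suc k) \<longrightarrow> Transposition.transpose k (Suc k) \<in> I)"
proof
  assume x: "x \<in> I"
  have "Transposition.transpose k (Suc k) \<in> I" if "1 \<le> k" "k < n" "rises x k (Suc k)" for k
  proof -
    have S: "x \<in> Sym n" using I_le[OF x] bruhat_le_Sym by blast
    have "bruhat_le n (Transposition.transpose k (Suc k)) x"
      using that rises_Suc_iff_falls[OF S] by (intro transpose_bruhat_leI[OF S]) auto
    then show ?thesis using I_down[OF x] by blast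
  qed
  then show "bruhat_le n x v \<and>
    (\<forall>k. 1 \<le> k \<longrightarrow> k < n \<longrightarrow> rises x k (Suc k) \<longrightarrow> Transposition.transpose k (Suc k) \<in> I)"
    using I_le[OF x] by blast
next
  assume "bruhat_le n x v \<and>
    (\<forall>k. 1 \<le> k \<longrightarrow> k < n \<longrightarrow> rises x k (Suc k) \<longrightarrow> Transposition.transpose k (Suc k) \<in> I)"
  then show "x \<in> I"
  proof (induction "len n x" arbitrary: x rule: less_induct)
    case less
    then have le: "bruhat_le n x v" by blast
    then have x: "x \<in> Sym n" using bruhat_le_Sym by blast
    show ?case
    proof (cases "\<exists>s\<in>invs x. \<exists>t\<in>invs x. s \<noteq> t")
      case False
      then consider "x = id" | k where "1 \<le> k" "k < n" "x = Transposition.transpose k (Suc k)"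
        using Sym_atMost_one_inversion[OF x] by blast
      then show ?thesis
      proof cases
        case (2 k)
        then have "rises x k (Suc k)" using rises_transpose[of k "Suc k" k "Suc k"] by simp
        then show ?thesis using less.prems 2 by simp
      qed (use id_in_I in simp)
    next
      case True
      then obtain d y1 y2 where e: "edge n d y1" "edge n d y2" "edge n y1 x" "edge n y2 x" "y1 \<noteq> y2"
        using diamond_below[OF x] by blast
      have "y \<in> I" if "edge n y x" for y
      proof (rule less.hyps)
        show "len n y < len n x" using edgeD(3)[OF that] .
        show "bruhat_le n y v \<and>
            (\<forall>k. 1 \<le> k \<longrightarrow> k < n \<longrightarrow> rises y k (Suc k) \<longrightarrow> Transposition.transpose k (Suc k) \<in> I)"
          using less.prems edge_imp_bruhat_le[OF that] bruhat_le_trans rises_mono by blast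
      qed
      then show ?thesis using diamond_top_in_I[OF e] e le by blast
    qed
  qed
qed

lemma not_mem_I:
  assumes "cut a c" "1 \<le> a" "c \<le> n" "rises y a c \<or> falls y a c"
  shows "y \<notin> I"
proof
  assume y: "y \<in> I"
  then have S: "y \<in> Sym n" using I_le bruhat_le_Sym by blast
  obtain k where k: "a \<le> k" "k < c" "Transposition.transpose k (Suc k) \<notin> I"
    using assms by (auto simp: cut_def)
  then have "rises y k (Suc k) \<or> falls y k (Suc k)"
    using assms(4) rises_subinterval[of y a c k "Suc k"] falls_subinterval[of y a c k "Suc k"] by auto
  then have "rises y k (Suc k)" using rises_Suc_iff_falls[OF S] by blast
  then show False using y k assms mem_I_iff[of y] by auto
qed

lemma transpose_in_I_iff:
  assumes "refl_below a c"
  shows "Transposition.transpose a c \<in> I \<longleftrightarrow> \<not> cut a c"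
proof -
  have ac: "1 \<le> a" "a < c" "c \<le> n" "bruhat_le n (Transposition.transpose a c) v"
    using assms by (auto simp: refl_below_def)
  have "rises (Transposition.transpose a c) k (Suc k) \<longleftrightarrow> a \<le> k \<and> k < c" for k
    using rises_transpose[OF ac(2), of k "Suc k"] by auto
  then show ?thesis unfolding mem_I_iff[of "Transposition.transpose a c"] cut_def using ac by auto
qed

lemma edge_id_transpose: "1 \<le> a \<Longrightarrow> a < c \<Longrightarrow> c \<le> n \<Longrightarrow> edge n id (Transposition.transpose a c)"
  using edge_right_iff[OF Sym_id, of a c] by (simp add: id_comp del: o_apply)

lemma upper_nbrs_id:
  "upper_nbrs n id v I id = {Transposition.transpose a c | a c. refl_below a c \<and> cut a c}"
proof (intro equalityI subsetI)
  fix y assume y: "y \<in> upper_nbrs n id v I id"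
  then have e: "edge n id y" "y \<notin> I" "bruhat_le n y v" by (auto simp: upper_nbrs_def interval_id)
  obtain a c where "1 \<le> a" "a < c" "c \<le> n" "y = id \<circ> Transposition.transpose a c"
    using edge_rightD[OF e(1)] .
  then have ac: "refl_below a c" "y = Transposition.transpose a c" using e by (auto simp: refl_below_def)
  then show "y \<in> {Transposition.transpose a c | a c. refl_below a c \<and> cut a c}"
    using e transpose_in_I_iff[of a c] by blast
next
  fix y assume "y \<in> {Transposition.transpose a c | a c. refl_below a c \<and> cut a c}"
  then obtain a c where ac: "refl_below a c" "cut a c" and [simp]: "y = Transposition.transpose a c" by blast
  then show "y \<in> upper_nbrs n id v I id"
    using transpose_in_I_iff[of a c] edge_id_transpose[of a c]
    by (auto simp: upper_nbrs_def interval_id refl_below_def)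
qed

section \<open>Position of the cuts, from antichains with two or three members\<close>

lemma antichain_pair_id:
  assumes "refl_below a b" "cut a b" "refl_below c d" "cut c d" "a < c" "b < d"
  shows "{Transposition.transpose a b, Transposition.transpose c d} \<in> antichains n id v I id"
    and "Transposition.transpose a b \<noteq> Transposition.transpose c d"
proof -
  have n: "\<not> bruhat_le n (Transposition.transpose a b) (Transposition.transpose c d)"
    "\<not> bruhat_le n (Transposition.transpose c d) (Transposition.transpose a b)"
    using assms transpose_bruhat_le_transpose_iff by (auto simp: refl_below_def)
  show "{Transposition.transpose a b, Transposition.transpose c d} \<in> antichains n id v I id"
    unfolding antichains_def upper_nbrs_id using assms n by (auto simp: pairwise_def)
  show "Transposition.transpose a b \<noteq> Transposition.transpose c d"
    using n(1) bruhat_le_refl Sym_transpose assms by (auto simp: refl_below_def)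
qed

text \<open>If both subintervals were cut, then the two 3-cycles on \<open>a < b < c\<close> would give two diamonds
  above \<open>id\<close> spanned by the same antichain.\<close>

lemma cut_once:
  assumes R: "refl_below a c" and abc: "a < b" "b < c"
  shows "\<not> (cut a b \<and> cut b c)"
proof
  assume N: "cut a b \<and> cut b c"
  have b: "1 \<le> a" "c \<le> n" using R by (auto simp: refl_below_def)
  have Rs: "refl_below a b" "refl_below b c" using R abc refl_below_sub by auto
  let ?y1 = "Transposition.transpose a b" and ?y2 = "Transposition.transpose b c"
  let ?w1 = "id(a := b, b := c, c := a)" and ?w2 = "id(a := c, b := a, c := b)"
  let ?t = "Transposition.transpose a c"
  have y: "?y1 = id(a := b, b := a)" "?y2 = id(b := c, c := b)" "?t = id(a := c, c := a)"
    by (auto simp: fun_eq_iff transpose_def)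
  have A: "{?y1, ?y2} \<in> antichains n id v I id" "?y1 \<noteq> ?y2"
    using antichain_pair_id[OF Rs(1) _ Rs(2)] N abc by auto
  have e: "edge n id ?y1" "edge n id ?y2" using abc b by (auto intro: edge_id_transpose)
  have S: "?y1 \<in> Sym n" "?y2 \<in> Sym n" using e edgeD by blast+
  have e1: "edge n ?y1 ?w1" "edge n ?y2 ?w1" "edge n ?y1 ?w2" "edge n ?y2 ?w2"
    subgoal by (rule edge_upd[OF S(1), of b c]) (use abc b in \<open>auto simp: y fun_eq_iff\<close>)
    subgoal by (rule edge_upd[OF S(2), of a c]) (use abc b in \<open>auto simp: y fun_eq_iff\<close>)
    subgoal by (rule edge_upd[OF S(1), of a c]) (use abc b in \<open>auto simp: y fun_eq_iff\<close>)
    subgoal by (rule edge_upd[OF S(2), of a b]) (use abc b in \<open>auto simp: y fun_eq_iff\<close>)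
    done
  have "edge n ?w1 ?t" "edge n ?w2 ?t"
    subgoal by (rule edge_upd[OF edgeD(2)[OF e1(1)], of a b]) (use abc b in \<open>auto simp: y fun_eq_iff\<close>)
    subgoal by (rule edge_upd[OF edgeD(2)[OF e1(3)], of b c]) (use abc b in \<open>auto simp: y fun_eq_iff\<close>)
    done
  then have le: "bruhat_le n ?w1 v" "bruhat_le n ?w2 v"
    using R edge_imp_bruhat_le bruhat_le_trans unfolding refl_below_def by blast+
  have i: "{id, ?y1, ?y2, w} \<subseteq> interval n id v" if "bruhat_le n w v" for w
    using Rs that id_bruhat_le[OF v] by (auto simp: interval_id refl_below_def)
  have "?w1 a \<noteq> ?w2 a" using abc by simp
  then have ww: "?w1 \<noteq> ?w2" by metis
  obtain f where f: "cube_map n id v f {?y1, ?y2}" "f {} = id" "f {?y1} = ?y1" "f {?y2} = ?y2" "f {?y1, ?y2} = ?w1"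
    using diamond_cube_map[OF e e1(1,2) A(2) i[OF le(1)]] by blast
  obtain g where g: "cube_map n id v g {?y1, ?y2}" "g {} = id" "g {?y1} = ?y1" "g {?y2} = ?y2" "g {?y1, ?y2} = ?w2"
    using diamond_cube_map[OF e e1(3,4) A(2) i[OF le(2)]] by blast
  have "\<exists>!H. hypercube_at n id v id {?y1, ?y2} H"
    using cluster[OF id_in_I] A(1) by (simp add: hypercube_cluster_def)
  then have "theta n id v id {?y1, ?y2} = ?w1" "theta n id v id {?y1, ?y2} = ?w2"
    using theta_eq[of n id v id "{?y1, ?y2}" f] theta_eq[of n id v id "{?y1, ?y2}" g] f g by auto
  then show False using ww by simp
qed

text \<open>Turns the existence of a cube on three atoms into a finite check: the face of the first
  two has one of two tops \<open>w\<close>, and an edge must leave \<open>w\<close> with a label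
  confined by the sets \<open>S\<close>. With \<open>S\<close> the points of a pattern, only
  exchanges inside the pattern have to be examined.\<close>

lemma triple_top:
  assumes x: "x \<in> I" and Y: "{y1, y2, y3} \<in> antichains n id v I x"
    and d: "y1 \<noteq> y2" "y1 \<noteq> y3" "y2 \<noteq> y3"
    and y: "y1 = Transposition.transpose p1 q1 \<circ> x" "y2 = Transposition.transpose p2 q2 \<circ> x"
      "y3 = Transposition.transpose p3 q3 \<circ> x" and pq: "p1 \<noteq> q1" "p2 \<noteq> q2" "p3 \<noteq> q3"
  obtains w i j where
    "w = Transposition.transpose p1 q1 \<circ> y2 \<or> w = Transposition.transpose p2 q2 \<circ> y1"
    "bruhat_le n w v" "i \<noteq> j" "edge n w (Transposition.transpose i j \<circ> w)"
    "bruhat_le n (Transposition.transpose i j \<circ> w) v"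
    "\<forall>S. (p1 \<in> S \<longleftrightarrow> q1 \<in> S) \<and> (p2 \<in> S \<longleftrightarrow> q2 \<in> S) \<longrightarrow> (i \<in> S \<longleftrightarrow> p3 \<in> S) \<and> (j \<in> S \<longleftrightarrow> q3 \<in> S)"
proof -
  let ?f = "theta n id v x"
  note f = theta_cube_map[OF cluster[OF x] Y]
  have fy: "?f {y1} = y1" "?f {y2} = y2" "?f {y3} = y3" using f(3) by auto
  have le: "bruhat_le n (?f B) v" if "B \<subseteq> {y1, y2, y3}" for B
    using cube_map_interval[OF f(1) that] interval_id by blast
  have S: "x \<in> Sym n" using I_le[OF x] bruhat_le_Sym by blast
  have e: "edge n x y1" "edge n x y2"
    using cube_map_edge[OF f(1), of "{}" y1] cube_map_edge[OF f(1), of "{}" y2] fy f(2) by auto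
  let ?w = "?f {y1, y2}"
  have w: "edge n y1 ?w" "edge n y2 ?w"
    using cube_map_edge[OF f(1), of "{y1}" y2] cube_map_edge[OF f(1), of "{y2}" y1] fy d
    by (auto simp: insert_commute)
  have w_cases: "?w = Transposition.transpose p1 q1 \<circ> y2 \<or> ?w = Transposition.transpose p2 q2 \<circ> y1"
    using diamond_top[OF S pq(1,2), of ?w] e w d y by metis
  define p where "p s = (if s = y1 then p1 else if s = y2 then p2 else p3)" for s
  define q where "q s = (if s = y1 then q1 else if s = y2 then q2 else q3)" for s
  have "\<exists>i j. i \<noteq> j \<and> ?f (insert y3 {y1, y2}) = Transposition.transpose i j \<circ> ?w \<and>
    (\<forall>S. (\<forall>t\<in>{y1, y2}. p t \<in> S \<longleftrightarrow> q t \<in> S) \<longrightarrow> (i \<in> S \<longleftrightarrow> p y3 \<in> S) \<and> (j \<in> S \<longleftrightarrow> q y3 \<in> S))"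
  proof (rule cube_map_label[OF f(1)])
    show "p s \<noteq> q s \<and> ?f {s} = Transposition.transpose (p s) (q s) \<circ> ?f {}" if "s \<in> {y1, y2, y3}" for s
      using that fy f(2) y pq d by (auto simp: p_def q_def simp del: o_apply)
  qed (use d in auto)
  then obtain i j where ij: "i \<noteq> j" "?f (insert y3 {y1, y2}) = Transposition.transpose i j \<circ> ?w"
    "\<And>S. \<forall>t\<in>{y1, y2}. p t \<in> S \<longleftrightarrow> q t \<in> S \<Longrightarrow> (i \<in> S \<longleftrightarrow> p y3 \<in> S) \<and> (j \<in> S \<longleftrightarrow> q y3 \<in> S)"
    by blast
  show ?thesis
  proof (rule that[of ?w i j])
    show "edge n ?w (Transposition.transpose i j \<circ> ?w)"
      using cube_map_edge[OF f(1), of "{y1, y2}" y3] d ij(2) by simp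
    show "bruhat_le n ?w v" by (rule le) auto
    show "bruhat_le n (Transposition.transpose i j \<circ> ?w) v"
      unfolding ij(2)[symmetric] by (rule le) auto
    show "\<forall>S. (p1 \<in> S \<longleftrightarrow> q1 \<in> S) \<and> (p2 \<in> S \<longleftrightarrow> q2 \<in> S) \<longrightarrow> (i \<in> S \<longleftrightarrow> p3 \<in> S) \<and> (j \<in> S \<longleftrightarrow> q3 \<in> S)"
    proof (intro allI impI)
      fix S assume "(p1 \<in> S \<longleftrightarrow> q1 \<in> S) \<and> (p2 \<in> S \<longleftrightarrow> q2 \<in> S)"
      then show "(i \<in> S \<longleftrightarrow> p3 \<in> S) \<and> (j \<in> S \<longleftrightarrow> q3 \<in> S)"
        using ij(3)[of S] d by (auto simp: p_def q_def)
    qed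
  qed fact+
qed

lemma antichain_tripleI:
  assumes "\<forall>y\<in>{y1, y2, y3}. bruhat_le n y v \<and> edge n x y \<and> y \<notin> I"
    and "\<not> bruhat_le n y1 y2" "\<not> bruhat_le n y1 y3" "\<not> bruhat_le n y2 y1"
      "\<not> bruhat_le n y2 y3" "\<not> bruhat_le n y3 y1" "\<not> bruhat_le n y3 y2"
  shows "{y1, y2, y3} \<in> antichains n id v I x" "y1 \<noteq> y2" "y1 \<noteq> y3" "y2 \<noteq> y3"
proof -
  show "{y1, y2, y3} \<in> antichains n id v I x"
    using assms by (auto simp: antichains_def upper_nbrs_def interval_id pairwise_def)
  have "y1 \<in> Sym n" "y2 \<in> Sym n" "y3 \<in> Sym n" using assms(1) bruhat_le_Sym by blast+
  then show "y1 \<noteq> y2" "y1 \<noteq> y3" "y2 \<noteq> y3" using assms(2-7) bruhat_le_refl by auto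
qed

end

lemma edge_values_cases:
  assumes "w \<in> Sym n" "edge n w (Transposition.transpose i j \<circ> w)" "i = w k" "j = w l" "k \<noteq> l"
  shows "k < l \<and> w k < w l \<or> l < k \<and> w l < w k"
  using edge_values[OF assms(1), of k l] edge_values[OF assms(1), of l k] assms
  by (cases "k < l") (simp_all add: transpose_commute del: o_apply)

lemma image_eq_pairE:
  assumes "w ` A = A" "i \<in> A" "j \<in> A"
  obtains k l where "k \<in> A" "l \<in> A" "i = w k" "j = w l"
  using assms by (metis imageE)

context lower_decomposition
begin

text \<open>Here \<open>x = (a b)(c d)\<close> is an element of \<open>I\<close>. In one-line notation on \<open>a, b, c, d\<close>, the
  antichain \<open>2341, 4123, 2413\<close> above \<open>x = 2143\<close> cannot span a cube, since its first two elements
  only span a diamond with top \<open>4321\<close>, from which no edge stays inside the pattern.\<close>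

lemma no_inner_cut:
  assumes R: "refl_below a d" and o: "a < b" "b < c" "c < d"
  shows "\<not> cut b c"
proof
  assume N: "cut b c"
  have bd: "1 \<le> a" "d \<le> n" and tv: "bruhat_le n (Transposition.transpose a d) v"
    using R by (auto simp: refl_below_def)
  note od = o bd
  \<comment> \<open>By \<open>cut_once\<close> a cut in \<open>[b, c]\<close> excludes cuts on
    either side of it; this is what puts \<open>?x\<close> into \<open>I\<close>.\<close>
  have Nab: "\<not> cut a b" using cut_once[OF R, of b] cut_split[of b c d] N o by auto
  have Ncd: "\<not> cut c d" using cut_once[OF R, of c] cut_split[of a b c] N o by auto
  let ?x = "id(a := b, b := a, c := d, d := c)"
  let ?y1 = "id(a := b, b := c, c := d, d := a)"
  let ?y2 = "id(a := d, b := a, c := b, d := c)"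
  let ?y3 = "id(a := b, b := d, c := a, d := c)"
  let ?t = "Transposition.transpose a d"
  let ?m1 = "id(a := b, b := d, d := a)" and ?m2 = "id(a := d, b := a, d := b)"
  let ?m3 = "id(a := d, c := a, d := c)"
  have e0: "edge n id (id(a := b, b := a))"
    by (rule edge_upd[OF Sym_id, of a b]) (use od in \<open>auto simp: fun_eq_iff\<close>)
  have ex: "edge n (id(a := b, b := a)) ?x"
    by (rule edge_upd[OF edgeD(2)[OF e0], of c d]) (use od in \<open>auto simp: fun_eq_iff\<close>)
  note S = edgeD(2)[OF ex]
  have e1: "edge n ?x ?y1"
    by (rule edge_upd[OF S, of b d]) (use od in \<open>auto simp: fun_eq_iff\<close>)
  have e2: "edge n ?x ?y2"
    by (rule edge_upd[OF S, of a c]) (use od in \<open>auto simp: fun_eq_iff\<close>)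
  have e3: "edge n ?x ?y3"
    by (rule edge_upd[OF S, of b c]) (use od in \<open>auto simp: fun_eq_iff\<close>)
  have f1: "edge n ?y1 ?m1"
    by (rule edge_upd[OF edgeD(2)[OF e1], of b c]) (use od in \<open>auto simp: fun_eq_iff\<close>)
  have g1: "edge n ?m1 ?t"
    by (rule edge_upd[OF edgeD(2)[OF f1], of a b]) (use od in \<open>auto simp: fun_eq_iff transpose_def\<close>)
  have f2: "edge n ?y2 ?m2"
    by (rule edge_upd[OF edgeD(2)[OF e2], of c d]) (use od in \<open>auto simp: fun_eq_iff\<close>)
  have g2: "edge n ?m2 ?t"
    by (rule edge_upd[OF edgeD(2)[OF f2], of b d]) (use od in \<open>auto simp: fun_eq_iff transpose_def\<close>)
  have f3: "edge n ?y3 (id(a := d, b := b, c := a, d := c))"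
    by (rule edge_upd[OF edgeD(2)[OF e3], of a b]) (use od in \<open>auto simp: fun_eq_iff\<close>)
  have g3: "edge n (id(a := d, b := b, c := a, d := c)) ?t"
    by (rule edge_upd[OF edgeD(2)[OF f3], of c d]) (use od in \<open>auto simp: fun_eq_iff transpose_def\<close>)
  have le: "bruhat_le n ?y1 v" "bruhat_le n ?y2 v" "bruhat_le n ?y3 v"
    using f1 g1 f2 g2 f3 g3 tv edge_imp_bruhat_le bruhat_le_trans by blast+
  have "bruhat_le n ?x v" using e1 le edge_imp_bruhat_le bruhat_le_trans by blast
  moreover have "a \<le> k \<and> k < b \<or> c \<le> k \<and> k < d" if "rises ?x k (Suc k)" for k
    using that od by (auto simp: rises_def split: if_splits)
  ultimately have xI: "?x \<in> I"
    unfolding mem_I_iff[of ?x] using Nab Ncd by (auto simp: cut_def)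
  have r: "rises ?y1 b c" "rises ?y2 b c" "rises ?y3 b c"
    unfolding rises_def
    subgoal using od by (intro exI[of _ b]) simp
    subgoal using od by (intro exI[of _ a]) simp
    subgoal using od by (intro exI[of _ b]) simp
    done
  have notI: "?y1 \<notin> I" "?y2 \<notin> I" "?y3 \<notin> I"
    using not_mem_I[OF N] r od by auto
  \<comment> \<open>All six non-comparabilities are read off from strands: an element with a strand
    is not below one without it.\<close>
  have "falls ?y1 a d" unfolding falls_def using od by (intro exI[of _ d]) simp
  moreover have "\<not> falls ?y2 a d" "\<not> falls ?y3 a d" unfolding falls_def using od by (auto split: if_splits)
  moreover have "rises ?y2 a d" unfolding rises_def using od by (intro exI[of _ a]) simp
  moreover have "\<not> rises ?y1 a d" "\<not> rises ?y3 a d" unfolding rises_def using od by (auto split: if_splits)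
  moreover have "rises ?y3 b d" unfolding rises_def using od by (intro exI[of _ b]) simp
  moreover have "\<not> rises ?y1 b d" unfolding rises_def using od by (auto split: if_splits)
  moreover have "falls ?y3 a c" unfolding falls_def using od by (intro exI[of _ c]) simp
  moreover have "\<not> falls ?y2 a c" unfolding falls_def using od by (auto split: if_splits)
  ultimately have nle: "\<not> bruhat_le n ?y1 ?y2" "\<not> bruhat_le n ?y1 ?y3" "\<not> bruhat_le n ?y2 ?y1"
    "\<not> bruhat_le n ?y2 ?y3" "\<not> bruhat_le n ?y3 ?y1" "\<not> bruhat_le n ?y3 ?y2"
    using rises_mono falls_mono by blast+
  have "\<forall>y\<in>{?y1, ?y2, ?y3}. bruhat_le n y v \<and> edge n ?x y \<and> y \<notin> I"
    using le e1 e2 e3 notI by blast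
  note A = antichain_tripleI[OF this nle]
  have y: "?y1 = Transposition.transpose a c \<circ> ?x" "?y2 = Transposition.transpose b d \<circ> ?x"
    "?y3 = Transposition.transpose a d \<circ> ?x"
    using od by (auto simp: fun_eq_iff transpose_def)
  have ne: "a \<noteq> c" "b \<noteq> d" "a \<noteq> d" using o by auto
  obtain w i j where w: "w = Transposition.transpose a c \<circ> ?y2 \<or> w = Transposition.transpose b d \<circ> ?y1"
    "bruhat_le n w v" "i \<noteq> j" "edge n w (Transposition.transpose i j \<circ> w)"
    "bruhat_le n (Transposition.transpose i j \<circ> w) v"
    and S: "\<forall>S. (a \<in> S \<longleftrightarrow> c \<in> S) \<and> (b \<in> S \<longleftrightarrow> d \<in> S) \<longrightarrow> (i \<in> S \<longleftrightarrow> a \<in> S) \<and> (j \<in> S \<longleftrightarrow> d \<in> S)"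
    by (rule triple_top[OF xI A y ne]) (rule that, assumption+)
  \<comment> \<open>The value pairs \<open>a, c\<close> and \<open>b, d\<close> are disjoint, so
    both candidates for \<open>w\<close> agree. The pattern is decreasing and admits no upward
    exchange.\<close>
  have w': "w = id(a := d, b := c, c := b, d := a)"
    using w(1) od by (auto simp: fun_eq_iff transpose_def)
  have wS: "w ` {a, b, c, d} = {a, b, c, d}" unfolding w' using od by auto
  have ijS: "i \<in> {a, b, c, d}" "j \<in> {a, b, c, d}" using S[THEN spec, of "{a, b, c, d}"] by auto
  obtain k l where kl: "k \<in> {a, b, c, d}" "l \<in> {a, b, c, d}" "i = w k" "j = w l"
    using image_eq_pairE[OF wS ijS] .
  then have "k < l \<and> w k < w l \<or> l < k \<and> w l < w k"
    using edge_values_cases[OF _ w(4) kl(3,4)] w(2,3) bruhat_le_Sym by blast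
  then show False using kl(1,2) od unfolding w' by (elim insertE emptyE) simp_all
qed

text \<open>A diamond above \<open>id\<close> spanned by \<open>(a b)\<close> and \<open>(b d)\<close> shows that \<open>v\<close> has a rising or a falling strand
  across \<open>[a, d]\<close>, and it cannot have both. In one-line notation on \<open>a, b, c, d\<close>, the antichain
  \<open>2314, 1342, 3124\<close> (respectively \<open>3124, 1423, 2314\<close>) above \<open>x = 1324\<close> cannot span a cube, since its
  first two elements only span a diamond with top \<open>4312\<close> (respectively \<open>3421\<close>), and the only edge from
  there inside the pattern leads to \<open>4321\<close>, which has strands of both kinds.\<close>

lemma crossing_cut:
  assumes R1: "refl_below a c" and R2: "refl_below b d" and o: "a < b" "b < c" "c < d"
    and N1: "cut a c" and N2: "cut b d"
  shows "cut b c"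
proof (rule ccontr)
  assume N: "\<not> cut b c"
  have bd: "1 \<le> a" "d \<le> n"
    and tv: "bruhat_le n (Transposition.transpose a c) v" "bruhat_le n (Transposition.transpose b d) v"
    using R1 R2 by (auto simp: refl_below_def)
  note od = o bd
  have Nab: "cut a b" and Ncd: "cut c d" using cut_split[of a b c] cut_split[of b c d] N N1 N2 o by auto
  have nR: "\<not> refl_below a d" using cut_once[of a d b] Nab N2 o by auto
  have excl: "\<not> (rises y a d \<and> falls y' a d)" if "bruhat_le n y v" "bruhat_le n y' v" for y y'
    using refl_belowI[of a d y y'] that nR od by auto
  have Rab: "refl_below a b" using R1 o by (auto intro: refl_below_sub)
  have strand: "rises v a d \<or> falls v a d"
  proof -
    let ?y1 = "Transposition.transpose a b" and ?y2 = "Transposition.transpose b d"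
    have A: "{?y1, ?y2} \<in> antichains n id v I id" "?y1 \<noteq> ?y2"
      using antichain_pair_id[OF Rab Nab R2 N2] o by auto
    note f = theta_cube_map[OF cluster[OF id_in_I] A(1)]
    let ?w = "theta n id v id {?y1, ?y2}"
    have e: "edge n id (?y1 \<circ> id)" "edge n id (?y2 \<circ> id)"
      using edge_id_transpose[of a b] edge_id_transpose[of b d] od by (simp_all only: comp_id)
    have w: "edge n (?y1 \<circ> id) ?w" "edge n (?y2 \<circ> id) ?w"
      using cube_map_edge[OF f(1), of "{?y1}" ?y2] cube_map_edge[OF f(1), of "{?y2}" ?y1] f(3) A(2)
      by (simp_all add: insert_commute)
    have "a \<noteq> b" "b \<noteq> d" using o by auto
    from diamond_top[OF Sym_id this e A(2) w]
    have "?w = ?y1 \<circ> (?y2 \<circ> id) \<or> ?w = ?y2 \<circ> (?y1 \<circ> id)" .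
    \<comment> \<open>The two products of \<open>(a b)\<close> and \<open>(b d)\<close> are the two
      3-cycles; one sends \<open>d\<close> to \<open>a\<close>, the other \<open>a\<close> to
      \<open>d\<close>.\<close>
    then have "?w d = a \<or> ?w a = d" using o by (auto simp: transpose_def)
    then have "falls ?w a d \<or> rises ?w a d" unfolding falls_def rises_def by fastforce
    moreover have "bruhat_le n ?w v" using cube_map_interval[OF f(1), of "{?y1, ?y2}"] interval_id by blast
    ultimately show ?thesis using rises_mono falls_mono by blast
  qed
  let ?x = "id(b := c, c := b)"
  let ?p = "id(a := b, b := c, c := a)"
  let ?q = "id(a := c, b := a, c := b)"
  let ?r1 = "id(b := c, c := d, d := b)"
  let ?r2 = "id(b := d, c := b, d := c)"
  have x: "?x = Transposition.transpose b c" by (auto simp: fun_eq_iff transpose_def)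
  have Rbc: "refl_below b c" using R1 o by (auto intro: refl_below_sub)
  have xI: "?x \<in> I" using transpose_in_I_iff[OF Rbc] N x by simp
  have S: "?x \<in> Sym n" using I_le[OF xI] bruhat_le_Sym by blast
  have e: "edge n ?x ?p" "edge n ?x ?q" "edge n ?x ?r1" "edge n ?x ?r2"
    subgoal by (rule edge_upd[OF S, of a c]) (use od in \<open>auto simp: fun_eq_iff\<close>)
    subgoal by (rule edge_upd[OF S, of a b]) (use od in \<open>auto simp: fun_eq_iff\<close>)
    subgoal by (rule edge_upd[OF S, of c d]) (use od in \<open>auto simp: fun_eq_iff\<close>)
    subgoal by (rule edge_upd[OF S, of b d]) (use od in \<open>auto simp: fun_eq_iff\<close>)
    done
  have "edge n ?p (Transposition.transpose a c)" "edge n ?q (Transposition.transpose a c)"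
    "edge n ?r1 (Transposition.transpose b d)" "edge n ?r2 (Transposition.transpose b d)"
    subgoal by (rule edge_upd[OF edgeD(2)[OF e(1)], of a b]) (use od in \<open>auto simp: fun_eq_iff transpose_def\<close>)
    subgoal by (rule edge_upd[OF edgeD(2)[OF e(2)], of b c]) (use od in \<open>auto simp: fun_eq_iff transpose_def\<close>)
    subgoal by (rule edge_upd[OF edgeD(2)[OF e(3)], of b c]) (use od in \<open>auto simp: fun_eq_iff transpose_def\<close>)
    subgoal by (rule edge_upd[OF edgeD(2)[OF e(4)], of c d]) (use od in \<open>auto simp: fun_eq_iff transpose_def\<close>)
    done
  then have le: "bruhat_le n ?p v" "bruhat_le n ?q v" "bruhat_le n ?r1 v" "bruhat_le n ?r2 v"
    using tv edge_imp_bruhat_le bruhat_le_trans by blast+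
  have ris: "rises ?p a b" "rises ?q a b" "rises ?q a c" "rises ?r1 c d" "rises ?r2 c d"
    subgoal unfolding rises_def using od by (intro exI[of _ a]) simp
    subgoal unfolding rises_def using od by (intro exI[of _ a]) simp
    subgoal unfolding rises_def using od by (intro exI[of _ a]) simp
    subgoal unfolding rises_def using od by (intro exI[of _ c]) simp
    subgoal unfolding rises_def using od by (intro exI[of _ b]) simp
    done
  have fal: "falls ?p a c" unfolding falls_def using od by (intro exI[of _ c]) simp
  have nris: "\<not> rises ?p a c" "\<not> rises ?r1 a c" "\<not> rises ?r2 a c" "\<not> rises ?p c d" "\<not> rises ?q c d"
    unfolding rises_def using od by (auto split: if_splits)
  have nfal: "\<not> falls ?q a c" "\<not> falls ?r1 a c" "\<not> falls ?r2 a c"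
    unfolding falls_def using od by (auto split: if_splits)
  have notI: "?p \<notin> I" "?q \<notin> I" "?r1 \<notin> I" "?r2 \<notin> I"
    using not_mem_I[OF Nab, of ?p] not_mem_I[OF Nab, of ?q] not_mem_I[OF Ncd, of ?r1] not_mem_I[OF Ncd, of ?r2]
      ris od by auto
  have nle: "\<not> bruhat_le n ?p ?q" "\<not> bruhat_le n ?q ?p" "\<not> bruhat_le n ?p ?r1" "\<not> bruhat_le n ?r1 ?p"
    "\<not> bruhat_le n ?p ?r2" "\<not> bruhat_le n ?r2 ?p" "\<not> bruhat_le n ?q ?r1" "\<not> bruhat_le n ?r1 ?q"
    "\<not> bruhat_le n ?q ?r2" "\<not> bruhat_le n ?r2 ?q"
    using ris fal nris nfal rises_mono falls_mono by blast+
  have tp: "?p = Transposition.transpose a b \<circ> ?x" and tq: "?q = Transposition.transpose a c \<circ> ?x"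
    and tr1: "?r1 = Transposition.transpose b d \<circ> ?x" and tr2: "?r2 = Transposition.transpose c d \<circ> ?x"
    using od by (auto simp: fun_eq_iff transpose_def)
  have ne: "a \<noteq> b" "a \<noteq> c" "b \<noteq> d" "c \<noteq> d" using o by auto
  \<comment> \<open>The cases correspond under inversion, which exchanges \<open>?p\<close> with
    \<open>?q\<close>, \<open>?r1\<close> with \<open>?r2\<close>, and rising with falling
    strands.\<close>
  consider "rises v a d" | "falls v a d" using strand by blast
  then show False
  proof cases
    case 1
    then have nf: "\<not> falls y a d" if "bruhat_le n y v" for y
      using excl[OF bruhat_le_refl[OF v] that] by blast
    have "\<forall>y\<in>{?p, ?r1, ?q}. bruhat_le n y v \<and> edge n ?x y \<and> y \<notin> I"
      using le e notI by blast
    note A = antichain_tripleI[OF this nle(3,1,4,8,2,7)]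
    obtain w i j where w: "w = Transposition.transpose a b \<circ> ?r1 \<or> w = Transposition.transpose b d \<circ> ?p"
      "bruhat_le n w v" "i \<noteq> j" "edge n w (Transposition.transpose i j \<circ> w)"
      "bruhat_le n (Transposition.transpose i j \<circ> w) v"
      and S: "\<forall>S. (a \<in> S \<longleftrightarrow> b \<in> S) \<and> (b \<in> S \<longleftrightarrow> d \<in> S) \<longrightarrow> (i \<in> S \<longleftrightarrow> a \<in> S) \<and> (j \<in> S \<longleftrightarrow> c \<in> S)"
      by (rule triple_top[OF xI A tp tr1 tq ne(1,3,2)]) (rule that, assumption+)
    have "w \<noteq> Transposition.transpose a b \<circ> ?r1"
    proof
      assume "w = Transposition.transpose a b \<circ> ?r1"
      then have "w d = a" using o by simp
      then show False using nf[OF w(2)] unfolding falls_def by auto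
    qed
    then have w': "w = id(a := d, b := c, c := a, d := b)"
      using w(1) od by (auto simp: fun_eq_iff transpose_def)
    have wS: "w ` {a, b, c, d} = {a, b, c, d}" unfolding w' using od by auto
    have ijS: "i \<in> {a, b, c, d}" "j \<in> {a, b, c, d}" using S[THEN spec, of "{a, b, c, d}"] by auto
    obtain k l where kl: "k \<in> {a, b, c, d}" "l \<in> {a, b, c, d}" "i = w k" "j = w l"
      using image_eq_pairE[OF wS ijS] .
    then have "k < l \<and> w k < w l \<or> l < k \<and> w l < w k"
      using edge_values_cases[OF _ w(4) kl(3,4)] w(2,3) bruhat_le_Sym by blast
    \<comment> \<open>Among the pattern positions of \<open>w\<close> only \<open>c\<close> and
      \<open>d\<close> carry values in increasing order; exchanging these values \<open>a, b\<close>
      creates the excluded falling strand.\<close>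
    then have "{i, j} = {a, b}" using kl od unfolding w' by (elim insertE emptyE) auto
    then have "(Transposition.transpose i j \<circ> w) d = a"
      unfolding w' using od by (auto simp: doubleton_eq_iff)
    then show False using nf[OF w(5)] unfolding falls_def by auto
  next
    case 2
    then have nf: "\<not> rises y a d" if "bruhat_le n y v" for y
      using excl[OF that bruhat_le_refl[OF v]] by blast
    have "\<forall>y\<in>{?q, ?r2, ?p}. bruhat_le n y v \<and> edge n ?x y \<and> y \<notin> I"
      using le e notI by blast
    note A = antichain_tripleI[OF this nle(9,2,10,6,1,5)]
    obtain w i j where w: "w = Transposition.transpose a c \<circ> ?r2 \<or> w = Transposition.transpose c d \<circ> ?q"
      "bruhat_le n w v" "i \<noteq> j" "edge n w (Transposition.transpose i j \<circ> w)"
      "bruhat_le n (Transposition.transpose i j \<circ> w) v"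
      and S: "\<forall>S. (a \<in> S \<longleftrightarrow> c \<in> S) \<and> (c \<in> S \<longleftrightarrow> d \<in> S) \<longrightarrow> (i \<in> S \<longleftrightarrow> a \<in> S) \<and> (j \<in> S \<longleftrightarrow> b \<in> S)"
      by (rule triple_top[OF xI A tq tr2 tp ne(2,4,1)]) (rule that, assumption+)
    have "w \<noteq> Transposition.transpose c d \<circ> ?q"
    proof
      assume "w = Transposition.transpose c d \<circ> ?q"
      then have "w a = d" using o by simp
      then show False using nf[OF w(2)] unfolding rises_def by auto
    qed
    then have w': "w = id(a := c, b := d, c := b, d := a)"
      using w(1) od by (auto simp: fun_eq_iff transpose_def)
    have wS: "w ` {a, b, c, d} = {a, b, c, d}" unfolding w' using od by auto
    have ijS: "i \<in> {a, b, c, d}" "j \<in> {a, b, c, d}" using S[THEN spec, of "{a, b, c, d}"] by auto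
    obtain k l where kl: "k \<in> {a, b, c, d}" "l \<in> {a, b, c, d}" "i = w k" "j = w l"
      using image_eq_pairE[OF wS ijS] .
    then have "k < l \<and> w k < w l \<or> l < k \<and> w l < w k"
      using edge_values_cases[OF _ w(4) kl(3,4)] w(2,3) bruhat_le_Sym by blast
    then have "{i, j} = {c, d}" using kl od unfolding w' by (elim insertE emptyE) auto
    then have "(Transposition.transpose i j \<circ> w) a = d"
      unfolding w' using od by (auto simp: doubleton_eq_iff)
    then show False using nf[OF w(5)] unfolding rises_def by auto
  qed
qed

end

section \<open>Property (E)\<close>

lemma transpose_eq_transpose_iff:
  fixes a b c d :: nat
  assumes "a < b" "c < d"
  shows "Transposition.transpose a b = Transposition.transpose c d \<longleftrightarrow> a = c \<and> b = d"
proof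
  assume eq: "Transposition.transpose a b = Transposition.transpose c d"
  then have "Transposition.transpose c d a = b" by (metis transpose_apply_first)
  then show "a = c \<and> b = d" using assms by (auto simp: transpose_def split: if_splits)
qed simp

context lower_decomposition
begin

text \<open>Numbers the blocks of the parabolic subgroup from left to right.\<close>

definition block :: "nat \<Rightarrow> nat" where
  "block b = card {k. k < b \<and> Transposition.transpose k (Suc k) \<notin> I}"

lemma block_less_iff:
  assumes "a < b"
  shows "block a < block b \<longleftrightarrow> cut a b"
proof -
  define G where "G b = {k. k < b \<and> Transposition.transpose k (Suc k) \<notin> I}" for b
  have G: "block b = card (G b)" "finite (G b)" for b by (simp_all add: block_def G_def)
  have sub: "G a \<subseteq> G b" using assms by (auto simp: G_def)
  have "cut a b \<longleftrightarrow> (\<exists>k. k \<in> G b \<and> k \<notin> G a)" by (auto simp: cut_def G_def not_less)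
  also have "\<dots> \<longleftrightarrow> G a \<subset> G b" using sub by blast
  also have "\<dots> \<longleftrightarrow> card (G a) < card (G b)"
    using sub G(2) psubset_card_mono[of "G b" "G a"] by (auto simp: psubset_eq)
  finally show ?thesis by (simp add: G)
qed

lemma block_mono: "a \<le> b \<Longrightarrow> block a \<le> block b"
  unfolding block_def by (intro card_mono) auto

text \<open>The order of the inversions along a reduced word of the longest permutation that starts with a
  reduced word of the longest element of the parabolic subgroup.\<close>

definition key :: "nat \<Rightarrow> nat \<Rightarrow> nat \<times> nat \<times> nat \<times> nat" where
  "key a b = (if cut a b then (1, a, block b, n - b) else (0, a, b, 0))"

lemma key_inj: "b \<le> n \<Longrightarrow> d \<le> n \<Longrightarrow> key a b = key c d \<Longrightarrow> a = c \<and> b = d"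
  by (auto simp: key_def split: if_splits)

definition adapted_order :: "perm rel" where
  "adapted_order = {(Transposition.transpose a b, Transposition.transpose c d) | a b c d.
     1 \<le> a \<and> a < b \<and> b \<le> n \<and> 1 \<le> c \<and> c < d \<and> d \<le> n \<and> key a b < key c d}"

lemma adapted_order_iff:
  assumes "1 \<le> a" "a < b" "b \<le> n" "1 \<le> c" "c < d" "d \<le> n"
  shows "(Transposition.transpose a b, Transposition.transpose c d) \<in> adapted_order \<longleftrightarrow> key a b < key c d"
  using assms transpose_eq_transpose_iff unfolding adapted_order_def by auto

lemma reflection_order_adapted: "reflection_order n adapted_order"
  unfolding reflection_order_def strict_linear_order_on_def
proof (intro conjI allI impI)
  show sub: "adapted_order \<subseteq> reflections n \<times> reflections n"
    by (auto simp: adapted_order_def reflections_def)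
  have E: "\<exists>a b. t = Transposition.transpose a b \<and> 1 \<le> a \<and> a < b \<and> b \<le> n" if "t \<in> reflections n" for t
    using that by (auto simp: reflections_def)
  show "trans adapted_order"
  proof (rule transI)
    fix r s t assume rs: "(r, s) \<in> adapted_order" and st: "(s, t) \<in> adapted_order"
    then have "r \<in> reflections n" "s \<in> reflections n" "t \<in> reflections n" using sub by auto
    then obtain a b c d e f where "r = Transposition.transpose a b" "1 \<le> a" "a < b" "b \<le> n"
      "s = Transposition.transpose c d" "1 \<le> c" "c < d" "d \<le> n"
      "t = Transposition.transpose e f" "1 \<le> e" "e < f" "f \<le> n" using E by metis
    then show "(r, t) \<in> adapted_order" using rs st less_trans by (simp add: adapted_order_iff)
  qed
  show "irrefl adapted_order"
  proof (rule irreflI)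
    fix t show "(t, t) \<notin> adapted_order"
    proof
      assume t: "(t, t) \<in> adapted_order"
      then obtain a b where "t = Transposition.transpose a b" "1 \<le> a" "a < b" "b \<le> n" using E sub by blast
      then show False using t by (simp add: adapted_order_iff)
    qed
  qed
  show "total_on (reflections n) adapted_order"
  proof (rule total_onI)
    fix s t assume "s \<in> reflections n" "t \<in> reflections n" "s \<noteq> t"
    then obtain a b c d where ab: "s = Transposition.transpose a b" "1 \<le> a" "a < b" "b \<le> n"
      and cd: "t = Transposition.transpose c d" "1 \<le> c" "c < d" "d \<le> n" using E by metis
    have "key a b \<noteq> key c d" using key_inj[of b d a c] ab cd \<open>s \<noteq> t\<close> by auto
    then show "(s, t) \<in> adapted_order \<or> (t, s) \<in> adapted_order"
      using ab cd by (auto simp: adapted_order_iff)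
  qed
  fix a b c assume abc: "1 \<le> a \<and> a < b \<and> b < c \<and> c \<le> n"
  \<comment> \<open>The first alternative holds unless only \<open>[a, b]\<close> is cut. Then
    \<open>(b c)\<close> is uncut and comes first, so \<open>(a c)\<close> must precede
    \<open>(a b)\<close>: both end in one block, and the last coordinate \<open>n - b\<close>
    reverses the order there.\<close>
  have "key a b < key a c \<and> key a c < key b c \<or> key b c < key a c \<and> key a c < key a b"
    using abc cut_split[of a b c] block_less_iff[of b c] block_mono[of b c]
    by (auto simp: key_def order_le_less)
  then show "let ab = Transposition.transpose a b; ac = Transposition.transpose a c; bc = Transposition.transpose b c
    in ((ab, ac) \<in> adapted_order \<and> (ac, bc) \<in> adapted_order) \<or> ((bc, ac) \<in> adapted_order \<and> (ac, ab) \<in> adapted_order)"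
    using abc by (simp add: Let_def adapted_order_iff)
qed

lemma edge_label:
  assumes "edge n x y"
  obtains a b where "1 \<le> a" "a < b" "b \<le> n" "label x y = Transposition.transpose a b"
    "y = Transposition.transpose a b \<circ> x"
proof -
  have x: "x \<in> Sym n" using edgeD assms by blast
  obtain a b where "1 \<le> a" "a < b" "b \<le> n" and y: "y = Transposition.transpose a b \<circ> x"
    using edge_leftD[OF assms] .
  moreover have "label x y = Transposition.transpose a b"
    using x unfolding label_def y by (auto simp: fun_eq_iff)
  ultimately show ?thesis using that by blast
qed

lemma I_preserves:
  assumes "x \<in> I" "1 \<le> k" "k < n" "Transposition.transpose k (Suc k) \<notin> I"
  shows "x i \<le> k \<longleftrightarrow> i \<le> k"
proof -
  have S: "x \<in> Sym n" using I_le assms bruhat_le_Sym by blast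
  have "\<not> rises x k (Suc k)" using assms mem_I_iff by blast
  then have "\<not> falls x k (Suc k)" using rises_Suc_iff_falls[OF S] by blast
  then show ?thesis using \<open>\<not> rises x k (Suc k)\<close> unfolding rises_def falls_def
    by (meson not_less_eq_eq)
qed

lemma property_E_I: "property_E n v I x"
  unfolding property_E_def
proof (intro exI[of _ adapted_order] conjI reflection_order_adapted ballI impI)
  fix x1 x2 x3 y
  assume "x1 \<in> I \<inter> interval n x v" "x2 \<in> I \<inter> interval n x v" "x3 \<in> I \<inter> interval n x v"
    "y \<in> interval n x v - I" and e: "edge n x1 x2 \<and> edge n x3 y"
  then have I: "x1 \<in> I" "x2 \<in> I" "x3 \<in> I" "y \<notin> I" "bruhat_le n y v" by (auto simp: interval_def)
  obtain a b where ab: "1 \<le> a" "a < b" "b \<le> n" "label x1 x2 = Transposition.transpose a b"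
    "x2 = Transposition.transpose a b \<circ> x1"
    using edge_label e by blast
  obtain c d where cd: "1 \<le> c" "c < d" "d \<le> n" "label x3 y = Transposition.transpose c d"
    "y = Transposition.transpose c d \<circ> x3"
    using edge_label e by blast
  have S: "x1 \<in> Sym n" using e edgeD by blast
  have "\<not> cut a b"
  proof
    assume "cut a b"
    then obtain k where k: "a \<le> k" "k < b" "Transposition.transpose k (Suc k) \<notin> I" by (auto simp: cut_def)
    then have "1 \<le> k" "k < n" using ab by auto
    \<comment> \<open>\<open>x1\<close> and \<open>x2\<close> send the position
      \<open>inv x1 a\<close> to \<open>a\<close> and \<open>b\<close>, on different sides of the
      missing step, whereas elements of \<open>I\<close> keep sides.\<close>
    then show False
      using I_preserves[OF I(1) _ _ k(3), of "inv x1 a"] I_preserves[OF I(2) _ _ k(3), of "inv x1 a"] k S ab(5)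
      by simp
  qed
  moreover have "cut c d"
  proof -
    obtain k where k: "1 \<le> k" "k < n" "rises y k (Suc k)" "Transposition.transpose k (Suc k) \<notin> I"
      using I mem_I_iff by blast
    then obtain i where i: "i \<le> k" "Suc k \<le> y i" by (auto simp: rises_def)
    moreover have "x3 i \<le> k" using I_preserves[OF I(3) k(1,2,4)] i by simp
    ultimately have "c \<le> k \<and> k < d" using cd by (auto simp: transpose_def split: if_splits)
    then show ?thesis using k by (auto simp: cut_def)
  qed
  ultimately show "(label x1 x2, label x3 y) \<in> adapted_order"
    using ab cd by (simp add: adapted_order_iff key_def)
qed

end

section \<open>Antichains of reflections\<close>

text \<open>Members of an antichain are permutations; \<open>lo\<close> and \<open>hi\<close> read
  the ends of the interval back from a transposition.\<close>

definition lo :: "perm \<Rightarrow> nat" where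
  "lo t = (LEAST k. t k \<noteq> k)"

definition hi :: "perm \<Rightarrow> nat" where
  "hi t = t (lo t)"

lemma lo_transpose [simp]: "a < b \<Longrightarrow> lo (Transposition.transpose a b) = a"
  unfolding lo_def by (rule Least_equality) (auto simp: transpose_def split: if_splits)

lemma hi_transpose [simp]: "a < b \<Longrightarrow> hi (Transposition.transpose a b) = b"
  by (simp add: hi_def)

lemma len_id: "len n id = 0"
proof -
  have "invs id = {}" by (auto simp: invs_def)
  then show ?thesis using len_eq_card_invs[OF Sym_id] by (metis card.empty)
qed

text \<open>All positions strictly between \<open>a\<close> and \<open>c\<close> are fixed and
  \<open>w a <= a\<close>, so each of them counts in \<open>len_transpose_right\<close>. The left
  version is the right one for the inverse.\<close>

lemma len_transpose_above:
  assumes w: "w \<in> Sym n" and ac: "1 \<le> a" "a < c" "c \<le> n" and fix_above: "\<And>k. a < k \<Longrightarrow> w k = k"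
  shows "len n (w \<circ> Transposition.transpose a c) + 1 = len n w + 2 * (c - a)"
    and "len n (Transposition.transpose a c \<circ> w) + 1 = len n w + 2 * (c - a)"
proof -
  have *: "len n (w \<circ> Transposition.transpose a c) + 1 = len n w + 2 * (c - a)"
    if w: "w \<in> Sym n" and fix_above: "\<And>k. a < k \<Longrightarrow> w k = k" for w
  proof -
    have "w a \<le> a"
    proof (rule ccontr)
      assume "\<not> w a \<le> a"
      then have "w (w a) = w a" by (intro fix_above) simp
      then show False using \<open>\<not> w a \<le> a\<close> w by (simp add: Sym_eq_iff)
    qed
    then have "{k. a < k \<and> k < c \<and> w a < w k \<and> w k < w c} = {a<..<c}"
      using fix_above ac by auto
    moreover have "w a < w c" using \<open>w a \<le> a\<close> fix_above[of c] ac by simp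
    ultimately show ?thesis using len_transpose_right[OF w ac] ac by simp
  qed
  show "len n (w \<circ> Transposition.transpose a c) + 1 = len n w + 2 * (c - a)"
    using *[OF w fix_above] .
  have "inv w k = k" if "a < k" for k
    using Sym_inv_f[OF w, of k] fix_above[OF that] by simp
  then have "len n (inv w \<circ> Transposition.transpose a c) + 1 = len n (inv w) + 2 * (c - a)"
    using *[OF Sym_inv[OF w]] by blast
  moreover have "Transposition.transpose a c \<circ> w \<in> Sym n"
    using w ac by (intro Sym_comp Sym_transpose) auto
  moreover have "inv (Transposition.transpose a c \<circ> w) = inv w \<circ> Transposition.transpose a c"
    using Sym_bij[OF w] by (subst o_inv_distrib) auto
  ultimately show "len n (Transposition.transpose a c \<circ> w) + 1 = len n w + 2 * (c - a)"
    using len_inv[OF w] len_inv[of "Transposition.transpose a c \<circ> w" n] by simp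
qed

context lower_decomposition
begin

abbreviation antis :: "perm set set" where
  "antis \<equiv> antichains n id v I id"

definition cube_top :: "perm set \<Rightarrow> perm" where
  "cube_top = theta n id v id"

lemma antis_memD:
  assumes "Y \<in> antis" "y \<in> Y"
  shows "refl_below (lo y) (hi y)" "cut (lo y) (hi y)" "y = Transposition.transpose (lo y) (hi y)"
    "1 \<le> lo y" "lo y < hi y" "hi y \<le> n"
proof -
  have "y \<in> upper_nbrs n id v I id" using assms by (auto simp: antichains_def)
  then obtain a b where "refl_below a b" "cut a b" "y = Transposition.transpose a b"
    by (auto simp: upper_nbrs_id)
  then show "refl_below (lo y) (hi y)" "cut (lo y) (hi y)" "y = Transposition.transpose (lo y) (hi y)"
    "1 \<le> lo y" "lo y < hi y" "hi y \<le> n"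
    by (auto simp: refl_below_def)
qed

lemma antis_nested:
  assumes Y: "Y \<in> antis" and y: "y \<in> Y" "y' \<in> Y" and le: "lo y' \<le> lo y" "hi y \<le> hi y'"
  shows "y = y'"
proof (rule ccontr)
  assume "y \<noteq> y'"
  then have "\<not> bruhat_le n y y'" using Y y by (auto simp: antichains_def pairwise_def)
  moreover have "bruhat_le n (Transposition.transpose (lo y) (hi y)) (Transposition.transpose (lo y') (hi y'))"
    using transpose_bruhat_le_transpose_iff antis_memD[OF Y y(1)] antis_memD[OF Y y(2)] le by blast
  ultimately show False using antis_memD(3)[OF Y y(1)] antis_memD(3)[OF Y y(2)] by simp
qed

lemma antis_less_iff:
  assumes Y: "Y \<in> antis" and y: "y \<in> Y" "y' \<in> Y"
  shows "lo y < lo y' \<longleftrightarrow> hi y < hi y'"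
  using antis_nested[OF Y y(1,2)] antis_nested[OF Y y(2,1)] by force

lemma antis_eq_iff:
  assumes Y: "Y \<in> antis" and y: "y \<in> Y" "y' \<in> Y"
  shows "lo y = lo y' \<longleftrightarrow> y = y'" "hi y = hi y' \<longleftrightarrow> y = y'"
  using antis_nested[OF Y y(1,2)] antis_nested[OF Y y(2,1)] by force+

text \<open>The overlap is cut by \<open>crossing_cut\<close>. Were it longer than one step, the cut
  would avoid both ends of the interval of \<open>y\<close> or both ends of that of
  \<open>y'\<close>, against \<open>no_inner_cut\<close>.\<close>

lemma antis_crossing:
  assumes Y: "Y \<in> antis" and y: "y \<in> Y" "y' \<in> Y" and c: "lo y < lo y'" "lo y' < hi y"
  shows "hi y = Suc (lo y')" "cut (lo y') (hi y)"
proof -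
  note m = antis_memD[OF Y y(1)] and m' = antis_memD[OF Y y(2)]
  have h: "hi y < hi y'" using antis_less_iff[OF Y y] c by simp
  show N: "cut (lo y') (hi y)" using crossing_cut[OF m(1) m'(1) c h m(2) m'(2)] .
  show "hi y = Suc (lo y')"
  proof (rule ccontr)
    assume "hi y \<noteq> Suc (lo y')"
    then have k: "lo y' < Suc (lo y')" "Suc (lo y') < hi y" using c by auto
    then have "cut (lo y') (Suc (lo y')) \<or> cut (Suc (lo y')) (hi y)" using cut_split[OF k] N by simp
    then show False
      using no_inner_cut[OF m(1) c(1) k] no_inner_cut[OF m'(1) k h] by blast
  qed
qed

text \<open>Provides a set closed under the other members: \<open>{lo t}\<close> if none has an end
  there, \<open>{..lo t}\<close> if none straddles \<open>lo t\<close>. A member straddling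
  \<open>lo t\<close> is cut just to the right of it, and one ending at \<open>lo t\<close> would
  cross that member and cut it again further left.\<close>

lemma antis_lo_invariant:
  assumes Y: "Y \<in> antis" and t: "t \<in> Y"
  shows "(\<forall>s \<in> Y - {t}. lo s \<noteq> lo t \<and> hi s \<noteq> lo t) \<or> (\<forall>s \<in> Y - {t}. lo s \<le> lo t \<longleftrightarrow> hi s \<le> lo t)"
proof (cases "\<exists>s \<in> Y. lo s < lo t \<and> lo t < hi s")
  case True
  then obtain s where s: "s \<in> Y" "lo s < lo t" "lo t < hi s" by blast
  note cs = antis_crossing[OF Y s(1) t s(2,3)]
  have "hi u \<noteq> lo t" if u: "u \<in> Y" for u
  proof
    assume hu: "hi u = lo t"
    then have "lo u < lo s" using antis_less_iff[OF Y u s(1)] cs by simp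
    then have "hi u = Suc (lo s)" "cut (lo s) (lo t)"
      using antis_crossing[OF Y u s(1)] s hu by auto
    then show False using cut_once[OF antis_memD(1)[OF Y s(1)] s(2,3)] cs by blast
  qed
  then show ?thesis using antis_eq_iff(1)[OF Y _ t] by blast
next
  case False
  have "lo s \<le> lo t \<longleftrightarrow> hi s \<le> lo t" if "s \<in> Y - {t}" for s
    using False that antis_eq_iff(1)[OF Y _ t, of s] antis_memD(5)[OF Y, of s] by force
  then show ?thesis by blast
qed

text \<open>The mirror image: a member straddling \<open>hi t\<close> is cut just before
  \<open>hi t\<close>, and one starting at \<open>hi t\<close> would cut it again.\<close>

lemma antis_hi_invariant:
  assumes Y: "Y \<in> antis" and t: "t \<in> Y"
  shows "(\<forall>s \<in> Y - {t}. lo s \<noteq> hi t \<and> hi s \<noteq> hi t) \<or> (\<forall>s \<in> Y - {t}. hi t \<le> lo s \<longleftrightarrow> hi t \<le> hi s)"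
proof (cases "\<exists>s \<in> Y. lo s < hi t \<and> hi t < hi s")
  case True
  then obtain s where s: "s \<in> Y" "lo s < hi t" "hi t < hi s" by blast
  have "lo t < lo s" using antis_less_iff[OF Y t s(1)] s by simp
  note cs = antis_crossing[OF Y t s(1) this s(2)]
  have "lo u \<noteq> hi t" if u: "u \<in> Y" for u
  proof
    assume lu: "lo u = hi t"
    then have "cut (hi t) (hi s)" using antis_crossing[OF Y s(1) u] s by auto
    then show False using cut_once[OF antis_memD(1)[OF Y s(1)] s(2,3)] cs by blast
  qed
  then show ?thesis using antis_eq_iff(2)[OF Y _ t] by blast
next
  case False
  have "hi t \<le> lo s \<longleftrightarrow> hi t \<le> hi s" if "s \<in> Y - {t}" for s
    using False that antis_eq_iff(2)[OF Y _ t, of s] antis_memD(5)[OF Y, of s] by force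
  then show ?thesis by blast
qed

subsection \<open>Tops of the cubes at the identity\<close>

lemma top_cube_map: "Y \<in> antis \<Longrightarrow> cube_map n id v cube_top Y"
  and top_empty: "cube_top {} = id"
  and top_single: "Y \<in> antis \<Longrightarrow> y \<in> Y \<Longrightarrow> cube_top {y} = y"
proof -
  have "{} \<in> antis" by (simp add: antichains_def)
  then show "cube_top {} = id" unfolding cube_top_def using theta_cube_map(2)[OF cluster[OF id_in_I]] by blast
qed (use theta_cube_map[OF cluster[OF id_in_I]] in \<open>auto simp: cube_top_def\<close>)

lemma top_atoms:
  assumes "Y \<in> antis" "s \<in> Y"
  shows "lo s \<noteq> hi s \<and> cube_top {s} = Transposition.transpose (lo s) (hi s) \<circ> cube_top {}"
  using antis_memD[OF assms] top_single[OF assms] by (simp add: top_empty)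

lemma top_le: "Y \<in> antis \<Longrightarrow> bruhat_le n (cube_top Y) v"
  using cube_map_interval[OF top_cube_map, of Y Y] interval_id by blast

lemma top_Sym: "Y \<in> antis \<Longrightarrow> cube_top Y \<in> Sym n"
  using top_le bruhat_le_Sym by blast

lemma top_edge: "insert t B \<in> antis \<Longrightarrow> t \<notin> B \<Longrightarrow> edge n (cube_top B) (cube_top (insert t B))"
  by (rule cube_map_edge[OF top_cube_map]) auto

lemma top_invariant:
  assumes "Y \<in> antis" "\<And>s. s \<in> Y \<Longrightarrow> lo s \<in> S \<longleftrightarrow> hi s \<in> S"
  shows "cube_top Y k \<in> S \<longleftrightarrow> k \<in> S"
  using cube_map_invariant[OF top_cube_map[OF assms(1)] top_atoms[OF assms(1)], of Y S k] assms(2)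
  by (simp add: top_empty)

lemma top_fixes:
  assumes "Y \<in> antis" "\<And>s. s \<in> Y \<Longrightarrow> lo s \<noteq> k \<and> hi s \<noteq> k"
  shows "cube_top Y k = k"
  using top_invariant[OF assms(1), of "{k}" k] assms(2) by auto

lemma top_label:
  assumes "insert t B \<in> antis" "t \<notin> B"
  obtains i j where "i \<noteq> j" "cube_top (insert t B) = Transposition.transpose i j \<circ> cube_top B"
    "\<forall>S. (\<forall>s\<in>B. lo s \<in> S \<longleftrightarrow> hi s \<in> S) \<longrightarrow> (i \<in> S \<longleftrightarrow> lo t \<in> S) \<and> (j \<in> S \<longleftrightarrow> hi t \<in> S)"
proof -
  have "\<exists>i j. i \<noteq> j \<and> cube_top (insert t B) = Transposition.transpose i j \<circ> cube_top B \<and>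
    (\<forall>S. (\<forall>s\<in>B. lo s \<in> S \<longleftrightarrow> hi s \<in> S) \<longrightarrow> (i \<in> S \<longleftrightarrow> lo t \<in> S) \<and> (j \<in> S \<longleftrightarrow> hi t \<in> S))"
    by (rule cube_map_label[OF top_cube_map[OF assms(1)]]) (use top_atoms[OF assms(1)] assms(2) in auto)
  then show ?thesis by (elim exE conjE) (rule that)
qed

section \<open>The numerical criterion\<close>

text \<open>The label of \<open>t\<close> is \<open>(lo t hi t)\<close> unless some member ends at
  \<open>lo t\<close>. Without that member the label is exact, and the two candidates for the top of
  the resulting diamond multiply \<open>cube_top B\<close> by it from the left or from the
  right.\<close>

lemma top_remove_last:
  assumes Y: "insert t B \<in> antis" "t \<notin> B" and last: "\<And>s. s \<in> B \<Longrightarrow> hi s \<le> lo t"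
  shows "len n (cube_top (insert t B)) + 1 = len n (cube_top B) + 2 * (hi t - lo t)"
proof -
  note t = antis_memD[OF Y(1) insertI1]
  have B: "B \<in> antis" using antichains_subset[OF Y(1)] by blast
  have lt: "lo s < lo t" if "s \<in> B" for s
    using antis_memD(5)[OF B that] last[OF that] by simp
  have fix_above: "cube_top B k = k" if "lo t < k" for k
    using that last lt by (intro top_fixes[OF B]) force
  have "cube_top (insert t B) = Transposition.transpose (lo t) (hi t) \<circ> cube_top B \<or>
    cube_top (insert t B) = cube_top B \<circ> Transposition.transpose (lo t) (hi t)"
  proof (cases "\<exists>s \<in> B. hi s = lo t")
    case False
    obtain i j where ij: "cube_top (insert t B) = Transposition.transpose i j \<circ> cube_top B"
      and S: "\<forall>S. (\<forall>s\<in>B. lo s \<in> S \<longleftrightarrow> hi s \<in> S) \<longrightarrow> (i \<in> S \<longleftrightarrow> lo t \<in> S) \<and> (j \<in> S \<longleftrightarrow> hi t \<in> S)"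
      by (rule top_label[OF Y]) (rule that, assumption+)
    have "i = lo t" using S[THEN spec, of "{lo t}"] False lt by force
    moreover have "j = hi t" using S[THEN spec, of "{hi t}"] lt last t(5) by force
    ultimately show ?thesis using ij by blast
  next
    case True
    then obtain s where s: "s \<in> B" "hi s = lo t" by blast
    define C where "C = B - {s}"
    have BC: "B = insert s C" "s \<notin> C" "t \<notin> C" "s \<noteq> t" using s Y by (auto simp: C_def)
    have Ct: "insert t C \<in> antis" and C: "C \<in> antis"
      using antichains_subset[OF Y(1), of "insert t C"] antichains_subset[OF Y(1), of C]
      by (auto simp: C_def)
    have hC: "hi u < lo t" "lo u < lo t" if "u \<in> C" for u
      using that last[of u] lt[of u] antis_eq_iff(2)[OF B, of u s] s by (auto simp: C_def order_le_less)
    obtain i j where ij: "i \<noteq> j" "cube_top (insert t C) = Transposition.transpose i j \<circ> cube_top C"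
      and S: "\<forall>S. (\<forall>s\<in>C. lo s \<in> S \<longleftrightarrow> hi s \<in> S) \<longrightarrow> (i \<in> S \<longleftrightarrow> lo t \<in> S) \<and> (j \<in> S \<longleftrightarrow> hi t \<in> S)"
      by (rule top_label[OF Ct BC(3)]) (rule that, assumption+)
    have "i = lo t" using S[THEN spec, of "{lo t}"] hC by force
    moreover have "j = hi t" using S[THEN spec, of "{hi t}"] hC t(5) by force
    ultimately have r: "cube_top (insert t C) = Transposition.transpose (lo t) (hi t) \<circ> cube_top C" using ij by blast
    obtain k l where kl: "k \<noteq> l" "cube_top (insert s C) = Transposition.transpose k l \<circ> cube_top C"
      using edge_transpose[OF top_edge[of s C]] B BC by metis
    have fixC: "cube_top C (lo t) = lo t" "cube_top C (hi t) = hi t"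
      by (rule top_fixes[OF C]; use hC t(5) in force)+
    \<comment> \<open>\<open>cube_top C\<close> fixes both points and so commutes with this
      transposition; this makes the second candidate a right multiple of
      \<open>cube_top B\<close>.\<close>
    have fC: "Transposition.transpose (lo t) (hi t) \<circ> cube_top C = cube_top C \<circ> Transposition.transpose (lo t) (hi t)"
      using transpose_comp_right[OF top_Sym[OF C], of "lo t" "hi t"] fixC by simp
    have e: "edge n (cube_top C) (Transposition.transpose (lo t) (hi t) \<circ> cube_top C)" "edge n (cube_top C) (Transposition.transpose k l \<circ> cube_top C)"
      using top_edge[OF Ct BC(3)] top_edge[of s C] B BC r kl by (simp_all del: o_apply)
    have e': "edge n (Transposition.transpose (lo t) (hi t) \<circ> cube_top C) (cube_top (insert t B))"
      "edge n (Transposition.transpose k l \<circ> cube_top C) (cube_top (insert t B))"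
      using top_edge[of s "insert t C"] top_edge[OF Y] Y(1) BC r kl by (simp_all add: insert_commute del: o_apply)
    have "cube_top (insert s C) \<noteq> cube_top (insert t C)"
      using BC by (subst cube_map_eq_iff[OF top_cube_map[OF Y(1)]]) auto
    then have ne: "Transposition.transpose (lo t) (hi t) \<noteq> Transposition.transpose k l" using r kl by metis
    have "lo t \<noteq> hi t" using t by simp
    from diamond_top[OF top_Sym[OF C] this kl(1) e ne e']
    show ?thesis unfolding fC using kl(2) BC(1) by (metis comp_assoc)
  qed
  then show ?thesis
    using len_transpose_above[OF top_Sym[OF B] t(4,5,6) fix_above] by metis
qed

text \<open>The gain is 2 less than in \<open>top_remove_last\<close>: position
  \<open>Suc (lo t)\<close> lies between the two ends, but because of \<open>s\<close> it carries a
  value below \<open>lo t\<close> and is lost from the count.\<close>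

lemma top_remove_last_crossing:
  assumes Y: "insert t B \<in> antis" "t \<notin> B" and last: "\<And>s. s \<in> B \<Longrightarrow> lo s < lo t"
    and s: "s \<in> B" "lo t < hi s"
  shows "len n (cube_top (insert t B)) + 3 = len n (cube_top B) + 2 * (hi t - lo t)"
    and "hi s = Suc (lo t)" "cut (lo t) (hi s)" "Suc (lo t) < hi t"
    and "\<And>u. u \<in> B \<Longrightarrow> hi u \<le> Suc (lo t)"
proof -
  note t = antis_memD[OF Y(1) insertI1]
  have B: "B \<in> antis" using antichains_subset[OF Y(1)] by blast
  show hs: "hi s = Suc (lo t)" and "cut (lo t) (hi s)"
    using antis_crossing[OF Y(1), of s t] s last by auto
  show ht: "Suc (lo t) < hi t" using antis_less_iff[OF Y(1), of s t] s last hs by auto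
  show hu: "hi u \<le> Suc (lo t)" if "u \<in> B" for u
    using antis_crossing(1)[OF Y(1), of u t] that last by (cases "lo t < hi u") auto
  have "\<not> (lo s \<le> lo t \<longleftrightarrow> hi s \<le> lo t)" using s last[of s] by simp
  moreover have "s \<in> insert t B - {t}" "insert t B - {t} = B" using s Y by auto
  ultimately have free: "lo u \<noteq> lo t \<and> hi u \<noteq> lo t" if "u \<in> B" for u
    using antis_lo_invariant[OF Y(1) insertI1] that by metis
  let ?w = "cube_top B"
  have w: "?w \<in> Sym n" using top_Sym[OF B] .
  have fa: "?w (lo t) = lo t" using free by (intro top_fixes[OF B]) auto
  have fab: "?w k = k" if "Suc (lo t) < k" for k
    using that hu last by (intro top_fixes[OF B]) force
  \<comment> \<open>Only \<open>s\<close> has an end at \<open>Suc (lo t)\<close>, so adding it last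
    moves that point. Larger points and \<open>lo t\<close> are fixed, which leaves a value below
    \<open>lo t\<close>.\<close>
  have mv: "?w (Suc (lo t)) < lo t"
  proof -
    define C where "C = B - {s}"
    have BC: "B = insert s C" "s \<notin> C" using s by (auto simp: C_def)
    have C: "C \<in> antis" using antichains_subset[OF B] by (auto simp: C_def)
    obtain i j where ij: "i \<noteq> j" "cube_top (insert s C) = Transposition.transpose i j \<circ> cube_top C"
      and S: "\<forall>S. (\<forall>s\<in>C. lo s \<in> S \<longleftrightarrow> hi s \<in> S) \<longrightarrow> (i \<in> S \<longleftrightarrow> lo s \<in> S) \<and> (j \<in> S \<longleftrightarrow> hi s \<in> S)"
      by (rule top_label[OF B[unfolded BC(1)] BC(2)]) (rule that, assumption+)
    have fr: "lo u \<noteq> Suc (lo t) \<and> hi u \<noteq> Suc (lo t)" if "u \<in> C" for u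
      using that last[of u] antis_eq_iff(2)[OF B, of u s] s hs by (auto simp: C_def)
    have "j = Suc (lo t)" using S[THEN spec, of "{Suc (lo t)}"] fr hs by force
    moreover have "cube_top C (Suc (lo t)) = Suc (lo t)" using fr by (intro top_fixes[OF C]) auto
    ultimately have "?w (Suc (lo t)) = i" "i \<noteq> Suc (lo t)" using ij BC by auto
    moreover have "\<not> Suc (lo t) < ?w (Suc (lo t))"
      using fab[of "?w (Suc (lo t))"] Sym_eq_iff[OF w, of "?w (Suc (lo t))" "Suc (lo t)"] by auto
    moreover have "?w (Suc (lo t)) \<noteq> lo t" using fa Sym_eq_iff[OF w, of "Suc (lo t)" "lo t"] by auto
    ultimately show ?thesis by simp
  qed
  obtain i j where ij: "cube_top (insert t B) = Transposition.transpose i j \<circ> ?w"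
    and S: "\<forall>S. (\<forall>s\<in>B. lo s \<in> S \<longleftrightarrow> hi s \<in> S) \<longrightarrow> (i \<in> S \<longleftrightarrow> lo t \<in> S) \<and> (j \<in> S \<longleftrightarrow> hi t \<in> S)"
    by (rule top_label[OF Y]) (rule that, assumption+)
  have "i = lo t" using S[THEN spec, of "{lo t}"] free by force
  moreover have "j = hi t" using S[THEN spec, of "{hi t}"] hu last ht by force
  ultimately have "cube_top (insert t B) = ?w \<circ> Transposition.transpose (lo t) (hi t)"
    using ij transpose_comp_right[OF w, of "lo t" "hi t"] fa fab[OF ht] by simp
  moreover have "{k. lo t < k \<and> k < hi t \<and> ?w (lo t) < ?w k \<and> ?w k < ?w (hi t)} = {Suc (lo t)<..<hi t}"
  proof (intro set_eqI iffI)
    fix k assume k: "k \<in> {k. lo t < k \<and> k < hi t \<and> ?w (lo t) < ?w k \<and> ?w k < ?w (hi t)}"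
    then have "k \<noteq> Suc (lo t)" using mv fa by auto
    then show "k \<in> {Suc (lo t)<..<hi t}" using k by auto
  qed (use fa fab ht in auto)
  moreover have "?w (lo t) < ?w (hi t)" using fa fab[OF ht] ht by simp
  ultimately show "len n (cube_top (insert t B)) + 3 = len n (cube_top B) + 2 * (hi t - lo t)"
    using len_transpose_right[OF w t(4,5,6)] ht by simp
qed

definition ideal_pairs :: "perm set \<Rightarrow> (nat \<times> nat) set" where
  "ideal_pairs Y = {(p, q). p < q \<and> cut p q \<and> (\<exists>y\<in>Y. lo y \<le> p \<and> q \<le> hi y)}"

lemma card_order_ideal:
  assumes Y: "Y \<in> antis"
  shows "card (order_ideal n id v I id Y) = card (ideal_pairs Y)" and "finite (ideal_pairs Y)"
proof -
  have "order_ideal n id v I id Y = (\<lambda>(p, q). Transposition.transpose p q) ` ideal_pairs Y"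
  proof (intro equalityI subsetI)
    fix t assume "t \<in> order_ideal n id v I id Y"
    then obtain p q y where pq: "refl_below p q" "cut p q" "t = Transposition.transpose p q"
      and y: "y \<in> Y" "bruhat_le n t y"
      by (auto simp: order_ideal_def upper_nbrs_id)
    have "lo y \<le> p \<and> q \<le> hi y"
      using y(2) antis_memD[OF Y y(1)] pq transpose_bruhat_le_transpose_iff[of "lo y" "hi y" n p q]
      by (auto simp: refl_below_def)
    then show "t \<in> (\<lambda>(p, q). Transposition.transpose p q) ` ideal_pairs Y"
      using pq y by (auto simp: ideal_pairs_def refl_below_def)
  next
    fix t assume "t \<in> (\<lambda>(p, q). Transposition.transpose p q) ` ideal_pairs Y"
    then obtain p q y where pq: "p < q" "cut p q" "t = Transposition.transpose p q"
      and y: "y \<in> Y" "lo y \<le> p" "q \<le> hi y"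
      by (auto simp: ideal_pairs_def)
    note m = antis_memD[OF Y y(1)]
    have "refl_below p q" using refl_below_sub[OF m(1) y(2) pq(1) y(3)] .
    moreover have "bruhat_le n t y"
      using transpose_bruhat_le_transpose_iff[of "lo y" "hi y" n p q] m pq y by auto
    ultimately show "t \<in> order_ideal n id v I id Y"
      using pq y by (auto simp: order_ideal_def upper_nbrs_id)
  qed
  moreover have "inj_on (\<lambda>(p, q). Transposition.transpose p q) (ideal_pairs Y)"
    by (auto simp: inj_on_def ideal_pairs_def transpose_eq_transpose_iff)
  ultimately show "card (order_ideal n id v I id Y) = card (ideal_pairs Y)" by (simp add: card_image)
  have "ideal_pairs Y \<subseteq> {..n} \<times> {..n}"
    using antis_memD(6)[OF Y] by (fastforce simp: ideal_pairs_def)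
  then show "finite (ideal_pairs Y)" using finite_subset by blast
qed

text \<open>The missing step of the interval is its first or its last one, so a subinterval is cut
  iff it shares that end.\<close>

lemma card_ideal_pairs_single:
  assumes R: "refl_below (lo t) (hi t)" and N: "cut (lo t) (hi t)"
  shows "card (ideal_pairs {t}) = hi t - lo t"
proof -
  let ?a = "lo t" and ?c = "hi t"
  have ac: "?a < ?c" using R by (simp add: refl_below_def)
  show ?thesis
  proof (cases "cut ?a (Suc ?a)")
    case True
    have "ideal_pairs {t} = {?a} \<times> {?a<..?c}"
    proof (intro equalityI subsetI)
      fix z assume "z \<in> ideal_pairs {t}"
      then obtain p q where z: "z = (p, q)" "p < q" "cut p q" "?a \<le> p" "q \<le> ?c" by (auto simp: ideal_pairs_def)
      have "p = ?a"
      proof (rule ccontr)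
        assume "p \<noteq> ?a"
        then have "Suc ?a \<le> p" using z by simp
        then have "cut (Suc ?a) ?c" "Suc ?a < ?c" using z cut_mono by auto
        then show False using cut_once[OF R, of "Suc ?a"] True by simp
      qed
      then show "z \<in> {?a} \<times> {?a<..?c}" using z by auto
    qed (use True cut_mono[OF True] in \<open>auto simp: ideal_pairs_def\<close>)
    then show ?thesis by simp
  next
    case False
    then have "Suc ?a \<noteq> ?c" using N by metis
    then have "Suc ?a < ?c" using ac by simp
    moreover from this have "cut (Suc ?a) ?c" using N False cut_split[of ?a "Suc ?a" ?c] by simp
    ultimately have 1: "Suc ?a < ?c" "cut (Suc ?a) ?c" by auto
    have N': "cut (?c - 1) ?c"
    proof (cases "Suc ?a = ?c - 1")
      case False
      then have k: "?a < Suc ?a" "Suc ?a < ?c - 1" "?c - 1 < ?c" using 1 by auto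
      then show ?thesis using no_inner_cut[OF R k] cut_split[OF k(2,3)] 1 by simp
    qed (use 1 in simp)
    have "ideal_pairs {t} = {?a..<?c} \<times> {?c}"
    proof (intro equalityI subsetI)
      fix z assume "z \<in> ideal_pairs {t}"
      then obtain p q where z: "z = (p, q)" "p < q" "cut p q" "?a \<le> p" "q \<le> ?c" by (auto simp: ideal_pairs_def)
      have "q = ?c"
      proof (rule ccontr)
        assume "q \<noteq> ?c"
        then have "q \<le> ?c - 1" using z by simp
        then have "cut ?a (?c - 1)" using z cut_mono by blast
        then show False using cut_once[OF R, of "?c - 1"] N' 1 by simp
      qed
      then show "z \<in> {?a..<?c} \<times> {?c}" using z by auto
    next
      fix z assume "z \<in> {?a..<?c} \<times> {?c}"
      then obtain p where p: "z = (p, ?c)" "?a \<le> p" "p < ?c" by auto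
      then have "cut p ?c" using cut_mono[OF N', of p ?c] by simp
      then show "z \<in> ideal_pairs {t}" using p by (simp add: ideal_pairs_def)
    qed
    then show ?thesis by simp
  qed
qed

text \<open>Induction on the member with the largest right end. With \<open>d = hi t - lo t\<close>,
  the left side grows by \<open>2 * d\<close> and the ideal by \<open>d\<close> if \<open>t\<close>
  crosses nothing; otherwise by \<open>2 * d - 2\<close> and \<open>d - 1\<close>, as the ideals
  then share exactly the one-step overlap.\<close>

lemma len_top:
  assumes "Y \<in> antis"
  shows "len n (cube_top Y) + card Y = 2 * card (ideal_pairs Y)"
proof -
  have "finite Y" using cube_map_finite[OF top_cube_map[OF assms]] .
  then show ?thesis using assms
  proof (induction "card Y" arbitrary: Y)
    case 0
    then have "Y = {}" by simp
    then have "len n (cube_top Y) = 0" using len_id top_empty by metis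
    then show ?case using \<open>Y = {}\<close> by (simp add: ideal_pairs_def)
  next
    case (Suc m)
    then have "Y \<noteq> {}" "finite Y" by auto
    then obtain t where "t \<in> Y" "hi t = Max (hi ` Y)" using Max_in[of "hi ` Y"] by fastforce
    then have t: "t \<in> Y" "\<And>s. s \<in> Y \<Longrightarrow> hi s \<le> hi t" using \<open>finite Y\<close> by simp_all
    define B where "B = Y - {t}"
    have Y: "insert t B \<in> antis" "t \<notin> B" and YB: "Y = insert t B" using Suc.prems t by (auto simp: B_def insert_absorb)
    have B: "B \<in> antis" using antichains_subset[OF Y(1)] by blast
    have lt: "lo s < lo t" if "s \<in> B" for s
      using that t antis_less_iff[OF Suc.prems(2), of s t] antis_eq_iff(2)[OF Suc.prems(2), of s t]
      by (auto simp: B_def order_le_less)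
    have fin: "finite B" "card B = m" using Suc t by (auto simp: B_def)
    have IH: "len n (cube_top B) + card B = 2 * card (ideal_pairs B)" using Suc.hyps(1)[of B] fin B by simp
    have tR: "refl_below (lo t) (hi t)" "cut (lo t) (hi t)" "lo t < hi t" using antis_memD[OF Y(1)] by auto
    have un: "ideal_pairs Y = ideal_pairs B \<union> ideal_pairs {t}" unfolding YB by (auto simp: ideal_pairs_def)
    have tA: "{t} \<in> antis" using antichains_subset[OF Y(1)] by blast
    have cards: "card (ideal_pairs Y) + card (ideal_pairs B \<inter> ideal_pairs {t}) = card (ideal_pairs B) + (hi t - lo t)"
      unfolding un using card_Un_Int[OF card_order_ideal(2)[OF B] card_order_ideal(2)[OF tA]]
        card_ideal_pairs_single[OF tR(1,2)] by simp
    have cY: "card Y = Suc (card B)" using fin Suc.hyps(2) by simp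
    show ?case
    proof (cases "\<exists>s\<in>B. lo t < hi s")
      case False
      then have last: "\<And>s. s \<in> B \<Longrightarrow> hi s \<le> lo t" by (simp add: not_less)
      then have "ideal_pairs B \<inter> ideal_pairs {t} = {}" by (fastforce simp: ideal_pairs_def)
      moreover have "len n (cube_top Y) + 1 = len n (cube_top B) + 2 * (hi t - lo t)"
        using top_remove_last[OF Y last] by (simp add: YB)
      ultimately show ?thesis using cards IH cY by simp
    next
      case True
      then obtain s where s: "s \<in> B" "lo t < hi s" by blast
      note r = top_remove_last_crossing[OF Y lt s]
      have "ideal_pairs B \<inter> ideal_pairs {t} = {(lo t, Suc (lo t))}"
      proof (intro equalityI subsetI)
        fix z assume "z \<in> ideal_pairs B \<inter> ideal_pairs {t}"
        then obtain p q u where "z = (p, q)" "p < q" "lo t \<le> p" "u \<in> B" "q \<le> hi u"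
          by (auto simp: ideal_pairs_def)
        then show "z \<in> {(lo t, Suc (lo t))}" using r(5)[of u] by auto
      next
        fix z assume "z \<in> {(lo t, Suc (lo t))}"
        moreover have "cut (lo t) (Suc (lo t))" using r(2,3) by simp
        ultimately show "z \<in> ideal_pairs B \<inter> ideal_pairs {t}"
          using s r(2,4) lt[OF s(1)] by (auto simp: ideal_pairs_def intro!: bexI[of _ s])
      qed
      moreover have "len n (cube_top Y) + 3 = len n (cube_top B) + 2 * (hi t - lo t)" using r(1) by (simp add: YB)
      ultimately show ?thesis using cards IH cY tR(3) by simp
    qed
  qed
qed

lemma numerical_criterion_id: "numerical_criterion n id v I id"
  unfolding numerical_criterion_def
proof
  fix Y assume Y: "Y \<in> antis"
  have half: "a = 2 * b \<Longrightarrow> a / 2 = b" for a b :: rat by simp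
  have "len2 n id (cube_top Y) + int (card Y) = 2 * int (card (order_ideal n id v I id Y))"
    using len_top[OF Y] card_order_ideal(1)[OF Y] len_id[of n] unfolding len2_def by linarith
  then have "rat_of_int (len2 n id (cube_top Y)) + rat_of_nat (card Y) = 2 * rat_of_nat (card (order_ideal n id v I id Y))"
    by (metis (mono_tags) of_int_add of_int_mult of_int_numeral of_int_of_nat_eq)
  then show "(rat_of_int (len2 n id (theta n id v id Y)) + rat_of_nat (card Y)) / 2 =
      rat_of_nat (card (order_ideal n id v I id Y))"
    unfolding cube_top_def by (rule half)
qed

section \<open>Strength\<close>

text \<open>There is a closed set containing \<open>lo t\<close> inside \<open>{..lo t}\<close>, and
  one containing \<open>hi t\<close> inside \<open>{hi t..}\<close>. The exchanged values and their
  positions before the exchange stay in these sets.\<close>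

lemma top_label_bounds:
  assumes Y: "insert t B \<in> antis" "t \<notin> B"
  obtains i j where "i \<noteq> j" "cube_top (insert t B) = Transposition.transpose i j \<circ> cube_top B"
    "i \<le> lo t" "inv (cube_top B) i \<le> lo t" "hi t \<le> j" "hi t \<le> inv (cube_top B) j"
    "\<forall>S. (\<forall>s\<in>B. lo s \<in> S \<longleftrightarrow> hi s \<in> S) \<longrightarrow> (i \<in> S \<longleftrightarrow> lo t \<in> S) \<and> (j \<in> S \<longleftrightarrow> hi t \<in> S)"
proof -
  obtain i j where ij: "i \<noteq> j" "cube_top (insert t B) = Transposition.transpose i j \<circ> cube_top B"
    and S: "\<forall>S. (\<forall>s\<in>B. lo s \<in> S \<longleftrightarrow> hi s \<in> S) \<longrightarrow> (i \<in> S \<longleftrightarrow> lo t \<in> S) \<and> (j \<in> S \<longleftrightarrow> hi t \<in> S)"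
    by (rule top_label[OF Y]) (rule that, assumption+)
  have B: "B \<in> antis" using antichains_subset[OF Y(1)] by blast
  have x: "cube_top B \<in> Sym n" using top_Sym[OF B] .
  have *: "inv (cube_top B) k \<in> S \<longleftrightarrow> k \<in> S" if "\<And>s. s \<in> B \<Longrightarrow> lo s \<in> S \<longleftrightarrow> hi s \<in> S" for k S
    using top_invariant[OF B that, of "inv (cube_top B) k"] x by simp
  have diff: "insert t B - {t} = B" using Y(2) by simp
  have "\<exists>S. (\<forall>s\<in>B. lo s \<in> S \<longleftrightarrow> hi s \<in> S) \<and> lo t \<in> S \<and> S \<subseteq> {..lo t}"
    using antis_lo_invariant[OF Y(1) insertI1] unfolding diff
  proof
    assume "\<forall>s\<in>B. lo s \<noteq> lo t \<and> hi s \<noteq> lo t"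
    then show ?thesis by (intro exI[of _ "{lo t}"]) simp
  next
    assume "\<forall>s\<in>B. lo s \<le> lo t \<longleftrightarrow> hi s \<le> lo t"
    then show ?thesis by (intro exI[of _ "{..lo t}"]) simp
  qed
  then obtain S1 where S1: "\<forall>s\<in>B. lo s \<in> S1 \<longleftrightarrow> hi s \<in> S1" "lo t \<in> S1" "S1 \<subseteq> {..lo t}" by blast
  then have i: "i \<in> S1" "inv (cube_top B) i \<in> S1" using S *[of S1 i] by blast+
  have "\<exists>S. (\<forall>s\<in>B. lo s \<in> S \<longleftrightarrow> hi s \<in> S) \<and> hi t \<in> S \<and> S \<subseteq> {hi t..}"
    using antis_hi_invariant[OF Y(1) insertI1] unfolding diff
  proof
    assume "\<forall>s\<in>B. lo s \<noteq> hi t \<and> hi s \<noteq> hi t"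
    then show ?thesis by (intro exI[of _ "{hi t}"]) simp
  next
    assume "\<forall>s\<in>B. hi t \<le> lo s \<longleftrightarrow> hi t \<le> hi s"
    then show ?thesis by (intro exI[of _ "{hi t..}"]) simp
  qed
  then obtain S2 where S2: "\<forall>s\<in>B. lo s \<in> S2 \<longleftrightarrow> hi s \<in> S2" "hi t \<in> S2" "S2 \<subseteq> {hi t..}" by blast
  then have "j \<in> S2" "inv (cube_top B) j \<in> S2" using S *[of S2 j] by blast+
  then show ?thesis using that[OF ij _ _ _ _ S] i S1(3) S2(3) by auto
qed

lemma transpose_commute_disjoint:
  assumes "i \<noteq> k" "i \<noteq> l" "j \<noteq> k" "j \<noteq> l"
  shows "Transposition.transpose i j \<circ> (Transposition.transpose k l \<circ> x) =
    Transposition.transpose k l \<circ> (Transposition.transpose i j \<circ> x)"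
  using assms by (auto simp: fun_eq_iff transpose_def)

text \<open>If the labels of the two edges did not commute, then the two possible tops of the diamond would
  provide a falling and a rising strand across \<open>[lo t, hi t']\<close>.\<close>

lemma strong_incomparable:
  assumes Y: "insert t (insert t' A) \<in> antis" and t: "t \<notin> A" "t' \<notin> A" and lt: "lo t < lo t'"
    and w: "edge n (cube_top (insert t A)) w" "edge n (cube_top (insert t' A)) w" "bruhat_le n w v"
  shows "cube_top (insert t (insert t' A)) = w"
proof (rule ccontr)
  assume neq: "cube_top (insert t (insert t' A)) \<noteq> w"
  have tt': "t \<noteq> t'" using lt by auto
  have Y1: "insert t A \<in> antis" and Y2: "insert t' A \<in> antis" and A: "A \<in> antis"
    using antichains_subset[OF Y] by (auto simp: subset_insertI2)
  have hlt: "hi t < hi t'" using antis_less_iff[OF Y, of t t'] lt by simp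
  note m = antis_memD[OF Y1 insertI1] and m' = antis_memD[OF Y2 insertI1]
  define x where "x = cube_top A"
  have x: "x \<in> Sym n" using top_Sym[OF A] by (simp add: x_def)
  obtain i j where ij: "i \<noteq> j" "cube_top (insert t A) = Transposition.transpose i j \<circ> x"
    "i \<le> lo t" "inv x i \<le> lo t" "hi t \<le> j" "hi t \<le> inv x j"
    and S: "\<forall>S. (\<forall>s\<in>A. lo s \<in> S \<longleftrightarrow> hi s \<in> S) \<longrightarrow> (i \<in> S \<longleftrightarrow> lo t \<in> S) \<and> (j \<in> S \<longleftrightarrow> hi t \<in> S)"
    by (rule top_label_bounds[OF Y1 t(1), folded x_def]) (rule that, assumption+)
  obtain i' j' where ij': "i' \<noteq> j'" "cube_top (insert t' A) = Transposition.transpose i' j' \<circ> x"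
    "i' \<le> lo t'" "inv x i' \<le> lo t'" "hi t' \<le> j'" "hi t' \<le> inv x j'"
    and S': "\<forall>S. (\<forall>s\<in>A. lo s \<in> S \<longleftrightarrow> hi s \<in> S) \<longrightarrow> (i' \<in> S \<longleftrightarrow> lo t' \<in> S) \<and> (j' \<in> S \<longleftrightarrow> hi t' \<in> S)"
    by (rule top_label_bounds[OF Y2 t(2), folded x_def]) (rule that, assumption+)
  let ?r = "Transposition.transpose i j" and ?r' = "Transposition.transpose i' j'"
  have e: "edge n x (?r \<circ> x)" "edge n x (?r' \<circ> x)"
    using top_edge[OF Y1 t(1)] top_edge[OF Y2 t(2)] ij(2) ij'(2) by (simp_all add: x_def del: o_apply)
  have "cube_top (insert t A) \<noteq> cube_top (insert t' A)"
    using t tt' by (subst cube_map_eq_iff[OF top_cube_map[OF Y]]) auto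
  then have ne: "?r \<noteq> ?r'" using ij(2) ij'(2) by metis
  let ?w0 = "cube_top (insert t (insert t' A))"
  have e0: "edge n (cube_top (insert t A)) ?w0" "edge n (cube_top (insert t' A)) ?w0"
    using top_edge[of t' "insert t A"] top_edge[of t "insert t' A"] Y t tt' by (simp_all add: insert_commute)
  note d0 = diamond_top[OF x ij(1) ij'(1) e ne e0[unfolded ij(2) ij'(2)]]
  note d = diamond_top[OF x ij(1) ij'(1) e ne w(1,2)[unfolded ij(2) ij'(2)]]
  have le0: "bruhat_le n ?w0 v" using top_le[OF Y] .
  \<comment> \<open>Two different tops exhaust the two candidates, so both products lie below
    \<open>v\<close>.\<close>
  have both: "bruhat_le n (?r \<circ> (?r' \<circ> x)) v" "bruhat_le n (?r' \<circ> (?r \<circ> x)) v"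
    "?r \<circ> (?r' \<circ> x) \<noteq> ?r' \<circ> (?r \<circ> x)"
    using d0 d neq le0 w(3) by metis+
  have "i \<noteq> i'"
  proof -
    have "\<forall>s\<in>A. s \<in> insert t A - {t}" using t by auto
    then consider "\<forall>s\<in>A. lo s \<noteq> lo t \<and> hi s \<noteq> lo t" | "\<forall>s\<in>A. lo s \<le> lo t \<longleftrightarrow> hi s \<le> lo t"
      using antis_lo_invariant[OF Y1 insertI1] by blast
    then show ?thesis
    proof cases
      case 1
      then show ?thesis using S[THEN spec, of "{lo t}"] S'[THEN spec, of "{lo t}"] lt by auto
    next
      case 2
      then show ?thesis using S[THEN spec, of "{..lo t}"] S'[THEN spec, of "{..lo t}"] lt by auto
    qed
  qed
  moreover have "j \<noteq> j'"
  proof -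
    have "\<forall>s\<in>A. s \<in> insert t' A - {t'}" using t by auto
    then consider "\<forall>s\<in>A. lo s \<noteq> hi t' \<and> hi s \<noteq> hi t'" | "\<forall>s\<in>A. hi t' \<le> lo s \<longleftrightarrow> hi t' \<le> hi s"
      using antis_hi_invariant[OF Y2 insertI1] by blast
    then show ?thesis
    proof cases
      case 1
      then show ?thesis using S[THEN spec, of "{hi t'}"] S'[THEN spec, of "{hi t'}"] hlt by auto
    next
      case 2
      then show ?thesis using S[THEN spec, of "{hi t'..}"] S'[THEN spec, of "{hi t'..}"] hlt by auto
    qed
  qed
  moreover have ij'_ne: "i \<noteq> j'" using ij(3) ij'(5) m(5) hlt by simp
  \<comment> \<open>Among the possible coincidences of points only \<open>j = i'\<close> is left;
    labels without a common point would commute.\<close>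
  ultimately have ji: "j = i'" using both(3) transpose_commute_disjoint[of i i' j' j x] by metis
  have "(?r \<circ> (?r' \<circ> x)) (inv x j') = i" using x ji ij'_ne ij(1) ij'(1) by simp
  then have "falls (?r \<circ> (?r' \<circ> x)) (lo t) (hi t')"
    unfolding falls_def using ij(3) ij'(6) by metis
  moreover have "(?r' \<circ> (?r \<circ> x)) (inv x i) = j'" using x ji by simp
  then have "rises (?r' \<circ> (?r \<circ> x)) (lo t) (hi t')"
    unfolding rises_def using ij(4) ij'(5) by metis
  ultimately have R: "refl_below (lo t) (hi t')"
    using refl_belowI[OF m(4) _ m'(6) both(2) _ both(1)] m(5) hlt by simp
  \<comment> \<open>Both \<open>t\<close> and \<open>t'\<close> contribute a cut. The two can
    coincide only in an overlap, where the cut would be an inner one.\<close>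
  show False
  proof (cases "lo t' < hi t")
    case True
    then have "\<not> cut (lo t) (lo t')" using cut_once[OF R lt] m'(2,5) by simp
    then have "cut (lo t') (hi t)" using cut_split[OF lt True] m(2) by simp
    then show False using no_inner_cut[OF R lt True hlt] by simp
  next
    case False
    then have "cut (lo t) (lo t')" using cut_mono[OF m(2), of "lo t" "lo t'"] by simp
    then show False using cut_once[OF R lt m'(5)] m'(2) by simp
  qed
qed

text \<open>Right ends are distinct, so the members of \<open>A\<close> lead from
  \<open>lo t\<close> only through \<open>s\<close> to \<open>lo s\<close>; there
  \<open>antis_lo_invariant\<close> for \<open>s\<close> bounds the rest of the orbit.\<close>

lemma antis_orbit_lo:
  assumes Y: "insert t A \<in> antis" "t \<notin> A" and s: "s \<in> A" "hi s = lo t"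
  obtains S where "\<And>u. u \<in> A \<Longrightarrow> lo u \<in> S \<longleftrightarrow> hi u \<in> S" "lo t \<in> S" "S \<subseteq> insert (lo t) {..lo s}"
proof -
  have A: "A \<in> antis" using antichains_subset[OF Y(1)] by blast
  have other: "lo u \<noteq> lo t" "u \<noteq> s \<Longrightarrow> hi u \<noteq> lo t" if "u \<in> A" for u
    using antis_eq_iff(1)[OF Y(1), of u t] antis_eq_iff(2)[OF A, of u s] that s Y(2) by auto
  from antis_lo_invariant[OF A s(1)] show ?thesis
  proof
    assume "\<forall>u\<in>A - {s}. lo u \<noteq> lo s \<and> hi u \<noteq> lo s"
    then show ?thesis using other s by (intro that[of "{lo s, lo t}"]) auto
  next
    assume *: "\<forall>u\<in>A - {s}. lo u \<le> lo s \<longleftrightarrow> hi u \<le> lo s"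
    show ?thesis
    proof (rule that[of "insert (lo t) {..lo s}"])
      fix u assume u: "u \<in> A"
      show "lo u \<in> insert (lo t) {..lo s} \<longleftrightarrow> hi u \<in> insert (lo t) {..lo s}"
        using * other[OF u] u s by (cases "u = s") auto
    qed auto
  qed
qed

lemma antis_orbit_hi:
  assumes Y: "insert t A \<in> antis" "t \<notin> A" and s: "s \<in> A" "lo s = hi t"
  obtains S where "\<And>u. u \<in> A \<Longrightarrow> lo u \<in> S \<longleftrightarrow> hi u \<in> S" "hi t \<in> S" "S \<subseteq> insert (hi t) {hi s..}"
proof -
  have A: "A \<in> antis" using antichains_subset[OF Y(1)] by blast
  have other: "hi u \<noteq> hi t" "u \<noteq> s \<Longrightarrow> lo u \<noteq> hi t" if "u \<in> A" for u
    using antis_eq_iff(2)[OF Y(1), of u t] antis_eq_iff(1)[OF A, of u s] that s Y(2) by auto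
  from antis_hi_invariant[OF A s(1)] show ?thesis
  proof
    assume "\<forall>u\<in>A - {s}. lo u \<noteq> hi s \<and> hi u \<noteq> hi s"
    then show ?thesis using other s by (intro that[of "{hi s, hi t}"]) auto
  next
    assume *: "\<forall>u\<in>A - {s}. hi s \<le> lo u \<longleftrightarrow> hi s \<le> hi u"
    show ?thesis
    proof (rule that[of "insert (hi t) {hi s..}"])
      fix u assume u: "u \<in> A"
      show "lo u \<in> insert (hi t) {hi s..} \<longleftrightarrow> hi u \<in> insert (hi t) {hi s..}"
        using * other[OF u] u s by (cases "u = s") auto
    qed auto
  qed
qed

text \<open>Two nested reflections \<open>t, t'\<close> share an end. If the labels share their point at that end, then on
  the three points involved the edge of \<open>t'\<close> leads to the longest pattern; otherwise they commute, and
  the strands of \<open>w\<close> produce a reflection below \<open>v\<close> that is cut twice.\<close>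

lemma no_top_common_lo:
  assumes Y1: "insert t A \<in> antis" and Y2: "insert t' A \<in> antis" and t: "t \<notin> A" "t' \<notin> A"
    and lo_eq: "lo t = lo t'" and hlt: "hi t < hi t'"
    and w: "edge n (cube_top (insert t A)) w" "edge n (cube_top (insert t' A)) w" "bruhat_le n w v"
  shows False
proof -
  have A: "A \<in> antis" using antichains_subset[OF Y1] by blast
  note m = antis_memD[OF Y1 insertI1] and m' = antis_memD[OF Y2 insertI1]
  have ncut: "\<not> cut (hi t) (hi t')" using cut_once[OF m'(1), of "hi t"] m lo_eq hlt by simp
  \<comment> \<open>Right ends in an antichain are distinct, and a member starting at
    \<open>hi t\<close> would cross \<open>t'\<close> and cut \<open>[hi t, hi t']\<close>, the part
    that is not cut.\<close>
  have free: "lo s \<noteq> hi t \<and> hi s \<noteq> hi t" if s: "s \<in> A" for s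
  proof
    show "hi s \<noteq> hi t" using antis_eq_iff(2)[OF Y1, of s t] s t by auto
    show "lo s \<noteq> hi t"
    proof
      assume "lo s = hi t"
      then show False using antis_crossing(2)[OF Y2, of t' s] s m(5) lo_eq hlt ncut by simp
    qed
  qed
  define x where "x = cube_top A"
  have x: "x \<in> Sym n" using top_Sym[OF A] by (simp add: x_def)
  have xc: "x (hi t) = hi t" unfolding x_def using free by (intro top_fixes[OF A])
  obtain i j where ij: "i \<noteq> j" "cube_top (insert t A) = Transposition.transpose i j \<circ> x"
    "i \<le> lo t" "inv x i \<le> lo t" "hi t \<le> j" "hi t \<le> inv x j"
    and S: "\<forall>S. (\<forall>s\<in>A. lo s \<in> S \<longleftrightarrow> hi s \<in> S) \<longrightarrow> (i \<in> S \<longleftrightarrow> lo t \<in> S) \<and> (j \<in> S \<longleftrightarrow> hi t \<in> S)"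
    by (rule top_label_bounds[OF Y1 t(1), folded x_def]) (rule that, assumption+)
  obtain i' j' where ij': "i' \<noteq> j'" "cube_top (insert t' A) = Transposition.transpose i' j' \<circ> x"
    "i' \<le> lo t'" "inv x i' \<le> lo t'" "hi t' \<le> j'" "hi t' \<le> inv x j'"
    and S': "\<forall>S. (\<forall>s\<in>A. lo s \<in> S \<longleftrightarrow> hi s \<in> S) \<longrightarrow> (i' \<in> S \<longleftrightarrow> lo t' \<in> S) \<and> (j' \<in> S \<longleftrightarrow> hi t' \<in> S)"
    by (rule top_label_bounds[OF Y2 t(2), folded x_def]) (rule that, assumption+)
  have j: "j = hi t" using S[THEN spec, of "{hi t}"] free by auto
  let ?r = "Transposition.transpose i j" and ?r' = "Transposition.transpose i' j'"
  have e: "edge n x (?r \<circ> x)" "edge n x (?r' \<circ> x)"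
    using top_edge[OF Y1 t(1)] top_edge[OF Y2 t(2)] ij(2) ij'(2) by (simp_all add: x_def del: o_apply)
  have jj: "j \<noteq> j'" "i \<noteq> j'" "i' \<noteq> j" "i < j" using ij ij' j hlt m(5) lo_eq by auto
  then have ne: "?r \<noteq> ?r'" by (metis ij(1) transpose_apply_second transpose_apply_other)
  note w' = w(1,2)[unfolded ij(2) ij'(2)]
  have d: "w = ?r \<circ> (?r' \<circ> x) \<or> w = ?r' \<circ> (?r \<circ> x)" using diamond_top[OF x ij(1) ij'(1) e ne w'] .
  show False
  proof (cases "i = i'")
    case True
    \<comment> \<open>The positions \<open>inv x i < hi t < inv x j'\<close> carry the decreasing
      values \<open>j' > hi t > i\<close> in \<open>?y\<close>, so neither candidate for
      \<open>w\<close> is reached by an upward edge.\<close>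
    let ?y = "?r' \<circ> x"
    have y: "?y \<in> Sym n" using edgeD[OF e(2)] by blast
    have val: "?y (inv x i) = j'" "?y (inv x j') = i" "?y (hi t) = hi t"
      using x xc True jj j by simp_all
    have pos: "inv x i < hi t" "hi t < inv x j'" using ij(4) ij'(6) m(5) hlt by auto
    have "w = Transposition.transpose i j \<circ> ?y \<or> w = Transposition.transpose j j' \<circ> ?y"
      using d True jj by (auto simp: fun_eq_iff transpose_def)
    then show False
    proof
      assume "w = Transposition.transpose i j \<circ> ?y"
      then have "edge n ?y (Transposition.transpose i j \<circ> ?y)" using w'(2) by simp
      from edge_values_cases[OF y this val(2)[symmetric], of "hi t"]
      show False using val j pos jj by auto
    next
      assume "w = Transposition.transpose j j' \<circ> ?y"
      then have "edge n ?y (Transposition.transpose j j' \<circ> ?y)" using w'(2) by simp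
      from edge_values_cases[OF y this _ val(1)[symmetric], of "hi t"]
      show False using val j pos jj ij'(5) hlt by auto
    qed
  next
    case ii': False
    have "\<exists>s\<in>A. hi s = lo t"
    proof (rule ccontr)
      assume "\<not> (\<exists>s\<in>A. hi s = lo t)"
      then have "\<forall>s\<in>A. lo s \<in> {lo t} \<longleftrightarrow> hi s \<in> {lo t}" using antis_eq_iff(1)[OF Y1, of _ t] t by auto
      then have "i \<in> {lo t}" "i' \<in> {lo t}"
        using S[THEN spec, of "{lo t}"] S'[THEN spec, of "{lo t}"] lo_eq by simp_all
      then show False using ii' by simp
    qed
    then obtain s where s: "s \<in> A" "hi s = lo t" by blast
    obtain Q where Q: "\<And>u. u \<in> A \<Longrightarrow> lo u \<in> Q \<longleftrightarrow> hi u \<in> Q" "lo t \<in> Q" "Q \<subseteq> insert (lo t) {..lo s}"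
      using antis_orbit_lo[OF Y1 t(1) s] by metis
    have iQ: "i \<in> Q" "i' \<in> Q" using S S' Q lo_eq by auto
    have "inv x k \<in> Q \<longleftrightarrow> k \<in> Q" for k
      using top_invariant[OF A Q(1), of "inv x k"] x by (simp add: x_def)
    then have pQ: "inv x i \<in> Q" "inv x i' \<in> Q" using iQ by auto
    have pp: "inv x i \<noteq> inv x i'" using ii' Sym_eq_iff[OF Sym_inv[OF x]] by simp
    have "w = ?r \<circ> (?r' \<circ> x)" using d transpose_commute_disjoint[of i i' j' j x] ii' jj by metis
    then have val: "w (inv x i) = j" "w (hi t) = i" "w (inv x i') = j'" "w (inv x j') = i'"
      using x xc ii' jj j ij(1) ij'(1) by simp_all
    \<comment> \<open>Of the distinct positions \<open>inv x i\<close> and \<open>inv x i'\<close>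
      in \<open>Q\<close> at most one is \<open>lo t\<close>; the other is at most
      \<open>lo s\<close> and carries a value of at least \<open>hi t\<close>. The values
      \<open>i\<close> and \<open>i'\<close> give the falling strand in the same way.\<close>
    have "rises w (lo s) (hi t)"
    proof (cases "inv x i = lo t")
      case True
      then have "inv x i' \<le> lo s" using pp pQ Q(3) by auto
      then show ?thesis unfolding rises_def using val(3) ij'(5) hlt by (intro exI[of _ "inv x i'"]) simp
    next
      case False
      then have "inv x i \<le> lo s" using pQ Q(3) by auto
      then show ?thesis unfolding rises_def using val(1) j by (intro exI[of _ "inv x i"]) simp
    qed
    moreover have "falls w (lo s) (hi t)"
    proof (cases "i = lo t")
      case True
      then have "i' \<le> lo s" using ii' iQ Q(3) by auto
      then show ?thesis unfolding falls_def using val(4) ij'(6) hlt by (intro exI[of _ "inv x j'"]) simp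
    next
      case False
      then have "i \<le> lo s" using iQ Q(3) by auto
      then show ?thesis unfolding falls_def using val(2) by (intro exI[of _ "hi t"]) simp
    qed
    moreover note ms = antis_memD[OF A s(1)]
    ultimately have "refl_below (lo s) (hi t)"
      using refl_belowI[OF ms(4) _ m(6) w(3) _ w(3)] m(5) s(2) by simp
    \<comment> \<open>The interval \<open>[lo s, hi t]\<close> contains the cut of \<open>s\<close>
      and that of \<open>t\<close>, on either side of \<open>lo t\<close>.\<close>
    then show False using cut_once[of "lo s" "hi t" "lo t"] ms m s(2) by simp
  qed
qed

text \<open>The mirror image of \<open>no_top_common_lo\<close> under \<open>k\<close> to
  \<open>n + 1 - k\<close>: now \<open>lo t\<close> is the fixed point, and the touching member
  \<open>s\<close> starts at \<open>hi t\<close>.\<close>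

lemma no_top_common_hi:
  assumes Y1: "insert t A \<in> antis" and Y2: "insert t' A \<in> antis" and t: "t \<notin> A" "t' \<notin> A"
    and hi_eq: "hi t = hi t'" and llt: "lo t' < lo t"
    and w: "edge n (cube_top (insert t A)) w" "edge n (cube_top (insert t' A)) w" "bruhat_le n w v"
  shows False
proof -
  have A: "A \<in> antis" using antichains_subset[OF Y1] by blast
  note m = antis_memD[OF Y1 insertI1] and m' = antis_memD[OF Y2 insertI1]
  have ncut: "\<not> cut (lo t') (lo t)" using cut_once[OF m'(1), of "lo t"] m hi_eq llt by simp
  have free: "lo s \<noteq> lo t \<and> hi s \<noteq> lo t" if s: "s \<in> A" for s
  proof
    show "lo s \<noteq> lo t" using antis_eq_iff(1)[OF Y1, of s t] s t by auto
    show "hi s \<noteq> lo t"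
    proof
      assume hs: "hi s = lo t"
      then have "lo s < lo t'" using antis_less_iff[OF Y2, of s t'] s m(5) hi_eq by simp
      then show False using antis_crossing(2)[OF Y2, of s t'] s hs llt ncut by simp
    qed
  qed
  define x where "x = cube_top A"
  have x: "x \<in> Sym n" using top_Sym[OF A] by (simp add: x_def)
  have xa: "x (lo t) = lo t" unfolding x_def using free by (intro top_fixes[OF A])
  obtain i j where ij: "i \<noteq> j" "cube_top (insert t A) = Transposition.transpose i j \<circ> x"
    "i \<le> lo t" "inv x i \<le> lo t" "hi t \<le> j" "hi t \<le> inv x j"
    and S: "\<forall>S. (\<forall>s\<in>A. lo s \<in> S \<longleftrightarrow> hi s \<in> S) \<longrightarrow> (i \<in> S \<longleftrightarrow> lo t \<in> S) \<and> (j \<in> S \<longleftrightarrow> hi t \<in> S)"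
    by (rule top_label_bounds[OF Y1 t(1), folded x_def]) (rule that, assumption+)
  obtain i' j' where ij': "i' \<noteq> j'" "cube_top (insert t' A) = Transposition.transpose i' j' \<circ> x"
    "i' \<le> lo t'" "inv x i' \<le> lo t'" "hi t' \<le> j'" "hi t' \<le> inv x j'"
    and S': "\<forall>S. (\<forall>s\<in>A. lo s \<in> S \<longleftrightarrow> hi s \<in> S) \<longrightarrow> (i' \<in> S \<longleftrightarrow> lo t' \<in> S) \<and> (j' \<in> S \<longleftrightarrow> hi t' \<in> S)"
    by (rule top_label_bounds[OF Y2 t(2), folded x_def]) (rule that, assumption+)
  have i: "i = lo t" using S[THEN spec, of "{lo t}"] free by auto
  let ?r = "Transposition.transpose i j" and ?r' = "Transposition.transpose i' j'"
  have e: "edge n x (?r \<circ> x)" "edge n x (?r' \<circ> x)"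
    using top_edge[OF Y1 t(1)] top_edge[OF Y2 t(2)] ij(2) ij'(2) by (simp_all add: x_def del: o_apply)
  have ii: "i \<noteq> i'" "i \<noteq> j'" "i' \<noteq> j" "i < j" using ij ij' i llt m(5) hi_eq by auto
  then have ne: "?r \<noteq> ?r'" by (metis ij(1) transpose_apply_first transpose_apply_other)
  note w' = w(1,2)[unfolded ij(2) ij'(2)]
  have d: "w = ?r \<circ> (?r' \<circ> x) \<or> w = ?r' \<circ> (?r \<circ> x)" using diamond_top[OF x ij(1) ij'(1) e ne w'] .
  show False
  proof (cases "j = j'")
    case True
    let ?y = "?r' \<circ> x"
    have y: "?y \<in> Sym n" using edgeD[OF e(2)] by blast
    have val: "?y (inv x i') = j" "?y (inv x j) = i'" "?y (lo t) = lo t"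
      using x xa True ii i by simp_all
    have pos: "inv x i' < lo t" "lo t < inv x j" using ij(6) ij'(4) m(5) llt by auto
    have "w = Transposition.transpose i j \<circ> ?y \<or> w = Transposition.transpose i' i \<circ> ?y"
      using d True ii by (auto simp: fun_eq_iff transpose_def)
    then show False
    proof
      assume "w = Transposition.transpose i j \<circ> ?y"
      then have "edge n ?y (Transposition.transpose i j \<circ> ?y)" using w'(2) by simp
      from edge_values_cases[OF y this _ val(1)[symmetric], of "lo t"]
      show False using val i pos ii by auto
    next
      assume "w = Transposition.transpose i' i \<circ> ?y"
      then have "edge n ?y (Transposition.transpose i' i \<circ> ?y)" using w'(2) by simp
      from edge_values_cases[OF y this val(2)[symmetric], of "lo t"]
      show False using val i pos ii ij'(3) llt by auto
    qed
  next
    case jj': False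
    have "\<exists>s\<in>A. lo s = hi t"
    proof (rule ccontr)
      assume "\<not> (\<exists>s\<in>A. lo s = hi t)"
      then have "\<forall>s\<in>A. lo s \<in> {hi t} \<longleftrightarrow> hi s \<in> {hi t}" using antis_eq_iff(2)[OF Y1, of _ t] t by auto
      then have "j \<in> {hi t}" "j' \<in> {hi t}"
        using S[THEN spec, of "{hi t}"] S'[THEN spec, of "{hi t}"] hi_eq by simp_all
      then show False using jj' by simp
    qed
    then obtain s where s: "s \<in> A" "lo s = hi t" by blast
    obtain Q where Q: "\<And>u. u \<in> A \<Longrightarrow> lo u \<in> Q \<longleftrightarrow> hi u \<in> Q" "hi t \<in> Q" "Q \<subseteq> insert (hi t) {hi s..}"
      using antis_orbit_hi[OF Y1 t(1) s] by metis
    have jQ: "j \<in> Q" "j' \<in> Q" using S S' Q hi_eq by auto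
    have "inv x k \<in> Q \<longleftrightarrow> k \<in> Q" for k
      using top_invariant[OF A Q(1), of "inv x k"] x by (simp add: x_def)
    then have pQ: "inv x j \<in> Q" "inv x j' \<in> Q" using jQ by auto
    have pp: "inv x j \<noteq> inv x j'" using jj' Sym_eq_iff[OF Sym_inv[OF x]] by simp
    have "w = ?r \<circ> (?r' \<circ> x)" using d transpose_commute_disjoint[of i i' j' j x] jj' ii by metis
    then have val: "w (inv x j) = i" "w (lo t) = j" "w (inv x i') = j'" "w (inv x j') = i'"
      using x xa jj' ii i ij(1) ij'(1) by simp_all
    have "falls w (lo t) (hi s)"
    proof (cases "inv x j = hi t")
      case True
      then have "hi s \<le> inv x j'" using pp pQ Q(3) by auto
      then show ?thesis unfolding falls_def using val(4) ij'(3) llt by (intro exI[of _ "inv x j'"]) simp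
    next
      case False
      then have "hi s \<le> inv x j" using pQ Q(3) by auto
      then show ?thesis unfolding falls_def using val(1) i by (intro exI[of _ "inv x j"]) simp
    qed
    moreover have "rises w (lo t) (hi s)"
    proof (cases "j = hi t")
      case True
      then have "hi s \<le> j'" using jj' jQ Q(3) by auto
      then show ?thesis unfolding rises_def using val(3) ij'(4) llt by (intro exI[of _ "inv x i'"]) simp
    next
      case False
      then have "hi s \<le> j" using jQ Q(3) by auto
      then show ?thesis unfolding rises_def using val(2) by (intro exI[of _ "lo t"]) simp
    qed
    moreover note ms = antis_memD[OF A s(1)]
    ultimately have "refl_below (lo t) (hi s)"
      using refl_belowI[OF m(4) _ ms(6) w(3) _ w(3)] m(5) s(2) ms(5) by simp
    then show False using cut_once[of "lo t" "hi s" "hi t"] ms m s(2) by simp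
  qed
qed

text \<open>Strict nesting at both ends would make the cut of \<open>t\<close> an inner cut of
  \<open>t'\<close>, so the two share exactly one end.\<close>

lemma no_top_nested:
  assumes Y1: "insert t A \<in> antis" and Y2: "insert t' A \<in> antis" and t: "t \<notin> A" "t' \<notin> A" "t \<noteq> t'"
    and le: "lo t' \<le> lo t" "hi t \<le> hi t'"
    and w: "edge n (cube_top (insert t A)) w" "edge n (cube_top (insert t' A)) w" "bruhat_le n w v"
  shows False
proof -
  note m = antis_memD[OF Y1 insertI1] and m' = antis_memD[OF Y2 insertI1]
  have "\<not> (lo t = lo t' \<and> hi t = hi t')" using m(3) m'(3) t(3) by metis
  moreover have "\<not> (lo t' < lo t \<and> hi t < hi t')" using no_inner_cut[OF m'(1) _ m(5)] m(2) by blast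
  ultimately have "lo t = lo t' \<and> hi t < hi t' \<or> hi t = hi t' \<and> lo t' < lo t" using le by linarith
  then show False
    using no_top_common_lo[OF Y1 Y2 t(1,2) _ _ w] no_top_common_hi[OF Y1 Y2 t(1,2) _ _ w] by blast
qed

lemma insert_insert_antis:
  assumes Y1: "insert t A \<in> antis" and Y2: "insert t' A \<in> antis" and lt: "lo t < lo t'" "hi t < hi t'"
  shows "insert t (insert t' A) \<in> antis"
proof -
  note m = antis_memD[OF Y1 insertI1] and m' = antis_memD[OF Y2 insertI1]
  have "\<not> bruhat_le n t t'" "\<not> bruhat_le n t' t"
    using transpose_bruhat_le_transpose_iff[of "lo t" "hi t" n "lo t'" "hi t'"]
      transpose_bruhat_le_transpose_iff[of "lo t'" "hi t'" n "lo t" "hi t"] m m' lt by auto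
  then show ?thesis using Y1 Y2 by (auto simp: antichains_def pairwise_insert)
qed

lemma strong_cluster_id: "strong_cluster n id v I id"
  unfolding strong_cluster_def cube_top_def[symmetric] arcs_bruhat_interval_graph
proof (intro ballI impI allI)
  fix Y1 Y2 w
  assume Y: "Y1 \<in> antis" "Y2 \<in> antis" and c: "card Y1 = card Y2 \<and> card Y2 = card (Y1 \<inter> Y2) + 1"
    and w: "\<forall>Y\<in>{Y1, Y2}. (edge n (cube_top (Y1 \<inter> Y2)) (cube_top Y) \<and>
        cube_top (Y1 \<inter> Y2) \<in> interval n id v \<and> cube_top Y \<in> interval n id v) \<and>
      edge n (cube_top Y) w \<and> cube_top Y \<in> interval n id v \<and> w \<in> interval n id v"
  define A where "A = Y1 \<inter> Y2"
  have fin: "finite Y1" "finite Y2" using cube_map_finite[OF top_cube_map] Y by auto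
  have "card (Y1 - A) = 1" "card (Y2 - A) = 1"
    using fin c by (auto simp: A_def card_Diff_subset Int_commute)
  then obtain t t' where "Y1 - A = {t}" "Y2 - A = {t'}" by (auto simp: card_1_singleton_iff)
  then have t: "Y1 = insert t A" "Y2 = insert t' A" "t \<notin> A" "t' \<notin> A" "t \<noteq> t'" unfolding A_def by auto
  have w1: "edge n (cube_top (insert t A)) w" "edge n (cube_top (insert t' A)) w" "bruhat_le n w v"
    using w t interval_id by auto
  note Y' = Y[unfolded t]
  have un: "Y1 \<union> Y2 = insert t (insert t' A)" "Y1 \<union> Y2 = insert t' (insert t A)" using t by auto
  \<comment> \<open>Nesting is excluded in both directions, so one interval lies to the left of the
    other at both ends.\<close>
  have "\<not> (lo t' \<le> lo t \<and> hi t \<le> hi t')" using no_top_nested[OF Y' t(3-5) _ _ w1] by blast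
  moreover have "\<not> (lo t \<le> lo t' \<and> hi t' \<le> hi t)"
    using no_top_nested[OF Y'(2,1) t(4,3) t(5)[symmetric] _ _ w1(2,1,3)] by blast
  ultimately consider "lo t < lo t'" "hi t < hi t'" | "lo t' < lo t" "hi t' < hi t" by linarith
  then show "Y1 \<union> Y2 \<in> antis \<and> cube_top (Y1 \<union> Y2) = w"
  proof cases
    case 1
    then show ?thesis
      using insert_insert_antis[OF Y'] strong_incomparable[OF _ t(3,4) _ w1] un(1) by simp
  next
    case 2
    then show ?thesis
      using insert_insert_antis[OF Y'(2,1)] strong_incomparable[OF _ t(4,3) _ w1(2,1,3)] un(2) by simp
  qed
qed

end

theorem theorem4p1:
  fixes n :: nat and v :: perm and I :: "perm set"
  assumes "v \<in> Sym n"
    and "hypercube_decomposition n id v I"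
  shows "(\<forall>x \<in> I. property_E n v I x) \<and>
         strong_cluster n id v I id \<and>
         numerical_criterion n id v I id"
proof -
  interpret lower_decomposition n v I
    using assms by unfold_locales
  show ?thesis using property_E_I strong_cluster_id numerical_criterion_id by blast
qed

end
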